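(* Let $k\ge3$ and $\beta\ge0$. Let $G_N=(\mathbf{A}_N,\mathbf{h}_N=\mathbf{0})$ be a sequence of $k$-regular graphs, $G_N$ on vertex set $[N]$, converging locally to the $k$-regular tree, with edge weights $A_{ij}=\beta$ for all $\{i,j\}\in E(G_N)$ and $A_{ij}=0$ otherwise. Let $\mathbf{A}_N^\perp=\mathbf{P}^\perp\mathbf{A}_N\mathbf{P}^\perp$, where $\mathbf{P}^\perp=\mathbf{I}-\mathbf{1}\mathbf{1}^{T}/N$. If there is an interval $I$ of length less than $1$, independent of $N$, such that $\lambda_{\max}(\mathbf{A}_N^\perp),\lambda_{\min}(\mathbf{A}_N^\perp)\in I$, then there exists a sequence $\varepsilon_N\to0$ (with $\varepsilon_N\in(0,1)$) such that $$\lim_{N\to\infty}F_b(G_N;\varepsilon_N)=\log2+\frac{k}{2}\log\cosh(\beta).$$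
   Context: Here $\mathbf{1}\in\mathbb{R}^N$ is the all-ones vector, $\lambda_{\max},\lambda_{\min}$ denote the largest and smallest eigenvalues of a symmetric matrix, and the magnetization-constrained (balanced) free energy density is $$F_b(G_N;\varepsilon)=\frac1N\log Z_b(G_N;\varepsilon),\qquad Z_b(G_N;\varepsilon)=\sum_{\substack{\boldsymbol\sigma\in\{-1,1\}^N\\ |\langle\boldsymbol\sigma,\mathbf{1}\rangle|\le N\varepsilon}}e^{\langle\boldsymbol\sigma,\mathbf{A}_N\boldsymbol\sigma\rangle/2}.$$ Converging locally to the $k$-regular tree means (Benjamini–Schramm local weak convergence): for every fixed $r$, the fraction of vertices of $G_N$ whose radius-$r$ neighborhood is isomorphic to the radius-$r$ ball of the infinite $k$-regular tree tends to $1$. The limit is taken along those $N$ for which $G_N$ is defined. *)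

theory Defs
  imports
    "HOL-Analysis.Topology_Euclidean_Space"
    "Jordan_Normal_Form.Spectral_Radius"
begin

section \<open>Graphs, rooted balls and local convergence to the regular tree\<close>

text \<open>A simple graph is a vertex set together with a symmetric irreflexive edge relation, so that
  every edge occurs in both orientations.\<close>

definition simple_graph :: "'a set \<Rightarrow> 'a rel \<Rightarrow> bool" where
  "simple_graph V E \<longleftrightarrow> E \<subseteq> V \<times> V \<and> sym E \<and> irrefl E"

definition regular_graph :: "nat \<Rightarrow> 'a set \<Rightarrow> 'a rel \<Rightarrow> bool" where
  "regular_graph k V E \<longleftrightarrow> simple_graph V E \<and> (\<forall>v\<in>V. finite (E `` {v}) \<and> card (E `` {v}) = k)"

definition graph_ball :: "'a rel \<Rightarrow> 'a \<Rightarrow> nat \<Rightarrow> 'a set" where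
  "graph_ball E v r = {w. \<exists>n\<le>r. (v, w) \<in> E ^^ n}"

text \<open>Root-preserving isomorphism of the subgraphs induced on the radius-\<open>r\<close> balls.\<close>

definition balls_isomorphic :: "nat \<Rightarrow> 'a rel \<Rightarrow> 'a \<Rightarrow> 'b rel \<Rightarrow> 'b \<Rightarrow> bool" where
  "balls_isomorphic r E v F w \<longleftrightarrow>
     (\<exists>f. bij_betw f (graph_ball E v r) (graph_ball F w r) \<and> f v = w \<and>
        (\<forall>x\<in>graph_ball E v r. \<forall>y\<in>graph_ball E v r. (x, y) \<in> E \<longleftrightarrow> (f x, f y) \<in> F))"

text \<open>The infinite \<open>k\<close>-regular tree is realised as the Cayley graph of the free product of \<open>k\<close>
  copies of the group with two elements: the vertices are the words over \<open>k\<close> letters without two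
  equal consecutive letters, and every nonempty word is joined to its tail.  It is vertex
  transitive, so rooting it at the empty word loses nothing.\<close>

definition tree_verts :: "nat \<Rightarrow> nat list set" where
  "tree_verts k = {xs. set xs \<subseteq> {..<k} \<and> successively (\<noteq>) xs}"

definition tree_edges :: "nat \<Rightarrow> nat list rel" where
  "tree_edges k = {(xs, ys). xs \<in> tree_verts k \<and> ys \<in> tree_verts k \<and>
     (\<exists>a. ys = a # xs \<or> xs = a # ys)}"

lemma tree_edges_Image:
  assumes "xs \<in> tree_verts k"
  shows "tree_edges k `` {xs} =
    (if xs = [] then (\<lambda>a. [a]) ` {..<k} else insert (tl xs) ((\<lambda>a. a # xs) ` ({..<k} - {hd xs})))"
  using assms
  by (cases xs) (auto simp: tree_edges_def tree_verts_def successively_Cons image_iff)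

lemma tree_regular: "regular_graph k (tree_verts k) (tree_edges k)"
proof -
  have "finite (tree_edges k `` {xs}) \<and> card (tree_edges k `` {xs}) = k"
    if xs: "xs \<in> tree_verts k" for xs
  proof (cases xs)
    case Nil
    then show ?thesis
      using tree_edges_Image[OF xs] by (simp add: card_image inj_on_def)
  next
    case (Cons a ys)
    have "a < k" using xs Cons by (auto simp: tree_verts_def)
    moreover have "ys \<notin> (\<lambda>b. b # a # ys) ` ({..<k} - {a})"
      by (metis (no_types, lifting) imageE length_Cons lessI less_SucI less_irrefl)
    ultimately show ?thesis
      using tree_edges_Image[OF xs] Cons
      by (simp add: card_image inj_on_def card_insert_if)
  qed
  then show ?thesis
    by (auto simp: regular_graph_def simple_graph_def tree_edges_def sym_def irrefl_def)
qed

lemma tree_connected: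
  assumes "xs \<in> tree_verts k"
  shows "([], xs) \<in> (tree_edges k)\<^sup>*"
  using assms
proof (induction xs)
  case (Cons a xs)
  then have xs: "xs \<in> tree_verts k"
    by (auto simp: tree_verts_def successively_Cons)
  with Cons.prems have "(xs, a # xs) \<in> tree_edges k"
    by (auto simp: tree_edges_def)
  with Cons.IH[OF xs] show ?case
    by (rule rtrancl_into_rtrancl)
qed simp

lemma tree_acyclic:
  assumes "length c \<ge> 3" "distinct c"
  shows "\<exists>i<length c. (c ! i, c ! (Suc i mod length c)) \<notin> tree_edges k"
proof (rule ccontr)
  let ?n = "length c"
  assume "\<not> ?thesis"
  then have E: "(c ! i, c ! (Suc i mod ?n)) \<in> tree_edges k" if "i < ?n" for i
    using that by blast
  have tl_if: "xs = tl ys" if "(xs, ys) \<in> tree_edges k \<or> (ys, xs) \<in> tree_edges k"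
    "length xs \<le> length ys" for xs ys
    using that by (auto simp: tree_edges_def)
  define i where "i = (ARG_MAX (\<lambda>i. length (c ! i)) i. i < ?n)"
  have n0: "0 < ?n" using assms(1) by linarith
  have i: "i < ?n" "\<And>j. j < ?n \<Longrightarrow> length (c ! j) \<le> length (c ! i)"
    using arg_max_nat_lemma[of "\<lambda>i. i < ?n" 0 "\<lambda>i. length (c ! i)"
        "Suc (Max ((\<lambda>i. length (c ! i)) ` {..<?n}))"] n0
    by (auto simp: i_def less_Suc_eq_le)
  define p where "p = (if i = 0 then ?n - 1 else i - 1)"
  define s where "s = Suc i mod ?n"
  have p: "p < ?n" "Suc p mod ?n = i" using i(1) n0 by (auto simp: p_def)
  have s: "s < ?n" using n0 by (simp add: s_def)
  have "c ! p = tl (c ! i)" using tl_if E[OF p(1)] p i(2) by auto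
  moreover have "c ! s = tl (c ! i)" using tl_if E[OF i(1)] s i(2) by (auto simp: s_def)
  ultimately have "p = s" using nth_eq_iff_index_eq[OF assms(2) p(1) s] by simp
  moreover have "p \<noteq> s"
    using i(1) assms(1) by (auto simp: p_def s_def mod_Suc split: if_splits)
  ultimately show False by simp
qed

text \<open>Sequences of graphs are indexed by the numbers \<open>N\<close> of vertices in an infinite set \<open>S\<close>, and the
  vertex set of size \<open>N\<close> is \<open>{..<N}\<close>.  Limits are taken along \<open>S\<close>.\<close>

abbreviation along :: "nat set \<Rightarrow> nat filter" where
  "along S \<equiv> inf sequentially (principal S)"

definition converges_locally_to_tree :: "nat \<Rightarrow> nat set \<Rightarrow> (nat \<Rightarrow> nat rel) \<Rightarrow> bool" where
  "converges_locally_to_tree k S E \<longleftrightarrow>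
     (\<forall>r. ((\<lambda>N. real (card {v\<in>{..<N}. balls_isomorphic r (E N) v (tree_edges k) []}) / real N)
        \<longlongrightarrow> 1) (along S))"


section \<open>Interaction matrices and the balanced free energy\<close>

definition interaction_mat :: "real \<Rightarrow> nat \<Rightarrow> nat rel \<Rightarrow> real mat" where
  "interaction_mat \<beta> N E = mat N N (\<lambda>(i, j). if (i, j) \<in> E then \<beta> else 0)"

definition ones :: "nat \<Rightarrow> real vec" where
  "ones N = vec N (\<lambda>_. 1)"

definition proj_perp :: "nat \<Rightarrow> real mat" where
  "proj_perp N = 1\<^sub>m N - (1 / real N) \<cdot>\<^sub>m (mat_of_cols N [ones N] * mat_of_rows N [ones N])"

definition compress_perp :: "real mat \<Rightarrow> real mat" where
  "compress_perp A = proj_perp (dim_row A) * A * proj_perp (dim_row A)"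

definition lambda_max :: "real mat \<Rightarrow> real" where
  "lambda_max A = Max (spectrum A)"

definition lambda_min :: "real mat \<Rightarrow> real" where
  "lambda_min A = Min (spectrum A)"

definition spin_configs :: "nat \<Rightarrow> real vec set" where
  "spin_configs N = {\<sigma> \<in> carrier_vec N. \<forall>i<N. \<sigma> $ i \<in> {-1, 1}}"

definition Z_b :: "real mat \<Rightarrow> real \<Rightarrow> real" where
  "Z_b A \<epsilon> = (let N = dim_row A in
     \<Sum>\<sigma> | \<sigma> \<in> spin_configs N \<and> \<bar>scalar_prod \<sigma> (ones N)\<bar> \<le> real N * \<epsilon>.
       exp (scalar_prod \<sigma> (A *\<^sub>v \<sigma>) / 2))"

definition F_b :: "real mat \<Rightarrow> real \<Rightarrow> real" where
  "F_b A \<epsilon> = 1 / real (dim_row A) * ln (Z_b A \<epsilon>)"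

lemma finite_spin_configs: "finite (spin_configs N)"
proof -
  have "spin_configs N \<subseteq> vec_of_list ` {xs. set xs \<subseteq> {-1, 1} \<and> length xs = N}"
  proof
    fix \<sigma> assume s: "\<sigma> \<in> spin_configs N"
    then have "set (list_of_vec \<sigma>) \<subseteq> {-1, 1} \<and> length (list_of_vec \<sigma>) = N"
      by (auto simp: spin_configs_def in_set_conv_nth list_of_vec_index)
    then show "\<sigma> \<in> vec_of_list ` {xs. set xs \<subseteq> {-1, 1} \<and> length xs = N}"
      by (metis (mono_tags, lifting) image_eqI mem_Collect_eq vec_list)
  qed
  then show ?thesis
    by (rule finite_subset) (simp add: finite_lists_length_eq)
qed

end

theory Submission
  imports Defs "HOL-Real_Asymp.Real_Asymp" "HOL-Analysis.Function_Topology"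
begin

text \<open>
  On the balanced configurations the energy of the graph differs from the quadratic form of the
  compressed matrix only by a term of order \<open>N \<epsilon>\<^sup>2\<close>, so the theorem is about the
  Ising measure whose interaction is the compressed matrix, multiplied by a parameter
  \<open>t \<in> [0, 1]\<close>.  Its free energy is \<open>ln 2\<close> at \<open>t = 0\<close>, and its derivative in
  \<open>t\<close> is, up to the square of the magnetization, the average correlation of the two ends of an
  edge.  The limit follows by the mean value theorem once these edge correlations are shown to be
  close to \<open>tanh (t \<beta>)\<close>, the value for two spins joined by a single edge, uniformly in
  \<open>t\<close> (\<open>perp_free_energy\<close>).

  The spectral hypothesis enters through a Poincare inequality for single spin flips, with a
  constant that does not depend on \<open>N\<close> (\<open>poincare_quadratic\<close>).  After a multiple of the
  identity has been added the interaction is positive semidefinite of norm below one, hence a sum of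
  squares of linear functions.  By the Hubbard--Stratonovich identity the measure is then a mixture
  of Ising measures with a weaker interaction and a random external field, and the variance splits
  into the mean variance of the components and the variance of their means.  The gradient of the
  mean with respect to the field consists of covariances with spins, and these are controlled by the
  inequality already proved for the components.  For an interaction \<open>s J\<close> with
  \<open>0 \<le> J \<le> j\<close> the constant \<open>K s\<close> therefore satisfies \<open>K' \<le> j K\<^sup>2\<close> and
  \<open>K 0 = 1\<close>, which stays bounded up to \<open>s = 1\<close> precisely because \<open>j < 1\<close>.  The
  Gaussian field is replaced by a random walk with small steps, so that all measures have finite
  support and no integral occurs.

  Let \<open>(i, j)\<close> be an edge whose neighbourhood is a tree.  Given \<open>\<sigma> i\<close> and the spins at
  depth \<open>r\<close> below \<open>j\<close>, the mean of \<open>\<sigma> j\<close> in the graph measure is an explicit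
  function of \<open>\<sigma> i\<close> and of one message, computed from the leaves by the tree recursion
  (\<open>edge_conditional_mean\<close>); if the message were zero, the correlation would be exactly
  \<open>tanh (t \<beta>)\<close>.  The message has mean zero by symmetry.  Flipping one leaf changes it by at
  most a constant times the \<open>r\<close>-th power of about \<open>\<beta>\<close>, so that the sum of the squared
  changes is of order \<open>((k - 1) \<beta>\<^sup>2) ^ r\<close> (\<open>message_gradient\<close>).  As \<open>N\<close>
  grows, the spectral hypothesis forces \<open>4 k \<beta>\<^sup>2 \<le> 1\<close> (\<open>degree_bound\<close>), hence by the Poincare inequality the
  message tends to zero in mean square as \<open>r\<close> grows.  The mean-field term contained in the
  compressed matrix disturbs the conditional mean only by a factor close to one, because the
  magnetization is of order \<open>sqrt N\<close> by the same inequality (\<open>edge_correlation\<close>).  The same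
  estimate shows that a window \<open>\<epsilon>\<close> of order \<open>N\<close> to the power \<open>-1/4\<close> carries almost
  all of the measure, which transfers the result to the balanced partition function (\<open>balanced_free_energy\<close>).
\<close>

section \<open>Weighted averages over finite sets\<close>

definition pos_weight :: "'s set \<Rightarrow> ('s \<Rightarrow> real) \<Rightarrow> bool" where
  "pos_weight S w \<longleftrightarrow> finite S \<and> S \<noteq> {} \<and> (\<forall>s\<in>S. 0 < w s)"

text \<open>Weights are not normalised, so that tilting a measure is multiplication of its weight.\<close>

definition avg :: "'s set \<Rightarrow> ('s \<Rightarrow> real) \<Rightarrow> ('s \<Rightarrow> real) \<Rightarrow> real" where
  "avg S w f = (\<Sum>s\<in>S. w s * f s) / (\<Sum>s\<in>S. w s)"

definition var :: "'s set \<Rightarrow> ('s \<Rightarrow> real) \<Rightarrow> ('s \<Rightarrow> real) \<Rightarrow> real" where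
  "var S w f = avg S w (\<lambda>s. (f s - avg S w f)\<^sup>2)"

lemma pos_weight_sum: "pos_weight S w \<Longrightarrow> 0 < (\<Sum>s\<in>S. w s)"
  unfolding pos_weight_def by (intro sum_pos) auto

lemma avg_add: "avg S w (\<lambda>s. f s + g s) = avg S w f + avg S w g"
  unfolding avg_def by (simp add: distrib_left sum.distrib add_divide_distrib)

lemma avg_diff: "avg S w (\<lambda>s. f s - g s) = avg S w f - avg S w g"
  unfolding avg_def by (simp add: right_diff_distrib sum_subtractf diff_divide_distrib)

lemma avg_cmult: "avg S w (\<lambda>s. c * f s) = c * avg S w f"
  unfolding avg_def by (simp add: sum_distrib_left mult.left_commute)

lemma avg_sum: "avg S w (\<lambda>s. \<Sum>i\<in>A. f i s) = (\<Sum>i\<in>A. avg S w (f i))"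
  unfolding avg_def by (simp add: sum_distrib_left sum_divide_distrib sum.swap[of _ A S])

lemma avg_const: "pos_weight S w \<Longrightarrow> avg S w (\<lambda>_. c) = c"
  using pos_weight_sum[of S w] unfolding avg_def by (simp flip: sum_distrib_right)

lemma avg_cong: "(\<And>s. s \<in> S \<Longrightarrow> f s = g s) \<Longrightarrow> avg S w f = avg S w g"
  unfolding avg_def by (metis (no_types, lifting) sum.cong)

lemma avg_mono:
  assumes "pos_weight S w" "\<And>s. s \<in> S \<Longrightarrow> f s \<le> g s"
  shows "avg S w f \<le> avg S w g"
proof -
  have "(\<Sum>s\<in>S. w s * f s) \<le> (\<Sum>s\<in>S. w s * g s)"
    using assms by (intro sum_mono mult_left_mono) (auto simp: pos_weight_def less_imp_le)
  then show ?thesis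
    unfolding avg_def using pos_weight_sum[OF assms(1)] by (simp add: divide_right_mono)
qed

lemma avg_nonneg:
  assumes "pos_weight S w" "\<And>s. s \<in> S \<Longrightarrow> 0 \<le> f s"
  shows "0 \<le> avg S w f"
  using avg_mono[OF assms(1), of "\<lambda>_. 0" f] avg_const[OF assms(1), of 0] assms(2) by simp

lemma avg_abs:
  assumes "pos_weight S w"
  shows "\<bar>avg S w f\<bar> \<le> avg S w (\<lambda>s. \<bar>f s\<bar>)"
proof -
  have "avg S w f \<le> avg S w (\<lambda>s. \<bar>f s\<bar>)" by (rule avg_mono[OF assms]) auto
  moreover have "avg S w (\<lambda>s. (-1) * f s) \<le> avg S w (\<lambda>s. \<bar>f s\<bar>)"
    by (rule avg_mono[OF assms]) auto
  ultimately show ?thesis using avg_cmult[of S w "-1" f] by linarith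
qed

lemma avg_scale: "c \<noteq> 0 \<Longrightarrow> avg S (\<lambda>s. c * w s) f = avg S w f"
  unfolding avg_def by (simp add: mult.assoc flip: sum_distrib_left)

lemma avg_sq_shift:
  assumes "pos_weight S w"
  shows "avg S w (\<lambda>s. (f s - c)\<^sup>2) = var S w f + (avg S w f - c)\<^sup>2"
proof -
  let ?m = "avg S w f"
  have "avg S w (\<lambda>s. (f s - c)\<^sup>2)
      = avg S w (\<lambda>s. (f s - ?m)\<^sup>2 + (2 * (?m - c) * (f s - ?m) + (?m - c)\<^sup>2))"
    by (rule avg_cong) (simp add: power2_eq_square algebra_simps)
  also have "\<dots> = var S w f + (2 * (?m - c) * (?m - ?m) + (?m - c)\<^sup>2)"
    by (simp only: avg_add avg_cmult avg_diff avg_const[OF assms] var_def)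
  finally show ?thesis by simp
qed

lemma var_le_avg_sq_shift:
  "pos_weight S w \<Longrightarrow> var S w f \<le> avg S w (\<lambda>s. (f s - c)\<^sup>2)"
  by (simp add: avg_sq_shift)

lemma var_eq:
  "pos_weight S w \<Longrightarrow> var S w f = avg S w (\<lambda>s. (f s)\<^sup>2) - (avg S w f)\<^sup>2"
  using avg_sq_shift[of S w f 0] by simp

lemma var_nonneg: "pos_weight S w \<Longrightarrow> 0 \<le> var S w f"
  unfolding var_def by (rule avg_nonneg) auto

lemma avg_Cauchy_Schwarz:
  assumes "pos_weight S w"
  shows "(avg S w (\<lambda>s. f s * g s))\<^sup>2 \<le> avg S w (\<lambda>s. (f s)\<^sup>2) * avg S w (\<lambda>s. (g s)\<^sup>2)"
proof -
  let ?a = "avg S w (\<lambda>s. (f s)\<^sup>2)" and ?b = "avg S w (\<lambda>s. f s * g s)"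
    and ?c = "avg S w (\<lambda>s. (g s)\<^sup>2)"
  have *: "0 \<le> x\<^sup>2 * ?a + 2 * x * y * ?b + y\<^sup>2 * ?c" for x y
  proof -
    have "0 \<le> avg S w (\<lambda>s. (x * f s + y * g s)\<^sup>2)" by (rule avg_nonneg[OF assms]) auto
    also have "\<dots> = avg S w (\<lambda>s. x\<^sup>2 * (f s)\<^sup>2 + 2 * x * y * (f s * g s) + y\<^sup>2 * (g s)\<^sup>2)"
      by (rule avg_cong) (simp add: power2_eq_square algebra_simps)
    finally show ?thesis by (simp only: avg_add avg_cmult)
  qed
  have a: "0 \<le> ?a" and c: "0 \<le> ?c" by (auto intro: avg_nonneg[OF assms])
  show ?thesis
  proof (cases "?a = 0")
    case True
    have "?b = 0"
    proof (rule ccontr)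
      assume b: "?b \<noteq> 0"
      have "0 \<le> 2 * (- (?c + 1) / (2 * ?b)) * 1 * ?b + 1\<^sup>2 * ?c"
        using *[of "- (?c + 1) / (2 * ?b)" 1] True by simp
      then show False using b by (simp add: field_simps)
    qed
    then show ?thesis using True by simp
  next
    case False
    then have "0 < ?a" using a by simp
    moreover have "0 \<le> ?a * (?a * ?c - ?b\<^sup>2)"
      using *[of "- ?b" "?a"] by (simp add: power2_eq_square algebra_simps)
    ultimately show ?thesis by (simp add: zero_le_mult_iff)
  qed
qed

text \<open>The factor \<open>exp d\<close> is lost twice, in the numerator and in the normalisation.\<close>

lemma avg_le_exp_mult:
  assumes w: "pos_weight S w" and w': "pos_weight S w'"
    and ratio: "\<And>s. s \<in> S \<Longrightarrow> w s \<le> w' s * exp d \<and> w' s \<le> w s * exp d"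
    and f: "\<And>s. s \<in> S \<Longrightarrow> 0 \<le> f s"
  shows "avg S w f \<le> exp (2 * d) * avg S w' f"
proof -
  have 1: "(\<Sum>s\<in>S. w s * f s) \<le> exp d * (\<Sum>s\<in>S. w' s * f s)"
    unfolding sum_distrib_left
    by (intro sum_mono) (metis f ratio mult.assoc mult.commute mult_right_mono)
  have 2: "(\<Sum>s\<in>S. w' s) \<le> exp d * (\<Sum>s\<in>S. w s)"
    unfolding sum_distrib_left
    by (intro sum_mono) (metis ratio mult.commute)
  have 0: "0 \<le> (\<Sum>s\<in>S. w' s * f s)"
    using w' f by (intro sum_nonneg) (auto simp: pos_weight_def less_imp_le)
  have "avg S w f \<le> (exp d * (\<Sum>s\<in>S. w' s * f s)) / (\<Sum>s\<in>S. w s)"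
    unfolding avg_def using 1 pos_weight_sum[OF w] by (simp add: divide_right_mono)
  also have "\<dots> \<le> (exp d * (\<Sum>s\<in>S. w' s * f s)) / ((\<Sum>s\<in>S. w' s) / exp d)"
    using 0 2 pos_weight_sum[OF w] pos_weight_sum[OF w']
    by (intro divide_left_mono) (auto simp: field_simps)
  also have "\<dots> = exp (2 * d) * avg S w' f"
    unfolding avg_def by (simp add: exp_double power2_eq_square)
  finally show ?thesis .
qed

section \<open>The spin cube and product measures\<close>

text \<open>Configurations vanish outside \<open>V\<close>; this keeps the cube finite and closed under negation.\<close>

definition cube :: "'a set \<Rightarrow> ('a \<Rightarrow> real) set" where
  "cube V = {\<sigma>. (\<forall>i\<in>V. \<sigma> i \<in> {-1, 1}) \<and> (\<forall>i. i \<notin> V \<longrightarrow> \<sigma> i = 0)}"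

definition flip :: "'a \<Rightarrow> ('a \<Rightarrow> real) \<Rightarrow> 'a \<Rightarrow> real" where
  "flip i \<sigma> = \<sigma>(i := - \<sigma> i)"

definition lin :: "'a set \<Rightarrow> ('a \<Rightarrow> real) \<Rightarrow> ('a \<Rightarrow> real) \<Rightarrow> real" where
  "lin V h x = (\<Sum>i\<in>V. h i * x i)"

text \<open>With the factor \<open>1/4\<close> a linear function has the squared norm of its coefficients as Dirichlet
  form, so a Poincare constant is at the same time a bound for the covariance matrix of the spins.\<close>

definition dirichlet :: "'a set \<Rightarrow> (('a \<Rightarrow> real) \<Rightarrow> real) \<Rightarrow> ('a \<Rightarrow> real) \<Rightarrow> real" where
  "dirichlet V f \<sigma> = (\<Sum>i\<in>V. (f \<sigma> - f (flip i \<sigma>))\<^sup>2 / 4)"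

definition poincare :: "'a set \<Rightarrow> (('a \<Rightarrow> real) \<Rightarrow> real) \<Rightarrow> real \<Rightarrow> bool" where
  "poincare V w K \<longleftrightarrow> (\<forall>f. var (cube V) w f \<le> K * avg (cube V) w (dirichlet V f))"

lemma cube_empty: "cube {} = {\<lambda>_. 0}"
  unfolding cube_def by auto

lemma cube_insert:
  assumes "a \<notin> V"
  shows "cube (insert a V) = (\<lambda>\<sigma>. \<sigma>(a := 1)) ` cube V \<union> (\<lambda>\<sigma>. \<sigma>(a := -1)) ` cube V"
proof (intro equalityI subsetI)
  fix \<sigma> assume s: "\<sigma> \<in> cube (insert a V)"
  have "\<sigma>(a := 0) \<in> cube V" using s assms by (auto simp: cube_def)
  moreover have "\<sigma> = (\<sigma>(a := 0))(a := \<sigma> a)" by auto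
  moreover have "\<sigma> a = 1 \<or> \<sigma> a = -1" using s by (auto simp: cube_def)
  ultimately show "\<sigma> \<in> (\<lambda>\<sigma>. \<sigma>(a := 1)) ` cube V \<union> (\<lambda>\<sigma>. \<sigma>(a := -1)) ` cube V"
    by (metis UnI1 UnI2 image_eqI)
qed (use assms in \<open>auto simp: cube_def split: if_splits\<close>)

lemma finite_cube: "finite V \<Longrightarrow> finite (cube V)"
  by (induction V rule: finite_induct) (auto simp: cube_empty cube_insert)

lemma cube_nonempty: "cube V \<noteq> {}"
proof -
  have "(\<lambda>i. if i \<in> V then 1 else 0) \<in> cube V" by (auto simp: cube_def)
  then show ?thesis by blast
qed

lemma cube_inj: "a \<notin> V \<Longrightarrow> inj_on (\<lambda>\<sigma>. \<sigma>(a := c)) (cube V)"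
  unfolding inj_on_def cube_def by (auto simp: fun_eq_iff) metis

lemma sum_cube_insert:
  assumes "finite V" "a \<notin> V"
  shows "(\<Sum>\<sigma>\<in>cube (insert a V). F \<sigma>) =
    (\<Sum>\<sigma>\<in>cube V. F (\<sigma>(a := 1))) + (\<Sum>\<sigma>\<in>cube V. F (\<sigma>(a := -1)))"
proof -
  have "(\<lambda>\<sigma>. \<sigma>(a := 1)) ` cube V \<inter> (\<lambda>\<sigma>. \<sigma>(a := -1)) ` cube V = {}"
    by (auto simp: fun_eq_iff) (metis one_neq_neg_one)
  then show ?thesis
    unfolding cube_insert[OF assms(2)]
    using assms finite_cube by (subst sum.union_disjoint) (auto simp: sum.reindex[OF cube_inj])
qed

lemma flip_cube: "\<sigma> \<in> cube V \<Longrightarrow> i \<in> V \<Longrightarrow> flip i \<sigma> \<in> cube V"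
  by (auto simp: cube_def flip_def)

lemma flip_flip: "flip i (flip i \<sigma>) = \<sigma>"
  by (auto simp: flip_def)

lemma sum_cube_flip: "i \<in> V \<Longrightarrow> (\<Sum>\<sigma>\<in>cube V. F (flip i \<sigma>)) = (\<Sum>\<sigma>\<in>cube V. F \<sigma>)"
  by (rule sum.reindex_bij_witness[of _ "flip i" "flip i"]) (auto simp: flip_cube flip_flip)

lemma sum_cube_uminus: "(\<Sum>\<sigma>\<in>cube V. F (- \<sigma>)) = (\<Sum>\<sigma>\<in>cube V. F \<sigma>)"
  by (rule sum.reindex_bij_witness[of _ uminus uminus]) (auto simp: cube_def)

lemma cube_sq: "\<sigma> \<in> cube V \<Longrightarrow> i \<in> V \<Longrightarrow> \<sigma> i * \<sigma> i = 1"
  by (auto simp: cube_def)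

lemma cube_abs: "\<sigma> \<in> cube V \<Longrightarrow> i \<in> V \<Longrightarrow> \<bar>\<sigma> i\<bar> = 1"
  by (auto simp: cube_def)

lemma pos_weight_cube:
  "finite V \<Longrightarrow> (\<And>\<sigma>. \<sigma> \<in> cube V \<Longrightarrow> 0 < w \<sigma>) \<Longrightarrow> pos_weight (cube V) w"
  unfolding pos_weight_def using finite_cube cube_nonempty by auto

lemma dirichlet_nonneg: "0 \<le> dirichlet V f \<sigma>"
  unfolding dirichlet_def by (intro sum_nonneg) auto

lemma dirichlet_lin:
  assumes "finite V" "\<sigma> \<in> cube V"
  shows "dirichlet V (lin V h) \<sigma> = (\<Sum>i\<in>V. (h i)\<^sup>2)"
proof -
  have "(lin V h \<sigma> - lin V h (flip i \<sigma>))\<^sup>2 / 4 = (h i)\<^sup>2" if i: "i \<in> V" for i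
  proof -
    have "lin V h \<sigma> - lin V h (flip i \<sigma>) = (\<Sum>j\<in>V. if j = i then 2 * h i * \<sigma> i else 0)"
      unfolding lin_def by (subst sum_subtractf[symmetric], rule sum.cong) (auto simp: flip_def)
    also have "\<dots> = 2 * h i * \<sigma> i" using i assms by simp
    finally show ?thesis using cube_sq[OF assms(2) i] by (simp add: power2_eq_square)
  qed
  then show ?thesis unfolding dirichlet_def by simp
qed

text \<open>The Efron--Stein inequality.  Conditioning on the last spin splits the variance into the mean
  variance of the two restrictions and \<open>p q\<close> times the squared difference of their means; here
  \<open>p q \<le> 1/4\<close>, and by Cauchy--Schwarz the squared difference of the means is at most the mean of
  the squared difference, which is the contribution of the last spin to the Dirichlet form.\<close>

lemma poincare_product: 
  assumes "finite V"
  shows "poincare V (\<lambda>\<sigma>. exp (lin V h \<sigma>)) 1"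
  using assms
proof (induction V rule: finite_induct)
  case empty
  then show ?case by (simp add: poincare_def var_def avg_def cube_empty dirichlet_def)
next
  case (insert a V)
  let ?w = "\<lambda>\<sigma>. exp (lin V h \<sigma>)"
  let ?W = "\<lambda>\<sigma>. exp (lin (insert a V) h \<sigma>)"
  let ?E = "avg (cube V) ?w"
  define p where "p = exp (h a) / (exp (h a) + exp (- h a))"
  define q where "q = exp (- h a) / (exp (h a) + exp (- h a))"
  have pw: "pos_weight (cube V) ?w" by (rule pos_weight_cube) (use insert in auto)
  have pW: "pos_weight (cube (insert a V)) ?W" by (rule pos_weight_cube) (use insert in auto)
  have "0 < exp (h a) + exp (- h a)" by (simp add: add_pos_pos)
  then have pq: "0 < p" "0 < q" "p + q = 1"
    unfolding p_def q_def by (auto simp flip: add_divide_distrib)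
  have "4 * (p * q) \<le> (p + q)\<^sup>2"
    using sum_squares_bound[of p q] by (simp add: power2_eq_square algebra_simps)
  with pq have pq4: "p * q \<le> 1 / 4" by simp
  have lin_upd: "lin (insert a V) h (\<sigma>(a := c)) = h a * c + lin V h \<sigma>" for \<sigma> c
    unfolding lin_def using insert by (auto intro: sum.cong)
  have split: "avg (cube (insert a V)) ?W F
      = p * ?E (\<lambda>\<sigma>. F (\<sigma>(a := 1))) + q * ?E (\<lambda>\<sigma>. F (\<sigma>(a := -1)))" for F
  proof -
    let ?Z = "\<Sum>\<sigma>\<in>cube V. ?w \<sigma>"
    have Z: "0 < ?Z" using pos_weight_sum[OF pw] .
    have "(\<Sum>\<sigma>\<in>cube (insert a V). ?W \<sigma>) = exp (h a) * ?Z + exp (- h a) * ?Z"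
      using insert by (simp add: sum_cube_insert lin_upd exp_add exp_diff exp_minus sum_distrib_left divide_inverse mult.commute)
    moreover have "(\<Sum>\<sigma>\<in>cube (insert a V). ?W \<sigma> * F \<sigma>)
        = exp (h a) * (\<Sum>\<sigma>\<in>cube V. ?w \<sigma> * F (\<sigma>(a := 1)))
          + exp (- h a) * (\<Sum>\<sigma>\<in>cube V. ?w \<sigma> * F (\<sigma>(a := -1)))"
      using insert by (simp add: sum_cube_insert lin_upd exp_add exp_diff exp_minus sum_distrib_left divide_inverse ac_simps)
    moreover have "exp (h a) * ?Z + exp (- h a) * ?Z = (exp (h a) + exp (- h a)) * ?Z"
      by (simp add: algebra_simps)
    ultimately show ?thesis
      unfolding avg_def p_def q_def using Z by (simp add: add_divide_distrib)
  qed
  show ?case unfolding poincare_def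
  proof
    fix f :: "('a \<Rightarrow> real) \<Rightarrow> real"
    let ?f1 = "\<lambda>\<sigma>. f (\<sigma>(a := 1))" and ?f2 = "\<lambda>\<sigma>. f (\<sigma>(a := -1))"
    let ?m1 = "?E ?f1" and ?m2 = "?E ?f2"
    have "var (cube (insert a V)) ?W f
        = p * (var (cube V) ?w ?f1 + ?m1\<^sup>2) + q * (var (cube V) ?w ?f2 + ?m2\<^sup>2)
          - (p * ?m1 + q * ?m2)\<^sup>2"
      unfolding var_eq[OF pW] split var_eq[OF pw] by simp
    also have "\<dots> = p * var (cube V) ?w ?f1 + q * var (cube V) ?w ?f2 + p * q * (?m1 - ?m2)\<^sup>2"
    proof -
      have q: "q = 1 - p" using pq by simp
      show ?thesis unfolding q by (simp add: power2_eq_square algebra_simps)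
    qed
    also have "\<dots> \<le> p * ?E (dirichlet V ?f1) + q * ?E (dirichlet V ?f2)
        + 1 / 4 * ?E (\<lambda>\<sigma>. (?f1 \<sigma> - ?f2 \<sigma>)\<^sup>2)"
    proof -
      have "var (cube V) ?w g \<le> ?E (dirichlet V g)" for g
        using insert.IH by (simp add: poincare_def)
      moreover have "(?m1 - ?m2)\<^sup>2 \<le> ?E (\<lambda>\<sigma>. (?f1 \<sigma> - ?f2 \<sigma>)\<^sup>2)"
        using avg_Cauchy_Schwarz[OF pw, of "\<lambda>_. 1" "\<lambda>\<sigma>. ?f1 \<sigma> - ?f2 \<sigma>"]
        by (simp add: avg_const[OF pw] avg_diff)
      ultimately show ?thesis
        using pq pq4 by (intro add_mono mult_left_mono mult_mono) auto
    qed
    also have "\<dots> = avg (cube (insert a V)) ?W (dirichlet (insert a V) f)"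
    proof -
      have fl: "flip i (\<sigma>(a := c)) = (flip i \<sigma>)(a := c)" if "i \<in> V" for i \<sigma> and c :: real
        using that insert by (auto simp: flip_def)
      have "dirichlet (insert a V) f (\<sigma>(a := c)) = dirichlet V (\<lambda>\<sigma>. f (\<sigma>(a := c))) \<sigma>
          + (f (\<sigma>(a := c)) - f (\<sigma>(a := - c)))\<^sup>2 / 4" for \<sigma> and c :: real
        unfolding dirichlet_def using insert by (simp add: fl) (simp add: flip_def)
      then have "avg (cube (insert a V)) ?W (dirichlet (insert a V) f)
        = p * (?E (dirichlet V ?f1) + 1 / 4 * ?E (\<lambda>\<sigma>. (?f1 \<sigma> - ?f2 \<sigma>)\<^sup>2))
        + q * (?E (dirichlet V ?f2) + 1 / 4 * ?E (\<lambda>\<sigma>. (?f2 \<sigma> - ?f1 \<sigma>)\<^sup>2))"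
        unfolding split by (simp add: avg_add flip: avg_cmult)
      also have "(\<lambda>\<sigma>. (?f2 \<sigma> - ?f1 \<sigma>)\<^sup>2) = (\<lambda>\<sigma>. (?f1 \<sigma> - ?f2 \<sigma>)\<^sup>2)"
        by (simp add: power2_commute)
      also have "p * (?E (dirichlet V ?f1) + 1 / 4 * ?E (\<lambda>\<sigma>. (?f1 \<sigma> - ?f2 \<sigma>)\<^sup>2))
        + q * (?E (dirichlet V ?f2) + 1 / 4 * ?E (\<lambda>\<sigma>. (?f1 \<sigma> - ?f2 \<sigma>)\<^sup>2))
        = p * ?E (dirichlet V ?f1) + q * ?E (dirichlet V ?f2)
        + (p + q) * (1 / 4 * ?E (\<lambda>\<sigma>. (?f1 \<sigma> - ?f2 \<sigma>)\<^sup>2))"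
        by (simp only: algebra_simps)
      finally show ?thesis using pq by simp
    qed
    finally show "var (cube (insert a V)) ?W f
      \<le> 1 * avg (cube (insert a V)) ?W (dirichlet (insert a V) f)" by simp
  qed
qed

section \<open>The Poincare inequality for interactions of spectral width below one\<close>

lemma poincareD: "poincare V w K \<Longrightarrow> var (cube V) w f \<le> K * avg (cube V) w (dirichlet V f)"
  by (simp add: poincare_def)

lemma poincare_mono:
  assumes "poincare V w K" "K \<le> K'" "finite V" "\<And>\<sigma>. \<sigma> \<in> cube V \<Longrightarrow> 0 < w \<sigma>"
  shows "poincare V w K'"
proof -
  have "pos_weight (cube V) w" using assms by (intro pos_weight_cube)
  then have "0 \<le> avg (cube V) w (dirichlet V f)" for f
    by (rule avg_nonneg) (rule dirichlet_nonneg)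
  then show ?thesis
    using assms(1,2) unfolding poincare_def by (meson mult_right_mono order_trans)
qed

lemma avg_tilt:
  assumes "pos_weight S w" "\<And>s. s \<in> S \<Longrightarrow> 0 < \<phi> s"
  shows "avg S (\<lambda>s. w s * \<phi> s) F = avg S w (\<lambda>s. \<phi> s * F s) / avg S w \<phi>"
  using pos_weight_sum[OF assms(1)] unfolding avg_def by (simp add: mult.assoc)

lemma exp_minus_linear_bound:
  fixes x :: real
  assumes "\<bar>x\<bar> \<le> 1"
  shows "\<bar>exp x - 1 - x\<bar> \<le> x\<^sup>2"
proof (cases "0 \<le> x")
  case True
  then show ?thesis
    using exp_bound[of x] exp_ge_add_one_self[of x] assms unfolding abs_le_iff by linarith
next
  case False
  have "1 - x \<le> exp (- x)" using exp_ge_add_one_self[of "- x"] by simp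
  then have "exp x \<le> 1 / (1 - x)"
    using False by (simp add: exp_minus field_simps)
  also have "\<dots> \<le> 1 + x + x\<^sup>2"
  proof -
    have "(1 + x + x\<^sup>2) * (1 - x) = 1 - x * x\<^sup>2" by (simp add: algebra_simps power2_eq_square)
    moreover have "x * x\<^sup>2 \<le> 0" using False by (simp add: mult_nonpos_nonneg)
    ultimately show ?thesis using False by (simp add: divide_le_eq)
  qed
  finally show ?thesis
    using exp_ge_add_one_self[of x] zero_le_power2[of x] unfolding abs_le_iff by linarith
qed

lemma lin_add: "lin V (\<lambda>i. h i + g i) x = lin V h x + lin V g x"
  unfolding lin_def by (simp add: distrib_right sum.distrib)

lemma lin_cmult: "lin V (\<lambda>i. c * h i) x = c * lin V h x"
  unfolding lin_def by (simp add: sum_distrib_left mult.assoc)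

text \<open>Let \<open>c\<close> be the vector of covariances of \<open>f\<close> with the spins.  Its squared norm is the
  covariance of \<open>f\<close> with the linear function with coefficients \<open>c\<close>, whose variance is in turn
  at most \<open>K\<close> times that squared norm; Cauchy--Schwarz then gives the claim.\<close>

lemma covariance_bound:
  assumes V: "finite V" and w: "pos_weight (cube V) w" and P: "poincare V w K"
  shows "(\<Sum>i\<in>V. (avg (cube V) w (\<lambda>\<sigma>. (f \<sigma> - avg (cube V) w f) * \<sigma> i))\<^sup>2)
    \<le> K * var (cube V) w f"
proof -
  let ?E = "avg (cube V) w"
  define g where "g \<sigma> = f \<sigma> - ?E f" for \<sigma>
  define c where "c i = ?E (\<lambda>\<sigma>. g \<sigma> * \<sigma> i)" for i
  let ?C = "\<Sum>i\<in>V. (c i)\<^sup>2" and ?m = "?E (lin V c)"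
  have g0: "?E g = 0" unfolding g_def by (simp add: avg_diff avg_const[OF w])
  have "?E (\<lambda>\<sigma>. g \<sigma> * (lin V c \<sigma> - ?m)) = ?E (\<lambda>\<sigma>. g \<sigma> * lin V c \<sigma>) - ?m * ?E g"
    unfolding avg_cmult[symmetric] avg_diff[symmetric]
    by (rule avg_cong) (simp add: algebra_simps)
  also have "?E (\<lambda>\<sigma>. g \<sigma> * lin V c \<sigma>) = ?E (\<lambda>\<sigma>. \<Sum>i\<in>V. c i * (g \<sigma> * \<sigma> i))"
    by (rule avg_cong) (simp add: lin_def sum_distrib_left mult.left_commute)
  also have "\<dots> = ?C" by (simp only: avg_sum avg_cmult c_def[symmetric] power2_eq_square)
  finally have 1: "?E (\<lambda>\<sigma>. g \<sigma> * (lin V c \<sigma> - ?m)) = ?C" using g0 by simp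
  have "?C * ?C \<le> ?E (\<lambda>\<sigma>. (g \<sigma>)\<^sup>2) * ?E (\<lambda>\<sigma>. (lin V c \<sigma> - ?m)\<^sup>2)"
    using avg_Cauchy_Schwarz[OF w, of g "\<lambda>\<sigma>. lin V c \<sigma> - ?m"] unfolding 1
    by (simp add: power2_eq_square)
  also have "\<dots> = var (cube V) w f * var (cube V) w (lin V c)"
    by (simp add: var_def g_def)
  also have "\<dots> \<le> var (cube V) w f * (K * ?C)"
  proof -
    have "?E (dirichlet V (lin V c)) = ?E (\<lambda>_. ?C)"
      by (rule avg_cong) (rule dirichlet_lin[OF V])
    then have "var (cube V) w (lin V c) \<le> K * ?C"
      using poincareD[OF P, of "lin V c"] by (simp add: avg_const[OF w])
    then show ?thesis using var_nonneg[OF w] by (rule mult_left_mono)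
  qed
  finally have *: "?C * ?C \<le> (K * var (cube V) w f) * ?C" by (simp add: mult.commute mult.left_commute)
  have "0 \<le> ?C" by (simp add: sum_nonneg)
  have "?C \<le> K * var (cube V) w f"
  proof (cases "?C = 0")
    case True
    have "0 \<le> var (cube V) w f" using var_nonneg[OF w] .
    show ?thesis
    proof (cases "V = {}")
      case True
      then have "var (cube V) w f = 0"
        using poincareD[OF P, of f] \<open>0 \<le> var (cube V) w f\<close>
        by (simp add: dirichlet_def[abs_def] avg_def)
      then show ?thesis using \<open>?C = 0\<close> by simp
    next
      case False
      then obtain i where i: "i \<in> V" by blast
      let ?h = "\<lambda>j. if j = i then 1 else 0 :: real"
      have s1: "(\<Sum>j\<in>V. (?h j)\<^sup>2) = 1" using i V by (simp add: if_distrib[of "\<lambda>t. t\<^sup>2"] cong: if_cong)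
      have "?E (dirichlet V (lin V ?h)) = ?E (\<lambda>_. 1)"
        by (rule avg_cong) (simp add: dirichlet_lin[OF V] s1)
      then have "0 \<le> K"
        using poincareD[OF P, of "lin V ?h"] var_nonneg[OF w, of "lin V ?h"]
        by (simp add: avg_const[OF w])
      then show ?thesis using \<open>?C = 0\<close> \<open>0 \<le> var (cube V) w f\<close> by simp
    qed
  next
    case False
    then show ?thesis using * \<open>0 \<le> ?C\<close> by simp
  qed
  then show ?thesis unfolding c_def g_def .
qed

text \<open>One step of the discrete Hubbard--Stratonovich transform: the new weight is the average of the
  weights with an additional field \<open>s \<xi>\<^sub>b\<close>.  The variance under the mixture is at most the mean
  variance of the components plus the mean of \<open>(m\<^sub>b - m)\<^sup>2\<close>, where \<open>m\<^sub>b\<close> and \<open>m\<close> are the means of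
  \<open>f\<close> with and without the additional field.  To first order in \<open>s\<close> this difference is the
  covariance of \<open>f\<close> with the linear function of \<open>\<xi>\<^sub>b\<close>, and averaging its square over \<open>b\<close> gives
  the quadratic form with bound \<open>j\<close> at the vector of covariances with the spins.  The constant thus
  increases by \<open>s\<^sup>2 j K\<^sup>2\<close>, up to terms of higher order in \<open>s\<close>.\<close>

lemma poincare_mixture_step:
  fixes \<xi> :: "'b \<Rightarrow> 'a \<Rightarrow> real"
  assumes V: "finite V" and w: "\<And>\<sigma>. \<sigma> \<in> cube V \<Longrightarrow> 0 < w \<sigma>"
    and P: "poincare V w K"
    and Pb: "\<And>b. b \<in> \<Xi> \<Longrightarrow> poincare V (\<lambda>\<sigma>. w \<sigma> * exp (s * lin V (\<xi> b) \<sigma>)) K"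
    and K: "1 \<le> K" and Xi: "finite \<Xi>" "\<Xi> \<noteq> {}" and s: "0 < s" "s * B \<le> 1" and j: "0 \<le> j"
    and B: "\<And>b \<sigma>. b \<in> \<Xi> \<Longrightarrow> \<sigma> \<in> cube V \<Longrightarrow> \<bar>lin V (\<xi> b) \<sigma>\<bar> \<le> B"
    and cov: "\<And>c. (\<Sum>b\<in>\<Xi>. (lin V (\<xi> b) c)\<^sup>2) \<le> real (card \<Xi>) * (j * (\<Sum>i\<in>V. (c i)\<^sup>2))"
  shows "poincare V (\<lambda>\<sigma>. w \<sigma> * ((\<Sum>b\<in>\<Xi>. exp (s * lin V (\<xi> b) \<sigma>)) / real (card \<Xi>)))
    (K + s\<^sup>2 * K\<^sup>2 * (exp (4 * (s * B)) * ((1 + s) * j + (s + s\<^sup>2) * B ^ 4)))"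
proof -
  let ?S = "cube V"
  let ?n = "real (card \<Xi>)"
  define x where "x b \<sigma> = s * lin V (\<xi> b) \<sigma>" for b \<sigma>
  define \<phi> where "\<phi> \<sigma> = (\<Sum>b\<in>\<Xi>. exp (x b \<sigma>)) / ?n" for \<sigma>
  define W where "W \<sigma> = w \<sigma> * \<phi> \<sigma>" for \<sigma>
  let ?E = "avg ?S w" and ?E' = "avg ?S W"
  let ?Eb = "\<lambda>b. avg ?S (\<lambda>\<sigma>. w \<sigma> * exp (x b \<sigma>))"
  have n: "0 < ?n" using Xi by (simp add: card_gt_0_iff)
  have xB: "\<bar>x b \<sigma>\<bar> \<le> s * B" if "b \<in> \<Xi>" "\<sigma> \<in> ?S" for b \<sigma>
    using B[OF that] s(1) by (simp add: x_def abs_mult)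
  have ex: "exp (- (s * B)) \<le> exp (x b \<sigma>)" "exp (x b \<sigma>) \<le> exp (s * B)"
    if "b \<in> \<Xi>" "\<sigma> \<in> ?S" for b \<sigma>
    using xB[OF that] by auto
  have B0: "0 \<le> B"
    using B Xi(2) cube_nonempty[of V] by (metis abs_ge_zero ex_in_conv order_trans)
  have phi: "exp (- (s * B)) \<le> \<phi> \<sigma>" "\<phi> \<sigma> \<le> exp (s * B)" if "\<sigma> \<in> ?S" for \<sigma>
  proof -
    have "?n * exp (- (s * B)) \<le> (\<Sum>b\<in>\<Xi>. exp (x b \<sigma>))"
      using ex(1)[OF _ that] by (intro sum_bounded_below) 
    then show "exp (- (s * B)) \<le> \<phi> \<sigma>" unfolding \<phi>_def using n by (simp add: field_simps)
    have "(\<Sum>b\<in>\<Xi>. exp (x b \<sigma>)) \<le> ?n * exp (s * B)"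
      using ex(2)[OF _ that] by (intro sum_bounded_above) 
    then show "\<phi> \<sigma> \<le> exp (s * B)" unfolding \<phi>_def using n by (simp add: field_simps)
  qed
  then have phi0: "0 < \<phi> \<sigma>" if "\<sigma> \<in> ?S" for \<sigma>
    using that by (meson exp_gt_zero less_le_trans)
  have pw: "pos_weight ?S w" and pW: "pos_weight ?S W"
    and pb: "pos_weight ?S (\<lambda>\<sigma>. w \<sigma> * exp (x b \<sigma>))" for b
    using V w phi0 by (auto intro!: pos_weight_cube simp: W_def)
  have Eex: "exp (- (s * B)) \<le> ?E (\<lambda>\<sigma>. exp (x b \<sigma>))" if "b \<in> \<Xi>" for b
    using avg_mono[OF pw, of "\<lambda>_. exp (- (s * B))" "\<lambda>\<sigma>. exp (x b \<sigma>)"] ex(1)[OF that]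
    by (simp add: avg_const[OF pw])
  have Eex0: "0 < ?E (\<lambda>\<sigma>. exp (x b \<sigma>))" if "b \<in> \<Xi>" for b
    using Eex[OF that] by (meson exp_gt_zero less_le_trans)
  have Ephi: "exp (- (s * B)) \<le> ?E \<phi>"
    using avg_mono[OF pw, of "\<lambda>_. exp (- (s * B))" \<phi>] phi(1)
    by (simp add: avg_const[OF pw])
  then have Ephi0: "0 < ?E \<phi>" by (meson exp_gt_zero less_le_trans)
  have E'_eq: "?E' F = (\<Sum>b\<in>\<Xi>. ?E (\<lambda>\<sigma>. exp (x b \<sigma>) * F \<sigma>)) / (?n * ?E \<phi>)" for F
  proof -
    have "?E' F = ?E (\<lambda>\<sigma>. \<phi> \<sigma> * F \<sigma>) / ?E \<phi>"
      unfolding W_def by (rule avg_tilt[OF pw phi0])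
    also have "?E (\<lambda>\<sigma>. \<phi> \<sigma> * F \<sigma>) = ?E (\<lambda>\<sigma>. (1 / ?n) * (\<Sum>b\<in>\<Xi>. exp (x b \<sigma>) * F \<sigma>))"
      by (rule avg_cong) (simp add: \<phi>_def sum_distrib_right)
    finally show ?thesis unfolding avg_cmult avg_sum by simp
  qed
  have Eb_eq: "?E (\<lambda>\<sigma>. exp (x b \<sigma>) * F \<sigma>) = ?E (\<lambda>\<sigma>. exp (x b \<sigma>)) * ?Eb b F"
    if "b \<in> \<Xi>" for b F
    using Eex0[OF that] by (subst avg_tilt[OF pw]) auto
  show ?thesis
    unfolding poincare_def x_def[symmetric] \<phi>_def[symmetric] W_def[symmetric]
  proof
    fix f :: "('a \<Rightarrow> real) \<Rightarrow> real"
    define m where "m = ?E f"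
    define g where "g \<sigma> = f \<sigma> - m" for \<sigma>
    define c where "c i = ?E (\<lambda>\<sigma>. g \<sigma> * \<sigma> i)" for i
    define v where "v = var ?S w f"
    have v0: "0 \<le> v" unfolding v_def by (rule var_nonneg[OF pw])
    have g0: "?E g = 0" unfolding g_def m_def by (simp add: avg_diff avg_const[OF pw])
    have gv: "?E (\<lambda>\<sigma>. (g \<sigma>)\<^sup>2) = v" unfolding v_def var_def g_def m_def ..
    have cv: "(\<Sum>i\<in>V. (c i)\<^sup>2) \<le> K * v"
      unfolding c_def g_def m_def v_def by (rule covariance_bound[OF V pw P])
    \<comment> \<open>As \<open>g\<close> is centred, only \<open>exp x - 1\<close> counts; the quadratic remainder is split off with weight \<open>s\<close>.\<close>
    have drift: "(?E (\<lambda>\<sigma>. exp (x b \<sigma>) * g \<sigma>))\<^sup>2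
        \<le> (1 + s) * s\<^sup>2 * (lin V (\<xi> b) c)\<^sup>2 + (s ^ 3 + s ^ 4) * B ^ 4 * v" if b: "b \<in> \<Xi>" for b
    proof -
      define R where "R = ?E (\<lambda>\<sigma>. (exp (x b \<sigma>) - 1 - x b \<sigma>) * g \<sigma>)"
      let ?a = "s * lin V (\<xi> b) c"
      have "?E (\<lambda>\<sigma>. exp (x b \<sigma>) * g \<sigma>)
          = ?E (\<lambda>\<sigma>. (exp (x b \<sigma>) - 1 - x b \<sigma>) * g \<sigma> + (x b \<sigma> * g \<sigma> + g \<sigma>))"
        by (rule avg_cong) (simp add: algebra_simps)
      also have "\<dots> = R + ?E (\<lambda>\<sigma>. x b \<sigma> * g \<sigma>)" by (simp only: avg_add g0 R_def add_0_right)
      also have "?E (\<lambda>\<sigma>. x b \<sigma> * g \<sigma>) = ?E (\<lambda>\<sigma>. s * (\<Sum>i\<in>V. \<xi> b i * (g \<sigma> * \<sigma> i)))"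
        by (rule avg_cong) (simp add: x_def lin_def sum_distrib_left sum_distrib_right ac_simps)
      also have "\<dots> = ?a" by (simp add: avg_cmult avg_sum c_def lin_def)
      finally have eq: "?E (\<lambda>\<sigma>. exp (x b \<sigma>) * g \<sigma>) = R + ?a" .
      have "R\<^sup>2 \<le> ?E (\<lambda>\<sigma>. (exp (x b \<sigma>) - 1 - x b \<sigma>)\<^sup>2) * v"
        unfolding R_def gv[symmetric] by (rule avg_Cauchy_Schwarz[OF pw])
      also have "\<dots> \<le> (s * B) ^ 4 * v"
      proof (rule mult_right_mono[OF _ v0])
        have "(exp (x b \<sigma>) - 1 - x b \<sigma>)\<^sup>2 \<le> (s * B) ^ 4" if "\<sigma> \<in> ?S" for \<sigma>
        proof -
          have "\<bar>exp (x b \<sigma>) - 1 - x b \<sigma>\<bar> \<le> (x b \<sigma>)\<^sup>2"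
            using xB[OF b that] s(2) by (intro exp_minus_linear_bound) simp
          also have "\<dots> \<le> (s * B)\<^sup>2"
            using power_mono[OF xB[OF b that], of 2] by simp
          finally have "\<bar>exp (x b \<sigma>) - 1 - x b \<sigma>\<bar>\<^sup>2 \<le> ((s * B)\<^sup>2)\<^sup>2"
            by (intro power_mono) auto
          then show ?thesis by (simp flip: power_mult)
        qed
        then show "?E (\<lambda>\<sigma>. (exp (x b \<sigma>) - 1 - x b \<sigma>)\<^sup>2) \<le> (s * B) ^ 4"
          using avg_mono[OF pw, of "\<lambda>\<sigma>. (exp (x b \<sigma>) - 1 - x b \<sigma>)\<^sup>2" "\<lambda>_. (s * B) ^ 4"]
          by (simp add: avg_const[OF pw])
      qed
      finally have R: "R\<^sup>2 \<le> (s * B) ^ 4 * v" .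
      have "(R + ?a)\<^sup>2 \<le> (1 + s) * ?a\<^sup>2 + (1 + 1 / s) * R\<^sup>2"
      proof -
        have "0 \<le> (s * ?a - R)\<^sup>2 / s" using s(1) by simp
        also have "(s * ?a - R)\<^sup>2 / s = (1 + s) * ?a\<^sup>2 + (1 + 1 / s) * R\<^sup>2 - (R + ?a)\<^sup>2"
          using s(1) by (simp add: field_simps power2_eq_square)
        finally show ?thesis by simp
      qed
      also have "\<dots> \<le> (1 + s) * ?a\<^sup>2 + (1 + 1 / s) * ((s * B) ^ 4 * v)"
        using R s(1) by (intro add_left_mono mult_left_mono) auto
      also have "\<dots> = (1 + s) * s\<^sup>2 * (lin V (\<xi> b) c)\<^sup>2 + (s ^ 3 + s ^ 4) * B ^ 4 * v"
        using s(1) by (simp add: field_simps power2_eq_square power3_eq_cube power4_eq_xxxx)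
      finally show ?thesis unfolding eq .
    qed
    have drift_sum: "(\<Sum>b\<in>\<Xi>. (?E (\<lambda>\<sigma>. exp (x b \<sigma>) * g \<sigma>))\<^sup>2)
        \<le> ?n * (s\<^sup>2 * K * ((1 + s) * j + (s + s\<^sup>2) * B ^ 4) * v)"
    proof -
      have "(\<Sum>b\<in>\<Xi>. (?E (\<lambda>\<sigma>. exp (x b \<sigma>) * g \<sigma>))\<^sup>2)
        \<le> (\<Sum>b\<in>\<Xi>. (1 + s) * s\<^sup>2 * (lin V (\<xi> b) c)\<^sup>2 + (s ^ 3 + s ^ 4) * B ^ 4 * v)"
        by (rule sum_mono) (rule drift)
      also have "\<dots> = (1 + s) * s\<^sup>2 * (\<Sum>b\<in>\<Xi>. (lin V (\<xi> b) c)\<^sup>2) + ?n * ((s ^ 3 + s ^ 4) * B ^ 4 * v)"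
        by (simp add: sum.distrib sum_distrib_left)
      also have "\<dots> \<le> (1 + s) * s\<^sup>2 * (?n * (j * (K * v))) + ?n * ((s ^ 3 + s ^ 4) * B ^ 4 * (K * v))"
      proof -
        have "(\<Sum>b\<in>\<Xi>. (lin V (\<xi> b) c)\<^sup>2) \<le> ?n * (j * (K * v))"
          using cov[of c] mult_left_mono[OF mult_left_mono[OF cv j], of ?n] n by linarith
        moreover have "v \<le> K * v" using K v0 by (simp add: mult_le_cancel_right1)
        ultimately show ?thesis using s B0 n by (intro add_mono mult_left_mono) auto
      qed
      also have "\<dots> = ?n * (s\<^sup>2 * K * ((1 + s) * j + (s + s\<^sup>2) * B ^ 4) * v)"
        by (simp add: algebra_simps power2_eq_square power3_eq_cube power4_eq_xxxx)
      finally show ?thesis .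
    qed
    have "var ?S W f \<le> ?E' (\<lambda>\<sigma>. (g \<sigma>)\<^sup>2)"
      unfolding g_def by (rule var_le_avg_sq_shift[OF pW])
    also have "\<dots> \<le> (\<Sum>b\<in>\<Xi>. K * ?E (\<lambda>\<sigma>. exp (x b \<sigma>) * dirichlet V f \<sigma>)
        + exp (s * B) * (?E (\<lambda>\<sigma>. exp (x b \<sigma>) * g \<sigma>))\<^sup>2) / (?n * ?E \<phi>)"
      unfolding E'_eq
    proof (intro divide_right_mono sum_mono)
      fix b assume b: "b \<in> \<Xi>"
      let ?e = "?E (\<lambda>\<sigma>. exp (x b \<sigma>))"
      have "?E (\<lambda>\<sigma>. exp (x b \<sigma>) * (g \<sigma>)\<^sup>2)
          = ?e * var ?S (\<lambda>\<sigma>. w \<sigma> * exp (x b \<sigma>)) f + ?e * (?Eb b f - m)\<^sup>2"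
        unfolding Eb_eq[OF b] g_def avg_sq_shift[OF pb] by (simp add: algebra_simps)
      moreover have "?e * var ?S (\<lambda>\<sigma>. w \<sigma> * exp (x b \<sigma>)) f
          \<le> ?e * (K * ?Eb b (dirichlet V f))"
        using poincareD[OF Pb[OF b]] Eex0[OF b] unfolding x_def by (intro mult_left_mono) auto
      moreover have "?e * (K * ?Eb b (dirichlet V f))
          = K * ?E (\<lambda>\<sigma>. exp (x b \<sigma>) * dirichlet V f \<sigma>)"
        unfolding Eb_eq[OF b] by simp
      moreover have "?e * (?Eb b f - m)\<^sup>2 = (?E (\<lambda>\<sigma>. exp (x b \<sigma>) * g \<sigma>))\<^sup>2 / ?e"
        unfolding Eb_eq[OF b] g_def using Eex0[OF b]
        by (simp add: avg_diff avg_const[OF pb] power2_eq_square)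
      moreover have "(?E (\<lambda>\<sigma>. exp (x b \<sigma>) * g \<sigma>))\<^sup>2 / ?e
          \<le> (?E (\<lambda>\<sigma>. exp (x b \<sigma>) * g \<sigma>))\<^sup>2 / exp (- (s * B))"
        using Eex[OF b] Eex0[OF b] by (intro divide_left_mono) auto
      moreover have "(?E (\<lambda>\<sigma>. exp (x b \<sigma>) * g \<sigma>))\<^sup>2 / exp (- (s * B))
          = exp (s * B) * (?E (\<lambda>\<sigma>. exp (x b \<sigma>) * g \<sigma>))\<^sup>2"
        by (simp add: exp_minus field_simps)
      ultimately show "?E (\<lambda>\<sigma>. exp (x b \<sigma>) * (g \<sigma>)\<^sup>2)
          \<le> K * ?E (\<lambda>\<sigma>. exp (x b \<sigma>) * dirichlet V f \<sigma>)
            + exp (s * B) * (?E (\<lambda>\<sigma>. exp (x b \<sigma>) * g \<sigma>))\<^sup>2"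
        by linarith
    qed (use n Ephi0 in simp)
    also have "\<dots> = K * ?E' (dirichlet V f)
        + exp (s * B) * (\<Sum>b\<in>\<Xi>. (?E (\<lambda>\<sigma>. exp (x b \<sigma>) * g \<sigma>))\<^sup>2) / (?n * ?E \<phi>)"
      unfolding E'_eq by (simp add: sum.distrib add_divide_distrib flip: sum_distrib_left)
    also have "\<dots> \<le> K * ?E' (dirichlet V f)
        + exp (s * B) * (?n * (s\<^sup>2 * K * ((1 + s) * j + (s + s\<^sup>2) * B ^ 4) * v)) / (?n * exp (- (s * B)))"
      using drift_sum Ephi Ephi0 n j K s B0 v0
      by (intro add_left_mono frac_le mult_left_mono mult_nonneg_nonneg add_nonneg_nonneg) auto
    also have "\<dots> = K * ?E' (dirichlet V f)
        + exp (2 * (s * B)) * (s\<^sup>2 * K * ((1 + s) * j + (s + s\<^sup>2) * B ^ 4) * v)"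
    proof -
      have "exp (2 * (s * B)) = exp (s * B) * exp (s * B)" by (simp flip: exp_add)
      then show ?thesis using n by (simp add: exp_minus divide_simps)
    qed
    also have "\<dots> \<le> K * ?E' (dirichlet V f)
        + exp (2 * (s * B)) * (s\<^sup>2 * K * ((1 + s) * j + (s + s\<^sup>2) * B ^ 4)
            * (K * (exp (2 * (s * B)) * ?E' (dirichlet V f))))"
    proof -
      have "?E (dirichlet V f) \<le> exp (2 * (s * B)) * ?E' (dirichlet V f)"
      proof (rule avg_le_exp_mult[OF pw pW])
        fix \<sigma> assume \<sigma>: "\<sigma> \<in> ?S"
        have "1 = exp (- (s * B)) * exp (s * B)" by (simp flip: exp_add)
        also have "\<dots> \<le> \<phi> \<sigma> * exp (s * B)" using phi(1)[OF \<sigma>] by simp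
        finally have "w \<sigma> * 1 \<le> w \<sigma> * (\<phi> \<sigma> * exp (s * B))"
          using w[OF \<sigma>] by (intro mult_left_mono) auto
        then show "w \<sigma> \<le> W \<sigma> * exp (s * B) \<and> W \<sigma> \<le> w \<sigma> * exp (s * B)"
          unfolding W_def using phi(2)[OF \<sigma>] w[OF \<sigma>] by (simp add: mult.assoc)
      qed (rule dirichlet_nonneg)
      moreover have "v \<le> K * ?E (dirichlet V f)" unfolding v_def by (rule poincareD[OF P])
      ultimately have "v \<le> K * (exp (2 * (s * B)) * ?E' (dirichlet V f))"
        using K by (meson mult_left_mono order_trans zero_le_one)
      then show ?thesis using j K s B0 by (intro add_left_mono mult_left_mono) auto
    qed
    also have "\<dots> = (K + s\<^sup>2 * K\<^sup>2 * (exp (4 * (s * B)) * ((1 + s) * j + (s + s\<^sup>2) * B ^ 4)))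
        * ?E' (dirichlet V f)"
    proof -
      have "exp (4 * (s * B)) = exp (2 * (s * B)) * exp (2 * (s * B))" by (simp flip: exp_add)
      then show ?thesis by (simp add: algebra_simps power2_eq_square)
    qed
    finally show "var ?S W f
      \<le> (K + s\<^sup>2 * K\<^sup>2 * (exp (4 * (s * B)) * ((1 + s) * j + (s + s\<^sup>2) * B ^ 4)))
        * ?E' (dirichlet V f)" .
  qed
qed

lemma poincare_limit:
  assumes V: "finite V" and w: "\<And>\<sigma>. \<sigma> \<in> cube V \<Longrightarrow> 0 < w \<sigma>"
    and lim: "\<And>\<sigma>. \<sigma> \<in> cube V \<Longrightarrow> (\<lambda>n. u n \<sigma>) \<longlonglongrightarrow> w \<sigma>"
    and P: "eventually (\<lambda>n. poincare V (u n) K) sequentially"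
  shows "poincare V w K"
  unfolding poincare_def
proof
  fix f :: "('a \<Rightarrow> real) \<Rightarrow> real"
  have "pos_weight (cube V) w" using V w by (rule pos_weight_cube)
  then have Z: "(\<Sum>\<sigma>\<in>cube V. w \<sigma>) \<noteq> 0"
    using pos_weight_sum by fastforce
  have avg_lim: "(\<lambda>n. avg (cube V) (u n) (F n)) \<longlonglongrightarrow> avg (cube V) w G"
    if "\<And>\<sigma>. (\<lambda>n. F n \<sigma>) \<longlonglongrightarrow> G \<sigma>" for F G
    unfolding avg_def using Z by (intro tendsto_divide tendsto_sum tendsto_mult lim that)
  have "(\<lambda>n. var (cube V) (u n) f) \<longlonglongrightarrow> var (cube V) w f"
    unfolding var_def by (intro avg_lim tendsto_intros)
  moreover have "(\<lambda>n. K * avg (cube V) (u n) (dirichlet V f))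
      \<longlonglongrightarrow> K * avg (cube V) w (dirichlet V f)"
    by (intro avg_lim tendsto_intros)
  moreover have "eventually (\<lambda>n. var (cube V) (u n) f \<le> K * avg (cube V) (u n) (dirichlet V f))
      sequentially"
    using P by eventually_elim (rule poincareD)
  ultimately show "var (cube V) w f \<le> K * avg (cube V) w (dirichlet V f)"
    by (intro tendsto_le[of sequentially]) auto
qed

lemma tendsto_power_exp:
  fixes y :: "nat \<Rightarrow> real"
  assumes "y \<longlonglongrightarrow> c"
  shows "(\<lambda>n. (1 + y n / real n) ^ n) \<longlonglongrightarrow> exp c"
proof -
  have y0: "(\<lambda>n. y n / real n) \<longlonglongrightarrow> 0"
    using assms by (rule real_tendsto_divide_at_top) (rule filterlim_real_sequentially)
  then have small: "eventually (\<lambda>n. \<bar>y n / real n\<bar> < 1 / 2) sequentially"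
    using order_tendstoD(2)[OF tendsto_rabs_zero[OF y0], of "1 / 2"] by simp
  have "(\<lambda>n. real n * ln (1 + y n / real n) - y n) \<longlonglongrightarrow> 0"
  proof (rule Lim_null_comparison)
    show "(\<lambda>n. 2 * (y n * (y n / real n))) \<longlonglongrightarrow> 0"
      using tendsto_mult[OF assms y0] by (intro tendsto_mult_right_zero) simp
    show "eventually (\<lambda>n. norm (real n * ln (1 + y n / real n) - y n)
        \<le> 2 * (y n * (y n / real n))) sequentially"
      using small eventually_gt_at_top[of 0]
    proof eventually_elim
      case (elim n)
      have "\<bar>ln (1 + y n / real n) - y n / real n\<bar> \<le> 2 * (y n / real n)\<^sup>2"
        using elim by (intro abs_ln_one_plus_x_minus_x_bound) auto
      then have "real n * \<bar>ln (1 + y n / real n) - y n / real n\<bar> \<le> real n * (2 * (y n / real n)\<^sup>2)"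
        by (rule mult_left_mono) simp
      moreover have "real n * \<bar>ln (1 + y n / real n) - y n / real n\<bar>
          = \<bar>real n * (ln (1 + y n / real n) - y n / real n)\<bar>" by (simp add: abs_mult)
      ultimately show ?case using elim by (simp add: field_simps power2_eq_square)
    qed
  qed
  from tendsto_add[OF this assms]
  have "(\<lambda>n. exp (real n * ln (1 + y n / real n))) \<longlonglongrightarrow> exp c"
    by (intro tendsto_exp) simp
  moreover have "eventually (\<lambda>n. exp (real n * ln (1 + y n / real n)) = (1 + y n / real n) ^ n)
      sequentially"
    using small
  proof eventually_elim
    case (elim n)
    then have "0 < 1 + y n / real n" unfolding abs_less_iff by linarith
    then show ?case by (simp add: exp_of_nat_mult)
  qed
  ultimately show ?thesis by (rule Lim_transform_eventually)
qed

lemma cosh_second_order: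
  fixes z :: real
  shows "(\<lambda>n. real n * (exp (1 / sqrt (real n) * z) + exp (1 / sqrt (real n) * (- z)) - 2)) \<longlonglongrightarrow> z\<^sup>2"
proof -
  consider "z > 0" | "z < 0" | "z = 0" by linarith
  then show ?thesis by cases (real_asymp simp: power2_eq_square)+
qed

text \<open>The interaction is built up in \<open>n\<close> mixture steps of size \<open>1 / sqrt n\<close> with fields
  \<open>\<plusminus> sqrt M u\<^sub>a\<close>, whose covariance is the quadratic form.  The constants \<open>1 / (1 - j' l / n)\<close>
  with \<open>j < j' < 1\<close> dominate the recursion of \<open>poincare_mixture_step\<close> when \<open>n\<close> is large: they solve
  \<open>K' = j' K\<^sup>2\<close> at discrete times, and the slack between \<open>j\<close> and \<open>j'\<close> absorbs the terms of
  higher order.  The choice \<open>j' = (1 + j) / 2\<close> gives the constant in the statement.  External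
  fields have to be carried through the induction because every step produces new ones.\<close>

lemma poincare_sum_of_squares:
  fixes u :: "nat \<Rightarrow> 'a \<Rightarrow> real"
  assumes V: "finite V" and M: "0 < M" and j: "0 \<le> j" "j < 1"
    and Q: "\<And>c. (\<Sum>a<M. (lin V (u a) c)\<^sup>2) \<le> j * (\<Sum>i\<in>V. (c i)\<^sup>2)"
  shows "poincare V (\<lambda>\<sigma>. exp ((\<Sum>a<M. (lin V (u a) \<sigma>)\<^sup>2) / 2)) (2 / (1 - j))"
proof -
  define j' where "j' = (1 + j) / 2"
  have j': "j < j'" "0 < j'" "j' < 1" using j by (auto simp: j'_def)
  let ?\<Xi> = "{..<M} \<times> {1, -1 :: real}"
  define \<xi> where "\<xi> = (\<lambda>(a, e) i. e * sqrt (real M) * u a i)"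
  have lin_xi: "lin V (\<xi> (a, e)) \<sigma> = e * (sqrt (real M) * lin V (u a) \<sigma>)" for a e \<sigma>
    unfolding \<xi>_def lin_def by (simp add: sum_distrib_left mult.assoc)
  have fX: "finite ?\<Xi>" "?\<Xi> \<noteq> {}" using M by auto
  have card: "real (card ?\<Xi>) = 2 * real M" by simp
  have sum_Xi: "(\<Sum>b\<in>?\<Xi>. F b) = (\<Sum>a<M. F (a, 1) + F (a, -1))" for F :: "nat \<times> real \<Rightarrow> real"
    by (subst sum.cartesian_product[symmetric, of "\<lambda>a e. F (a, e)", simplified]) auto
  have cov: "(\<Sum>b\<in>?\<Xi>. (lin V (\<xi> b) c)\<^sup>2) \<le> real (card ?\<Xi>) * (j * (\<Sum>i\<in>V. (c i)\<^sup>2))" for c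
  proof -
    have "(\<Sum>b\<in>?\<Xi>. (lin V (\<xi> b) c)\<^sup>2) = real (card ?\<Xi>) * (\<Sum>a<M. (lin V (u a) c)\<^sup>2)"
      unfolding sum_Xi lin_xi card by (simp add: power_mult_distrib sum_distrib_left mult.assoc)
    then show ?thesis using mult_left_mono[OF Q[of c], of "real (card ?\<Xi>)"] by simp
  qed
  define B where "B = (\<Sum>b\<in>?\<Xi>. \<Sum>\<sigma>\<in>cube V. \<bar>lin V (\<xi> b) \<sigma>\<bar>)"
  have B: "\<bar>lin V (\<xi> b) \<sigma>\<bar> \<le> B" if "b \<in> ?\<Xi>" "\<sigma> \<in> cube V" for b \<sigma>
  proof -
    have "\<bar>lin V (\<xi> b) \<sigma>\<bar> \<le> (\<Sum>\<sigma>\<in>cube V. \<bar>lin V (\<xi> b) \<sigma>\<bar>)"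
      using that finite_cube[OF V] by (intro member_le_sum) auto
    also have "\<dots> \<le> B" unfolding B_def
      by (rule member_le_sum[OF that(1), of "\<lambda>b. \<Sum>\<sigma>\<in>cube V. \<bar>lin V (\<xi> b) \<sigma>\<bar>"])
        (auto intro: sum_nonneg)
    finally show ?thesis .
  qed
  define s where "s n = 1 / sqrt (real n)" for n :: nat
  define \<phi> where "\<phi> n \<sigma> = (\<Sum>b\<in>?\<Xi>. exp (s n * lin V (\<xi> b) \<sigma>)) / real (card ?\<Xi>)" for n \<sigma>
  have phi_pos: "0 < \<phi> n \<sigma>" for n \<sigma>
    unfolding \<phi>_def using fX by (intro divide_pos_pos sum_pos) (auto simp: card_gt_0_iff)
  have s0: "s \<longlonglongrightarrow> 0" unfolding s_def by real_asymp
  have "(\<lambda>n. s n * B) \<longlonglongrightarrow> 0 * B" by (intro tendsto_intros s0)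
  then have "eventually (\<lambda>n. s n * B < 1) sequentially"
    by (intro order_tendstoD) auto
  moreover have "(\<lambda>n. exp (4 * (s n * B)) * ((1 + s n) * j + (s n + (s n)\<^sup>2) * B ^ 4))
      \<longlonglongrightarrow> exp (4 * (0 * B)) * ((1 + 0) * j + (0 + 0\<^sup>2) * B ^ 4)"
    by (intro tendsto_intros s0)
  then have "eventually (\<lambda>n. exp (4 * (s n * B)) * ((1 + s n) * j + (s n + (s n)\<^sup>2) * B ^ 4) < j')
      sequentially"
    using j' by (intro order_tendstoD) auto
  ultimately have ev: "eventually (\<lambda>n. 0 < n \<and> s n * B \<le> 1 \<and>
      exp (4 * (s n * B)) * ((1 + s n) * j + (s n + (s n)\<^sup>2) * B ^ 4) \<le> j') sequentially"
    using eventually_gt_at_top[of 0] by eventually_elim auto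
  show ?thesis
  proof (rule poincare_limit[OF V])
    show "eventually (\<lambda>n. poincare V (\<lambda>\<sigma>. \<phi> n \<sigma> ^ n) (2 / (1 - j))) sequentially"
      using ev
    proof eventually_elim
      case (elim n)
      have sn: "0 < s n" "(s n)\<^sup>2 = 1 / real n" using elim by (auto simp: s_def power_divide)
      define K where "K l = 1 / (1 - j' * (real l * (s n)\<^sup>2))" for l :: nat
      have den: "1 - j' \<le> 1 - j' * (real l * (s n)\<^sup>2)" if "l \<le> n" for l
      proof -
        have "real l * (s n)\<^sup>2 \<le> 1" using that elim by (simp add: sn(2))
        then have "j' * (real l * (s n)\<^sup>2) \<le> j' * 1" using j' by (intro mult_left_mono) auto
        then show ?thesis by simp
      qed
      have "\<forall>h. poincare V (\<lambda>\<sigma>. \<phi> n \<sigma> ^ l * exp (lin V h \<sigma>)) (K l)" if "l \<le> n" for l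
        using that
      proof (induction l)
        case 0
        then show ?case using poincare_product[OF V] by (simp add: K_def)
      next
        case (Suc l)
        then have IH: "poincare V (\<lambda>\<sigma>. \<phi> n \<sigma> ^ l * exp (lin V h \<sigma>)) (K l)" for h by simp
        have d1: "0 < 1 - j' * (real l * (s n)\<^sup>2)" using den[of l] Suc.prems j' by linarith
        have d2: "0 < 1 - j' * (real (Suc l) * (s n)\<^sup>2)" using den[of "Suc l"] Suc.prems j' by linarith
        have "0 \<le> j' * (real l * (s n)\<^sup>2)" using j' by simp
        then have K1: "1 \<le> K l" unfolding K_def using d1 by simp
        let ?b = "exp (4 * (s n * B)) * ((1 + s n) * j + (s n + (s n)\<^sup>2) * B ^ 4)"
        have "K l + (s n)\<^sup>2 * (K l)\<^sup>2 * ?b \<le> K l + (s n)\<^sup>2 * (K l)\<^sup>2 * j'"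
          using elim by (intro add_left_mono mult_left_mono) auto
        also have "\<dots> \<le> K (Suc l)"
        proof -
          define x where "x = 1 - j' * (real l * (s n)\<^sup>2)"
          define y where "y = j' * (s n)\<^sup>2"
          have xy: "0 < x" "0 < x - y" "0 < y"
            using d1 d2 sn(1) j' by (auto simp: x_def y_def algebra_simps)
          have "1 / x + y * (1 / x)\<^sup>2 \<le> 1 / (x - y)"
          proof -
            have "(1 / x + y * (1 / x)\<^sup>2) * (x - y) = 1 - (y / x)\<^sup>2"
              using xy by (simp add: field_simps power2_eq_square)
            then show ?thesis using xy by (simp add: le_divide_eq)
          qed
          moreover have Kl: "K l = 1 / x" and "K (Suc l) = 1 / (x - y)"
            by (auto simp: K_def x_def y_def algebra_simps)
          moreover have "(s n)\<^sup>2 * (K l)\<^sup>2 * j' = y * (1 / x)\<^sup>2" unfolding Kl y_def by simp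
          ultimately show ?thesis by linarith
        qed
        finally have Kle: "K l + (s n)\<^sup>2 * (K l)\<^sup>2 * ?b \<le> K (Suc l)" .
        show ?case
        proof
          fix h
          have shift: "\<phi> n \<sigma> ^ l * exp (lin V h \<sigma>) * exp (s n * lin V (\<xi> b) \<sigma>)
              = \<phi> n \<sigma> ^ l * exp (lin V (\<lambda>i. h i + s n * \<xi> b i) \<sigma>)" for b \<sigma>
            by (simp add: lin_add lin_cmult exp_add mult.assoc)
          have "poincare V (\<lambda>\<sigma>. \<phi> n \<sigma> ^ l * exp (lin V h \<sigma>) *
              ((\<Sum>b\<in>?\<Xi>. exp (s n * lin V (\<xi> b) \<sigma>)) / real (card ?\<Xi>)))
              (K l + (s n)\<^sup>2 * (K l)\<^sup>2 * ?b)"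
            by (rule poincare_mixture_step[OF V _ IH _ K1 fX sn(1) _ j(1) B cov])
              (use phi_pos elim IH in \<open>auto simp: shift\<close>)
          then have "poincare V (\<lambda>\<sigma>. \<phi> n \<sigma> ^ l * exp (lin V h \<sigma>) *
              ((\<Sum>b\<in>?\<Xi>. exp (s n * lin V (\<xi> b) \<sigma>)) / real (card ?\<Xi>))) (K (Suc l))"
            by (rule poincare_mono[OF _ Kle V]) (unfold \<phi>_def[symmetric], intro mult_pos_pos zero_less_power phi_pos exp_gt_zero)
          then show "poincare V (\<lambda>\<sigma>. \<phi> n \<sigma> ^ Suc l * exp (lin V h \<sigma>)) (K (Suc l))"
            unfolding \<phi>_def[symmetric] by (simp add: mult.commute mult.left_commute)
        qed
      qed
      from this[of n] have "poincare V (\<lambda>\<sigma>. \<phi> n \<sigma> ^ n * exp (lin V (\<lambda>_. 0) \<sigma>)) (K n)" by simp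
      moreover have "lin V (\<lambda>_. 0) = (\<lambda>_. 0)" by (simp add: lin_def fun_eq_iff)
      moreover have "K n = 2 / (1 - j)"
        using elim j by (simp add: K_def sn(2) j'_def field_simps)
      ultimately show ?case by simp
    qed
    fix \<sigma> :: "'a \<Rightarrow> real"
    define z where "z a = sqrt (real M) * lin V (u a) \<sigma>" for a
    define y where "y n = (\<Sum>a<M. real n * (exp (s n * z a) + exp (s n * (- z a)) - 2)) / (2 * real M)"
      for n
    have "y \<longlonglongrightarrow> (\<Sum>a<M. (z a)\<^sup>2) / (2 * real M)"
      unfolding y_def s_def using M by (intro tendsto_intros cosh_second_order) auto
    also have "(\<Sum>a<M. (z a)\<^sup>2) / (2 * real M) = (\<Sum>a<M. (lin V (u a) \<sigma>)\<^sup>2) / 2"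
      using M by (simp add: z_def power_mult_distrib flip: sum_distrib_left)
    finally have "(\<lambda>n. (1 + y n / real n) ^ n) \<longlonglongrightarrow> exp ((\<Sum>a<M. (lin V (u a) \<sigma>)\<^sup>2) / 2)"
      by (rule tendsto_power_exp)
    moreover have "eventually (\<lambda>n. (1 + y n / real n) ^ n = \<phi> n \<sigma> ^ n) sequentially"
      using eventually_gt_at_top[of 0]
    proof eventually_elim
      case (elim n)
      have "\<phi> n \<sigma> = (\<Sum>a<M. exp (s n * z a) + exp (s n * (- z a))) / (2 * real M)"
        unfolding \<phi>_def sum_Xi lin_xi card z_def by simp
      also have "\<dots> = 1 + y n / real n"
        unfolding y_def using elim M
        by (simp add: sum_subtractf field_simps flip: sum_distrib_left)
      finally show ?case by simp
    qed
    ultimately show "(\<lambda>n. \<phi> n \<sigma> ^ n) \<longlonglongrightarrow> exp ((\<Sum>a<M. (lin V (u a) \<sigma>)\<^sup>2) / 2)"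
      by (rule Lim_transform_eventually)
  qed simp
qed

text \<open>Elimination of one variable at a time, as in the Cholesky decomposition.  A vanishing diagonal
  entry of a positive semidefinite matrix forces its row to vanish.\<close>

lemma psd_sum_of_squares:
  fixes J :: "'a \<Rightarrow> 'a \<Rightarrow> real"
  assumes "finite V" "\<And>i l. i \<in> V \<Longrightarrow> l \<in> V \<Longrightarrow> J i l = J l i"
    and "\<And>x. 0 \<le> (\<Sum>i\<in>V. \<Sum>l\<in>V. J i l * x i * x l)"
  shows "\<exists>(M::nat) u. 0 < M \<and> (\<forall>x. (\<Sum>i\<in>V. \<Sum>l\<in>V. J i l * x i * x l) = (\<Sum>a<M. (lin V (u a) x)\<^sup>2))"
  using assms
proof (induction V arbitrary: J rule: finite_induct)
  case empty
  then show ?case by (intro exI[of _ 1] exI[of _ "\<lambda>_ _. 0"]) (simp add: lin_def)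
next
  case (insert a V)
  let ?r = "\<lambda>x. \<Sum>l\<in>V. J a l * x l"
  have expand: "(\<Sum>i\<in>insert a V. \<Sum>l\<in>insert a V. J i l * x i * x l)
      = J a a * (x a)\<^sup>2 + 2 * x a * ?r x + (\<Sum>i\<in>V. \<Sum>l\<in>V. J i l * x i * x l)" for x
  proof -
    have "(\<Sum>i\<in>V. J i a * x i * x a) = x a * ?r x"
      using insert.prems(1) by (auto simp: sum_distrib_left intro!: sum.cong)
    moreover have "(\<Sum>l\<in>V. J a l * x a * x l) = x a * ?r x"
      by (auto simp: sum_distrib_left intro!: sum.cong)
    ultimately show ?thesis
      using insert.hyps by (simp add: sum.distrib power2_eq_square)
  qed
  have psd: "0 \<le> J a a * t\<^sup>2 + 2 * t * ?r x + (\<Sum>i\<in>V. \<Sum>l\<in>V. J i l * x i * x l)" for t x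
  proof -
    have "0 \<le> (\<Sum>i\<in>insert a V. \<Sum>l\<in>insert a V. J i l * (x(a := t)) i * (x(a := t)) l)"
      by (rule insert.prems(2))
    also have "\<dots> = J a a * t\<^sup>2 + 2 * t * ?r (x(a := t))
        + (\<Sum>i\<in>V. \<Sum>l\<in>V. J i l * (x(a := t)) i * (x(a := t)) l)"
      unfolding expand by simp
    also have "?r (x(a := t)) = ?r x" using insert.hyps by (intro sum.cong) auto
    also have "(\<Sum>i\<in>V. \<Sum>l\<in>V. J i l * (x(a := t)) i * (x(a := t)) l)
        = (\<Sum>i\<in>V. \<Sum>l\<in>V. J i l * x i * x l)"
      using insert.hyps by (intro sum.cong) auto
    finally show ?thesis .
  qed
  have "0 \<le> J a a" using psd[of 1 "\<lambda>_. 0"] by simp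
  show ?case
  proof (cases "J a a = 0")
    case True
    have r0: "?r x = 0" for x
    proof (rule ccontr)
      assume r: "?r x \<noteq> 0"
      let ?q = "\<Sum>i\<in>V. \<Sum>l\<in>V. J i l * x i * x l"
      have "0 \<le> 2 * (- (?q + 1) / (2 * ?r x)) * ?r x + ?q"
        using psd[of "- (?q + 1) / (2 * ?r x)" x] True by simp
      then show False using r by (simp add: field_simps)
    qed
    have "\<exists>(M::nat) u. 0 < M \<and> (\<forall>x. (\<Sum>i\<in>V. \<Sum>l\<in>V. J i l * x i * x l) = (\<Sum>a<M. (lin V (u a) x)\<^sup>2))"
      using insert.prems psd[of 0] by (intro insert.IH) auto
    then obtain M :: nat and u where Mu: "0 < M"
      "\<And>x. (\<Sum>i\<in>V. \<Sum>l\<in>V. J i l * x i * x l) = (\<Sum>a<M. (lin V (u a) x)\<^sup>2)" by blast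
    define U where "U b = (u b)(a := 0)" for b
    have "lin (insert a V) (U b) x = lin V (u b) x" for b x
      unfolding lin_def U_def using insert.hyps by (auto intro: sum.cong)
    then show ?thesis
      using Mu(1) by (intro exI[of _ M] exI[of _ U]) (simp add: expand True r0 Mu(2))
  next
    case False
    with \<open>0 \<le> J a a\<close> have Ja: "0 < J a a" by simp
    let ?J = "\<lambda>i l. J i l - J a i * J a l / J a a"
    have J': "(\<Sum>i\<in>V. \<Sum>l\<in>V. ?J i l * x i * x l)
        = (\<Sum>i\<in>V. \<Sum>l\<in>V. J i l * x i * x l) - (?r x)\<^sup>2 / J a a" for x
      unfolding power2_eq_square sum_product sum_divide_distrib
      by (simp add: algebra_simps sum_subtractf)
    have "\<exists>(M::nat) u. 0 < M \<and> (\<forall>x. (\<Sum>i\<in>V. \<Sum>l\<in>V. ?J i l * x i * x l) = (\<Sum>a<M. (lin V (u a) x)\<^sup>2))"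
    proof (rule insert.IH)
      show "?J i l = ?J l i" if "i \<in> V" "l \<in> V" for i l
        using insert.prems(1)[of i l] that by simp
      show "0 \<le> (\<Sum>i\<in>V. \<Sum>l\<in>V. ?J i l * x i * x l)" for x
        using psd[of "- ?r x / J a a" x] Ja unfolding J'
        by (simp add: field_simps power2_eq_square)
    qed
    then obtain M :: nat and u where Mu: "0 < M"
      "\<And>x. (\<Sum>i\<in>V. \<Sum>l\<in>V. ?J i l * x i * x l) = (\<Sum>a<M. (lin V (u a) x)\<^sup>2)" by blast
    define U where "U b = (if b < M then (u b)(a := 0) else (\<lambda>i. J a i / sqrt (J a a)))" for b
    have 1: "lin (insert a V) (U b) x = lin V (u b) x" if "b < M" for b x
      unfolding lin_def U_def using insert.hyps that by (auto intro: sum.cong)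
    have 2: "(lin (insert a V) (U M) x)\<^sup>2 = (J a a * x a + ?r x)\<^sup>2 / J a a" for x
    proof -
      have "lin (insert a V) (U M) x = (J a a * x a + ?r x) / sqrt (J a a)"
        unfolding lin_def U_def using insert.hyps
        by (simp add: add_divide_distrib sum_divide_distrib)
      then show ?thesis using Ja by (simp add: power_divide)
    qed
    have "(\<Sum>i\<in>insert a V. \<Sum>l\<in>insert a V. J i l * x i * x l)
        = (\<Sum>b<Suc M. (lin (insert a V) (U b) x)\<^sup>2)" for x
    proof -
      have "(\<Sum>b<Suc M. (lin (insert a V) (U b) x)\<^sup>2)
          = (\<Sum>b<M. (lin V (u b) x)\<^sup>2) + (J a a * x a + ?r x)\<^sup>2 / J a a"
        by (simp add: 1 2)
      also have "\<dots> = (\<Sum>i\<in>V. \<Sum>l\<in>V. J i l * x i * x l) - (?r x)\<^sup>2 / J a a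
          + (J a a * x a + ?r x)\<^sup>2 / J a a"
        by (simp only: Mu(2)[symmetric] J')
      also have "\<dots> = J a a * (x a)\<^sup>2 + 2 * x a * ?r x + (\<Sum>i\<in>V. \<Sum>l\<in>V. J i l * x i * x l)"
        using Ja by (simp add: field_simps power2_eq_square)
      finally show ?thesis unfolding expand by simp
    qed
    then show ?thesis by (intro exI[of _ "Suc M"] exI[of _ U]) simp
  qed
qed

theorem poincare_quadratic:
  fixes J :: "'a \<Rightarrow> 'a \<Rightarrow> real"
  assumes V: "finite V" and sym: "\<And>i l. i \<in> V \<Longrightarrow> l \<in> V \<Longrightarrow> J i l = J l i"
    and psd: "\<And>x. 0 \<le> (\<Sum>i\<in>V. \<Sum>l\<in>V. J i l * x i * x l)"
    and bound: "\<And>x. (\<Sum>i\<in>V. \<Sum>l\<in>V. J i l * x i * x l) \<le> j * (\<Sum>i\<in>V. (x i)\<^sup>2)"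
    and j: "0 \<le> j" "j < 1"
  shows "poincare V (\<lambda>\<sigma>. exp ((\<Sum>i\<in>V. \<Sum>l\<in>V. J i l * \<sigma> i * \<sigma> l) / 2)) (2 / (1 - j))"
proof -
  obtain M :: nat and u where Mu: "0 < M"
    "\<And>x. (\<Sum>i\<in>V. \<Sum>l\<in>V. J i l * x i * x l) = (\<Sum>a<M. (lin V (u a) x)\<^sup>2)"
    using psd_sum_of_squares[OF V sym psd] by blast
  show ?thesis
    unfolding Mu(2) by (rule poincare_sum_of_squares[OF V Mu(1) j]) (use bound Mu(2) in metis)
qed

section \<open>Messages on tree-like branches\<close>

text \<open>A directed edge from \<open>p\<close> to \<open>v\<close> carries the branch of all vertices that can be reached from
  \<open>v\<close> without returning through \<open>p\<close>, cut off at depth \<open>r\<close>.  The inner vertices are those at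
  depth below \<open>r\<close>: all their neighbours lie in the branch or are \<open>p\<close>.\<close>

fun branch_inner :: "'a rel \<Rightarrow> nat \<Rightarrow> 'a \<Rightarrow> 'a \<Rightarrow> 'a set" where
  "branch_inner E 0 p v = {}"
| "branch_inner E (Suc r) p v = insert v (\<Union>w\<in>E `` {v} - {p}. branch_inner E r v w)"

fun branch :: "'a rel \<Rightarrow> nat \<Rightarrow> 'a \<Rightarrow> 'a \<Rightarrow> 'a set" where
  "branch E 0 p v = {v}"
| "branch E (Suc r) p v = insert v (\<Union>w\<in>E `` {v} - {p}. branch E r v w)"

fun branch_energy :: "'a rel \<Rightarrow> nat \<Rightarrow> 'a \<Rightarrow> 'a \<Rightarrow> ('a \<Rightarrow> real) \<Rightarrow> real" where
  "branch_energy E 0 p v \<sigma> = 0"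
| "branch_energy E (Suc r) p v \<sigma> = (\<Sum>w\<in>E `` {v} - {p}. \<sigma> v * \<sigma> w + branch_energy E r v w \<sigma>)"

text \<open>This is \<open>tanh (\<Sum>w\<in>W. artanh (\<theta> * x w))\<close>, written without \<open>artanh\<close> so that the values
  \<open>x w = \<plusminus>1\<close> at the leaves need no separate treatment.\<close>

definition combine :: "real \<Rightarrow> 'a set \<Rightarrow> ('a \<Rightarrow> real) \<Rightarrow> real" where
  "combine \<theta> W x = ((\<Prod>w\<in>W. 1 + \<theta> * x w) - (\<Prod>w\<in>W. 1 - \<theta> * x w)) /
    ((\<Prod>w\<in>W. 1 + \<theta> * x w) + (\<Prod>w\<in>W. 1 - \<theta> * x w))"

text \<open>The belief propagation recursion: for the Ising model on the branch alone, the message is the mean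
  of \<open>\<sigma> v\<close> given the spins at depth \<open>r\<close>.\<close>

fun message :: "'a rel \<Rightarrow> real \<Rightarrow> nat \<Rightarrow> 'a \<Rightarrow> 'a \<Rightarrow> ('a \<Rightarrow> real) \<Rightarrow> real" where
  "message E \<theta> 0 p v \<sigma> = \<sigma> v"
| "message E \<theta> (Suc r) p v \<sigma> = combine \<theta> (E `` {v} - {p}) (\<lambda>w. message E \<theta> r v w \<sigma>)"

fun treelike :: "'a rel \<Rightarrow> nat \<Rightarrow> 'a \<Rightarrow> 'a \<Rightarrow> bool" where
  "treelike E 0 p v \<longleftrightarrow> p \<noteq> v"
| "treelike E (Suc r) p v \<longleftrightarrow> p \<notin> branch E (Suc r) p v \<and>
    (\<forall>w\<in>E `` {v} - {p}. treelike E r v w) \<and>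
    (\<forall>w\<in>E `` {v} - {p}. \<forall>w'\<in>E `` {v} - {p}. w \<noteq> w' \<longrightarrow> branch E r v w \<inter> branch E r v w' = {})"

lemma branch_inner_subset: "branch_inner E r p v \<subseteq> branch E r p v"
  by (induction r arbitrary: p v) auto

lemma root_in_branch: "v \<in> branch E r p v"
  by (cases r) auto

lemma treelike_parent: "treelike E r p v \<Longrightarrow> p \<notin> branch E r p v"
  by (cases r) auto

lemma treelike_disjoint:
  assumes "treelike E (Suc r) p v" "w \<in> E `` {v} - {p}" "w' \<in> E `` {v} - {p}" "w \<noteq> w'"
  shows "branch E r v w \<inter> branch E r v w' = {}"
  using assms unfolding treelike.simps by blast

lemma branch_subset:
  assumes "E \<subseteq> V \<times> V"
  shows "v \<in> V \<Longrightarrow> branch E r p v \<subseteq> V"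
proof (induction r arbitrary: p v)
  case (Suc r)
  have "branch E r v w \<subseteq> V" if "w \<in> E `` {v}" for w
    using Suc.IH[of w v] that assms by blast
  then show ?case using Suc.prems by auto
qed simp

lemma card_branch_inner:
  assumes "E \<subseteq> V \<times> V" "\<And>v. v \<in> V \<Longrightarrow> finite (E `` {v}) \<and> card (E `` {v}) = k"
  shows "v \<in> V \<Longrightarrow> finite (branch_inner E r p v) \<and> card (branch_inner E r p v) \<le> (k + 1) ^ r"
proof (induction r arbitrary: p v)
  case (Suc r)
  let ?C = "E `` {v} - {p}"
  have fin: "finite ?C" "card ?C \<le> k"
    using assms(2)[OF Suc.prems] card_mono[of "E `` {v}" ?C] by auto
  have IH: "finite (branch_inner E r v w)" "card (branch_inner E r v w) \<le> (k + 1) ^ r"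
    if "w \<in> ?C" for w
    using Suc.IH[of w v] that assms(1) by blast+
  have "card (\<Union>w\<in>?C. branch_inner E r v w) \<le> (\<Sum>w\<in>?C. card (branch_inner E r v w))"
    by (rule card_UN_le[OF fin(1)])
  also have "\<dots> \<le> card ?C * (k + 1) ^ r" by (rule sum_bounded_above[where 'a = nat, simplified]) (rule IH)
  also have "\<dots> \<le> k * (k + 1) ^ r" using fin(2) by simp
  finally have "card (\<Union>w\<in>?C. branch_inner E r v w) \<le> k * (k + 1) ^ r" .
  moreover have "finite (\<Union>w\<in>?C. branch_inner E r v w)" using fin IH by blast
  ultimately have "card (branch_inner E (Suc r) p v) \<le> Suc (k * (k + 1) ^ r)"
    by (simp add: card_insert_if)
  also have "\<dots> \<le> (k + 1) ^ r + k * (k + 1) ^ r" using one_le_power[of "k + 1" r] by simp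
  also have "\<dots> = (k + 1) ^ Suc r" by simp
  finally show ?case using \<open>finite (\<Union>w\<in>?C. branch_inner E r v w)\<close> by simp
qed simp

lemma combine_cong: "(\<And>w. w \<in> W \<Longrightarrow> x w = y w) \<Longrightarrow> combine \<theta> W x = combine \<theta> W y"
  unfolding combine_def by (metis (no_types, lifting) prod.cong)

lemma message_flip_outside:
  "u \<notin> branch E r p v \<Longrightarrow> message E \<theta> r p v (flip u \<sigma>) = message E \<theta> r p v \<sigma>"
proof (induction r arbitrary: p v)
  case 0
  then show ?case by (simp add: flip_def)
next
  case (Suc r)
  then show ?case by (auto intro!: combine_cong)
qed

lemma branch_energy_flip_outside:
  "u \<notin> branch E r p v \<Longrightarrow> branch_energy E r p v (flip u \<sigma>) = branch_energy E r p v \<sigma>"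
proof (induction r arbitrary: p v)
  case (Suc r)
  have "flip u \<sigma> v = \<sigma> v" using Suc.prems by (auto simp: flip_def)
  moreover have "flip u \<sigma> w = \<sigma> w" if "w \<in> E `` {v} - {p}" for w
    using Suc.prems that root_in_branch[of w E r v] by (auto simp: flip_def)
  ultimately show ?case using Suc by (auto intro!: sum.cong)
qed simp

lemma message_flip_inner:
  assumes "treelike E r p v" "u \<in> branch_inner E r p v"
  shows "message E \<theta> r p v (flip u \<sigma>) = message E \<theta> r p v \<sigma>"
  using assms
proof (induction r arbitrary: p v)
  case (Suc r)
  have "message E \<theta> r v w (flip u \<sigma>) = message E \<theta> r v w \<sigma>" if w: "w \<in> E `` {v} - {p}" for w
  proof (cases "u \<in> branch_inner E r v w")
    case True
    then show ?thesis using Suc.IH Suc.prems(1) w by auto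
  next
    case False
    have "u \<notin> branch E r v w"
    proof (cases "u = v")
      case True
      then show ?thesis using treelike_parent Suc.prems(1) w by (metis treelike.simps(2))
    next
      case u: False
      then obtain w' where w': "w' \<in> E `` {v} - {p}" "u \<in> branch_inner E r v w'"
        using Suc.prems(2) by auto
      then have "w \<noteq> w'" using False by auto
      then have "branch E r v w \<inter> branch E r v w' = {}" by (rule treelike_disjoint[OF Suc.prems(1) w w'(1)])
      then show ?thesis using w'(2) branch_inner_subset[of E r v w'] by blast
    qed
    then show ?thesis by (rule message_flip_outside)
  qed
  then show ?case by (auto intro!: combine_cong)
qed simp

lemma prod_plus_pos:
  fixes x :: "'a \<Rightarrow> real"
  assumes "0 \<le> \<theta>" "\<theta> < 1" "\<And>w. w \<in> W \<Longrightarrow> \<bar>x w\<bar> \<le> 1"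
  shows "0 < (\<Prod>w\<in>W. 1 + \<theta> * x w)"
proof (rule prod_pos)
  fix w assume "w \<in> W"
  then have "\<bar>\<theta> * x w\<bar> < 1"
    using assms(3)[of w] assms(1,2) mult_left_mono[of "\<bar>x w\<bar>" 1 \<theta>] by (simp add: abs_mult)
  then show "0 < 1 + \<theta> * x w" by linarith
qed

lemma prod_minus_pos:
  fixes x :: "'a \<Rightarrow> real"
  assumes "0 \<le> \<theta>" "\<theta> < 1" "\<And>w. w \<in> W \<Longrightarrow> \<bar>x w\<bar> \<le> 1"
  shows "0 < (\<Prod>w\<in>W. 1 - \<theta> * x w)"
  using prod_plus_pos[of \<theta> W "\<lambda>w. - x w"] assms by simp

lemma combine_bound:
  assumes "0 \<le> \<theta>" "\<theta> < 1" "\<And>w. w \<in> W \<Longrightarrow> \<bar>x w\<bar> \<le> 1"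
  shows "\<bar>combine \<theta> W x\<bar> \<le> 1"
proof -
  have "\<bar>(a - b) / (a + b)\<bar> \<le> 1" if "0 < a" "0 < b" for a b :: real
    using that by (simp add: abs_le_iff divide_simps)
  then show ?thesis
    unfolding combine_def using prod_plus_pos[of \<theta> W x] prod_minus_pos[of \<theta> W x] assms by blast
qed

text \<open>As a function of one argument \<open>x\<close> the value is \<open>2 A (1 + \<theta> x) / D x - 1\<close> with
  \<open>D x = A (1 + \<theta> x) + B (1 - \<theta> x)\<close>, where \<open>A\<close> and \<open>B\<close> collect the other arguments.  Differences
  carry the factor \<open>4 A B \<theta> / (D x * D y)\<close>, and the arithmetic-geometric mean inequality
  bounds \<open>(D x)\<^sup>2\<close> below by \<open>4 A B (1 - \<theta>\<^sup>2)\<close>.\<close>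

lemma combine_lipschitz:
  assumes W: "finite W" "w0 \<in> W" and \<theta>: "0 \<le> \<theta>" "\<theta> < 1"
    and x: "\<And>w. w \<in> W \<Longrightarrow> \<bar>x w\<bar> \<le> 1" and y: "\<And>w. w \<in> W \<Longrightarrow> \<bar>y w\<bar> \<le> 1"
    and eq: "\<And>w. w \<in> W \<Longrightarrow> w \<noteq> w0 \<Longrightarrow> x w = y w"
  shows "\<bar>combine \<theta> W x - combine \<theta> W y\<bar> \<le> \<theta> / (1 - \<theta>\<^sup>2) * \<bar>x w0 - y w0\<bar>"
proof -
  define A where "A = (\<Prod>w\<in>W - {w0}. 1 + \<theta> * x w)"
  define B where "B = (\<Prod>w\<in>W - {w0}. 1 - \<theta> * x w)"
  have AB: "0 < A" "0 < B"
    unfolding A_def B_def using W \<theta> x by (auto intro!: prod_plus_pos prod_minus_pos)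
  define D where "D t = A * (1 + \<theta> * t) + B * (1 - \<theta> * t)" for t
  have yAB: "(\<Prod>w\<in>W - {w0}. 1 + \<theta> * y w) = A" "(\<Prod>w\<in>W - {w0}. 1 - \<theta> * y w) = B"
    unfolding A_def B_def using eq by (auto intro!: prod.cong)
  have xAB: "(\<Prod>w\<in>W - {w0}. 1 + \<theta> * x w) = A" "(\<Prod>w\<in>W - {w0}. 1 - \<theta> * x w) = B"
    unfolding A_def B_def by simp_all
  have comb_D: "((1 + \<theta> * t) * A - (1 - \<theta> * t) * B) / ((1 + \<theta> * t) * A + (1 - \<theta> * t) * B)
      = 2 * A * (1 + \<theta> * t) / D t - 1" if "0 < D t" for t
  proof -
    have e1: "(1 + \<theta> * t) * A - (1 - \<theta> * t) * B = 2 * A * (1 + \<theta> * t) - D t"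
      and e2: "(1 + \<theta> * t) * A + (1 - \<theta> * t) * B = D t"
      unfolding D_def by (simp_all add: algebra_simps)
    show ?thesis unfolding e1 e2 using that by (simp add: diff_divide_distrib)
  qed
  have th2: "\<theta>\<^sup>2 < 1" using \<theta> by (simp add: power_less_one_iff abs_square_less_1)
  have D: "0 < D t" "4 * A * B * (1 - \<theta>\<^sup>2) \<le> (D t)\<^sup>2" if t: "\<bar>t\<bar> \<le> 1" for t
  proof -
    have "\<bar>\<theta> * t\<bar> < 1"
      using t \<theta> mult_left_mono[of "\<bar>t\<bar>" 1 \<theta>] by (simp add: abs_mult)
    then have p: "0 < 1 + \<theta> * t" "0 < 1 - \<theta> * t" by linarith+
    then show "0 < D t" unfolding D_def by (intro add_pos_pos mult_pos_pos AB p)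
    have "t\<^sup>2 \<le> 1" using t by (simp add: abs_square_le_1)
    then have "\<theta>\<^sup>2 * t\<^sup>2 \<le> \<theta>\<^sup>2 * 1" by (intro mult_left_mono) auto
    then have "4 * A * B * (1 - \<theta>\<^sup>2) \<le> 4 * A * B * (1 - \<theta>\<^sup>2 * t\<^sup>2)"
      using AB by (intro mult_left_mono) auto
    also have "\<dots> \<le> (D t)\<^sup>2"
    proof -
      have "(D t)\<^sup>2 - 4 * A * B * (1 - \<theta>\<^sup>2 * t\<^sup>2) = (A * (1 + \<theta> * t) - B * (1 - \<theta> * t))\<^sup>2"
        unfolding D_def by (simp add: power2_eq_square algebra_simps)
      then show ?thesis by (metis diff_ge_0_iff_ge zero_le_power2)
    qed
    finally show "4 * A * B * (1 - \<theta>\<^sup>2) \<le> (D t)\<^sup>2" .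
  qed
  \<comment> \<open>Multiplying the two bounds and taking the square root bounds the product of the denominators.\<close>
  have xy: "\<bar>x w0\<bar> \<le> 1" "\<bar>y w0\<bar> \<le> 1" using W x y by auto
  let ?P = "D (x w0) * D (y w0)"
  have P0: "0 < ?P" using D(1) xy by simp
  have "0 \<le> 4 * A * B * (1 - \<theta>\<^sup>2)" using AB th2 by simp
  then have "(4 * A * B * (1 - \<theta>\<^sup>2))\<^sup>2 \<le> ?P\<^sup>2"
    unfolding power_mult_distrib[of "D (x w0)"]
    using mult_mono[OF D(2)[OF xy(1)] D(2)[OF xy(2)]] by (simp add: power2_eq_square)
  then have P: "4 * A * B * (1 - \<theta>\<^sup>2) \<le> ?P"
    using P0 by (meson less_imp_le power2_le_imp_le)
  have comb: "combine \<theta> W x = 2 * A * (1 + \<theta> * x w0) / D (x w0) - 1"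
    "combine \<theta> W y = 2 * A * (1 + \<theta> * y w0) / D (y w0) - 1"
    unfolding combine_def prod.remove[OF W] xAB yAB by (rule comb_D, rule D(1), rule xy)+
  have "combine \<theta> W x - combine \<theta> W y
      = (2 * A * (1 + \<theta> * x w0) * D (y w0) - 2 * A * (1 + \<theta> * y w0) * D (x w0)) / ?P"
    unfolding comb using D(1)[OF xy(1)] D(1)[OF xy(2)] by (simp add: diff_frac_eq)
  also have "2 * A * (1 + \<theta> * x w0) * D (y w0) - 2 * A * (1 + \<theta> * y w0) * D (x w0)
      = (4 * A * B * \<theta>) * (x w0 - y w0)"
    by (simp add: D_def algebra_simps)
  finally have diff: "combine \<theta> W x - combine \<theta> W y = (4 * A * B * \<theta>) * (x w0 - y w0) / ?P" .
  have "0 \<le> 4 * A * B * \<theta>" using AB \<theta> by simp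
  then have "\<bar>combine \<theta> W x - combine \<theta> W y\<bar> = (4 * A * B * \<theta>) * \<bar>x w0 - y w0\<bar> / ?P"
    unfolding diff abs_divide abs_mult[of "4 * A * B * \<theta>"] abs_of_pos[OF P0]
    by (simp only: abs_of_nonneg)
  also have "\<dots> \<le> \<theta> / (1 - \<theta>\<^sup>2) * \<bar>x w0 - y w0\<bar>"
  proof -
    have "4 * A * B \<le> ?P / (1 - \<theta>\<^sup>2)" using P th2 by (simp only: pos_le_divide_eq diff_gt_0_iff_gt)
    then have "4 * A * B / ?P \<le> 1 / (1 - \<theta>\<^sup>2)"
      by (simp only: pos_divide_le_eq[OF P0] times_divide_eq_left mult_1)
    then have "4 * A * B / ?P * (\<theta> * \<bar>x w0 - y w0\<bar>) \<le> 1 / (1 - \<theta>\<^sup>2) * (\<theta> * \<bar>x w0 - y w0\<bar>)"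
      using \<theta> by (intro mult_right_mono) auto
    then show ?thesis by (simp add: mult.assoc)
  qed
  finally show ?thesis .
qed

text \<open>The linearisation of the edge weight: it makes the measure affine in each child spin, so that a child
  spin may be replaced by its conditional mean.\<close>

lemma exp_spin_product:
  fixes b x y :: real
  assumes "x * x = 1" "y * y = 1"
  shows "exp (b * (x * y)) = cosh b * (1 + tanh b * (x * y))"
proof -
  have "(x * y) * (x * y) = (x * x) * (y * y)" by (simp only: ac_simps)
  then have "(x * y) * (x * y) = 1" using assms by simp
  then have "(x * y - 1) * (x * y + 1) = 0" by (simp add: algebra_simps)
  then have "x * y = 1 \<or> x * y = -1" by auto
  moreover have "exp b = cosh b * (1 + tanh b)" "exp (- b) = cosh b * (1 - tanh b)"
    by (simp_all add: tanh_def algebra_simps cosh_plus_sinh cosh_minus_sinh)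
  ultimately show ?thesis by auto
qed

text \<open>Every edge occurs in both orientations, hence the division by 2.\<close>

definition pair_energy :: "'a rel \<Rightarrow> ('a \<Rightarrow> real) \<Rightarrow> real" where
  "pair_energy E \<sigma> = (\<Sum>(x, y)\<in>E. \<sigma> x * \<sigma> y) / 2"

context
  fixes V :: "'a set" and E :: "'a rel" and k :: nat
  assumes V: "finite V" and reg: "regular_graph k V E"
begin

lemma edges_subset: "E \<subseteq> V \<times> V" and edges_sym: "sym E" and edges_irrefl: "irrefl E"
  and degree: "v \<in> V \<Longrightarrow> finite (E `` {v}) \<and> card (E `` {v}) = k"
  using reg by (auto simp: regular_graph_def simple_graph_def)

lemma finite_edges: "finite E"
  using edges_subset V by (meson finite_SigmaI finite_subset)

lemma finite_nbrs: "finite (E `` {v})"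
  using finite_edges by (simp add: finite_Image)

lemma message_bound:
  assumes "0 \<le> \<theta>" "\<theta> < 1" "\<sigma> \<in> cube V"
  shows "v \<in> V \<Longrightarrow> \<bar>message E \<theta> r p v \<sigma>\<bar> \<le> 1"
proof (induction r arbitrary: p v)
  case 0
  then show ?case using cube_abs[OF assms(3)] by simp
next
  case (Suc r)
  have "w \<in> V" if "w \<in> E `` {v} - {p}" for w using that edges_subset by auto
  then show ?case using Suc assms(1,2) finite_nbrs by (auto intro!: combine_bound)
qed

lemma message_uminus: "message E \<theta> r p v (- \<sigma>) = - message E \<theta> r p v \<sigma>"
proof (induction r arbitrary: p v)
  case (Suc r)
  show ?case
    unfolding message.simps Suc.IH combine_def by (simp add: add.commute minus_divide_left)
qed simp

text \<open>A vertex lies in at most one branch below \<open>v\<close>, so it acts through one child only and the squared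
  changes add up over the children.  Hence each level contributes \<open>k - 1\<close> times the square of the
  Lipschitz constant, not the square of \<open>k - 1\<close> times it; this makes
  the sum small for \<open>\<beta>\<close> of order \<open>1 / sqrt k\<close> rather than \<open>1 / k\<close>.\<close>

lemma message_gradient:
  assumes \<theta>: "0 \<le> \<theta>" "\<theta> < 1" and \<sigma>: "\<sigma> \<in> cube V"
  shows "(p, v) \<in> E \<Longrightarrow> treelike E r p v \<Longrightarrow>
    (\<Sum>u\<in>V. (message E \<theta> r p v \<sigma> - message E \<theta> r p v (flip u \<sigma>))\<^sup>2)
      \<le> 4 * (real (k - 1) * (\<theta> / (1 - \<theta>\<^sup>2))\<^sup>2) ^ r"
proof (induction r arbitrary: p v)
  case 0
  have v: "v \<in> V" using 0 edges_subset by auto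
  have "(\<sigma> v - flip u \<sigma> v)\<^sup>2 = (if u = v then 4 else 0)" for u
    using cube_sq[OF \<sigma> v] by (auto simp: flip_def power2_eq_square)
  then show ?case using V v by simp
next
  case (Suc r)
  let ?C = "E `` {v} - {p}" and ?L = "\<theta> / (1 - \<theta>\<^sup>2)"
  let ?X = "\<lambda>w. message E \<theta> r v w"
  have v: "v \<in> V" using Suc edges_subset by auto
  have C: "finite ?C" using finite_nbrs by simp
  have CV: "w \<in> V" if "w \<in> ?C" for w using that edges_subset by auto
  have "p \<in> E `` {v}" using Suc.prems(1) edges_sym by (auto dest: symD)
  then have cC: "card ?C = k - 1" using degree[OF v] by simp
  have tl: "treelike E r v w" if "w \<in> ?C" for w using Suc.prems(2) that by simp
  have pt: "(message E \<theta> (Suc r) p v \<sigma> - message E \<theta> (Suc r) p v (flip u \<sigma>))\<^sup>2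
      \<le> (\<Sum>w\<in>?C. ?L\<^sup>2 * (?X w \<sigma> - ?X w (flip u \<sigma>))\<^sup>2)" if u: "u \<in> V" for u
  proof (cases "\<exists>w\<in>?C. u \<in> branch E r v w")
    case True
    then obtain w where w: "w \<in> ?C" "u \<in> branch E r v w" by blast
    have other: "?X w' \<sigma> = ?X w' (flip u \<sigma>)" if "w' \<in> ?C" "w' \<noteq> w" for w'
    proof -
      have "branch E r v w \<inter> branch E r v w' = {}"
        using that by (intro treelike_disjoint[OF Suc.prems(2) w(1)]) auto
      then have "u \<notin> branch E r v w'" using w(2) by blast
      then show ?thesis by (simp add: message_flip_outside)
    qed
    have "\<bar>message E \<theta> (Suc r) p v \<sigma> - message E \<theta> (Suc r) p v (flip u \<sigma>)\<bar>
        \<le> ?L * \<bar>?X w \<sigma> - ?X w (flip u \<sigma>)\<bar>"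
      unfolding message.simps
      using C w(1) \<theta> other CV message_bound[OF \<theta> \<sigma>] message_bound[OF \<theta> flip_cube[OF \<sigma> u]]
      by (intro combine_lipschitz) auto
    then have "\<bar>message E \<theta> (Suc r) p v \<sigma> - message E \<theta> (Suc r) p v (flip u \<sigma>)\<bar>\<^sup>2
        \<le> (?L * \<bar>?X w \<sigma> - ?X w (flip u \<sigma>)\<bar>)\<^sup>2"
      by (rule power_mono) simp
    then have "(message E \<theta> (Suc r) p v \<sigma> - message E \<theta> (Suc r) p v (flip u \<sigma>))\<^sup>2
        \<le> ?L\<^sup>2 * (?X w \<sigma> - ?X w (flip u \<sigma>))\<^sup>2"
      by (simp only: power_mult_distrib power2_abs)
    also have "\<dots> \<le> (\<Sum>w\<in>?C. ?L\<^sup>2 * (?X w \<sigma> - ?X w (flip u \<sigma>))\<^sup>2)"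
      using w(1) C by (intro member_le_sum[of w ?C "\<lambda>w. ?L\<^sup>2 * (?X w \<sigma> - ?X w (flip u \<sigma>))\<^sup>2"]) auto
    finally show ?thesis .
  next
    case False
    then have "message E \<theta> (Suc r) p v \<sigma> = message E \<theta> (Suc r) p v (flip u \<sigma>)"
      unfolding message.simps by (intro combine_cong) (metis message_flip_outside)
    then show ?thesis by (simp add: sum_nonneg)
  qed
  have "(\<Sum>u\<in>V. (message E \<theta> (Suc r) p v \<sigma> - message E \<theta> (Suc r) p v (flip u \<sigma>))\<^sup>2)
      \<le> (\<Sum>u\<in>V. \<Sum>w\<in>?C. ?L\<^sup>2 * (?X w \<sigma> - ?X w (flip u \<sigma>))\<^sup>2)"
    by (rule sum_mono) (rule pt)
  also have "\<dots> = (\<Sum>w\<in>?C. ?L\<^sup>2 * (\<Sum>u\<in>V. (?X w \<sigma> - ?X w (flip u \<sigma>))\<^sup>2))"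
    by (subst sum.swap) (simp add: sum_distrib_left)
  also have "\<dots> \<le> (\<Sum>w\<in>?C. ?L\<^sup>2 * (4 * (real (k - 1) * ?L\<^sup>2) ^ r))"
    using Suc.IH tl by (intro sum_mono mult_left_mono) auto
  also have "\<dots> = 4 * (real (k - 1) * ?L\<^sup>2) ^ Suc r" using cC by simp
  finally show ?case .
qed

text \<open>Integrating out the inner spins of the branch from the leaves upwards.  The weight of the branch is
  a product over the children \<open>w\<close> of their branch weights and factors affine in \<open>\<sigma> w\<close>; by
  induction the spins \<open>\<sigma> w\<close> are replaced by their messages one after the other, everything else being
  independent of the inner spins below \<open>w\<close>.  The remaining sum over \<open>\<sigma> v\<close> vanishes by the
  definition of the message.\<close>

lemma branch_conditional_mean:
  assumes b: "0 \<le> b"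
  shows "v \<in> V \<Longrightarrow> treelike E r p v \<Longrightarrow>
    (\<And>u \<sigma>. u \<in> branch_inner E r p v \<Longrightarrow> \<sigma> \<in> cube V \<Longrightarrow> H (flip u \<sigma>) = H \<sigma>) \<Longrightarrow>
    (\<Sum>\<sigma>\<in>cube V. exp (b * branch_energy E r p v \<sigma>) *
      (\<sigma> v - message E (tanh b) r p v \<sigma>) * H \<sigma>) = 0"
proof (induction r arbitrary: p v H)
  case 0
  then show ?case by simp
next
  case (Suc r)
  let ?\<theta> = "tanh b"
  let ?C = "E `` {v} - {p}" and ?X = "\<lambda>w. message E ?\<theta> r v w"
    and ?S = "\<lambda>w. branch_energy E r v w"
  let ?Y = "message E ?\<theta> (Suc r) p v"
  have \<theta>: "0 \<le> ?\<theta>" "?\<theta> < 1" using b by (auto simp: tanh_real_lt_1)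
  have C: "finite ?C" using finite_nbrs by simp
  have CV: "w \<in> V" if "w \<in> ?C" for w using that edges_subset by auto
  have tl: "treelike E r v w" if "w \<in> ?C" for w using Suc.prems(2) that by simp
  have vnb: "v \<notin> branch E r v w" if "w \<in> ?C" for w using treelike_parent[OF tl[OF that]] .
  \<comment> \<open>\<open>D\<close> is the set of children whose spins have already been replaced by messages.\<close>
  define P where "P D \<sigma> = (\<Prod>w\<in>?C. exp (b * ?S w \<sigma>) *
    (1 + ?\<theta> * (\<sigma> v * (if w \<in> D then ?X w \<sigma> else \<sigma> w))))" for D \<sigma>
  have start: "exp (b * branch_energy E (Suc r) p v \<sigma>) = cosh b ^ card ?C * P {} \<sigma>"
    if \<sigma>: "\<sigma> \<in> cube V" for \<sigma>
  proof -
    have "exp (b * branch_energy E (Suc r) p v \<sigma>)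
        = (\<Prod>w\<in>?C. exp (b * (\<sigma> v * \<sigma> w + ?S w \<sigma>)))"
      unfolding branch_energy.simps sum_distrib_left by (rule exp_sum[OF C])
    also have "\<dots> = (\<Prod>w\<in>?C. cosh b * (exp (b * ?S w \<sigma>) * (1 + ?\<theta> * (\<sigma> v * \<sigma> w))))"
    proof (rule prod.cong)
      fix w assume w: "w \<in> ?C"
      have "exp (b * (\<sigma> v * \<sigma> w + ?S w \<sigma>)) = exp (b * ?S w \<sigma>) * exp (b * (\<sigma> v * \<sigma> w))"
        by (simp add: distrib_left exp_add)
      then show "exp (b * (\<sigma> v * \<sigma> w + ?S w \<sigma>))
          = cosh b * (exp (b * ?S w \<sigma>) * (1 + ?\<theta> * (\<sigma> v * \<sigma> w)))"
        using exp_spin_product[OF cube_sq[OF \<sigma> Suc.prems(1)] cube_sq[OF \<sigma> CV[OF w]]] by simp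
    qed simp
    also have "\<dots> = cosh b ^ card ?C * P {} \<sigma>"
      by (simp add: prod.distrib P_def)
    finally show ?thesis .
  qed
  have replace: "(\<Sum>\<sigma>\<in>cube V. P D \<sigma> * (\<sigma> v - ?Y \<sigma>) * H \<sigma>)
      = (\<Sum>\<sigma>\<in>cube V. P {} \<sigma> * (\<sigma> v - ?Y \<sigma>) * H \<sigma>)" if "D \<subseteq> ?C" for D
    using finite_subset[OF that C] that
  proof (induction D rule: finite_induct)
    case (insert w D)
    then have w: "w \<in> ?C" by auto
    define R where "R \<sigma> = (\<Prod>w'\<in>?C - {w}. exp (b * ?S w' \<sigma>) *
      (1 + ?\<theta> * (\<sigma> v * (if w' \<in> D then ?X w' \<sigma> else \<sigma> w'))))" for \<sigma>
    have PD: "P D \<sigma> = exp (b * ?S w \<sigma>) * (1 + ?\<theta> * (\<sigma> v * \<sigma> w)) * R \<sigma>" for \<sigma>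
      unfolding P_def R_def using C w insert.hyps by (subst prod.remove[of ?C w]) auto
    have PiD: "P (insert w D) \<sigma> = exp (b * ?S w \<sigma>) * (1 + ?\<theta> * (\<sigma> v * ?X w \<sigma>)) * R \<sigma>" for \<sigma>
      unfolding P_def R_def using C w by (subst prod.remove[of ?C w]) (auto intro!: prod.cong)
    define H' where "H' \<sigma> = ?\<theta> * \<sigma> v * R \<sigma> * (\<sigma> v - ?Y \<sigma>) * H \<sigma>" for \<sigma>
    have "(\<Sum>\<sigma>\<in>cube V. exp (b * ?S w \<sigma>) * (\<sigma> w - ?X w \<sigma>) * H' \<sigma>) = 0"
    proof (rule Suc.IH[OF CV[OF w] tl[OF w]])
      fix u \<sigma> assume u: "u \<in> branch_inner E r v w" and \<sigma>: "\<sigma> \<in> cube V"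
      then have ub: "u \<in> branch E r v w" using branch_inner_subset[of E r v w] by blast
      have uv: "flip u \<sigma> v = \<sigma> v" using ub vnb[OF w] by (auto simp: flip_def)
      have ui: "u \<in> branch_inner E (Suc r) p v" using u w by auto
      have "R (flip u \<sigma>) = R \<sigma>"
        unfolding R_def
      proof (rule prod.cong)
        fix w' assume w': "w' \<in> ?C - {w}"
        then have "branch E r v w \<inter> branch E r v w' = {}"
          by (intro treelike_disjoint[OF Suc.prems(2) w]) auto
        then have n: "u \<notin> branch E r v w'" using ub by blast
        then have "flip u \<sigma> w' = \<sigma> w'"
          using root_in_branch[of w' E r v] by (auto simp: flip_def)
        then show "exp (b * ?S w' (flip u \<sigma>)) *
            (1 + ?\<theta> * (flip u \<sigma> v * (if w' \<in> D then ?X w' (flip u \<sigma>) else flip u \<sigma> w')))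
          = exp (b * ?S w' \<sigma>) * (1 + ?\<theta> * (\<sigma> v * (if w' \<in> D then ?X w' \<sigma> else \<sigma> w')))"
          by (simp add: uv message_flip_outside[OF n] branch_energy_flip_outside[OF n])
      qed simp
      then show "H' (flip u \<sigma>) = H' \<sigma>"
        unfolding H'_def uv message_flip_inner[OF Suc.prems(2) ui] Suc.prems(3)[OF ui \<sigma>] by simp
    qed
    moreover have "exp (b * ?S w \<sigma>) * (\<sigma> w - ?X w \<sigma>) * H' \<sigma>
        = P D \<sigma> * (\<sigma> v - ?Y \<sigma>) * H \<sigma> - P (insert w D) \<sigma> * (\<sigma> v - ?Y \<sigma>) * H \<sigma>" for \<sigma>
      unfolding PD PiD H'_def by (simp add: algebra_simps del: message.simps)
    ultimately show ?case using insert by (simp add: sum_subtractf del: message.simps)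
  qed simp
  have "(\<Sum>\<sigma>\<in>cube V. P ?C \<sigma> * (\<sigma> v - ?Y \<sigma>) * H \<sigma>) = 0"
  proof -
    let ?F = "\<lambda>\<sigma>. P ?C \<sigma> * (\<sigma> v - ?Y \<sigma>) * H \<sigma>"
    have "?F \<sigma> + ?F (flip v \<sigma>) = 0" if \<sigma>: "\<sigma> \<in> cube V" for \<sigma>
    proof -
      have vi: "v \<in> branch_inner E (Suc r) p v" by simp
      define S0 where "S0 = (\<Prod>w\<in>?C. exp (b * ?S w \<sigma>))"
      define A where "A = (\<Prod>w\<in>?C. 1 + ?\<theta> * ?X w \<sigma>)"
      define B where "B = (\<Prod>w\<in>?C. 1 - ?\<theta> * ?X w \<sigma>)"
      define y where "y = ?Y \<sigma>"
      have Xb: "\<bar>?X w \<sigma>\<bar> \<le> 1" if "w \<in> ?C" for w using message_bound[OF \<theta> \<sigma> CV[OF that]] .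
      have "0 < A" "0 < B"
        unfolding A_def B_def by (intro prod_plus_pos prod_minus_pos \<theta> Xb; assumption)+
      moreover have "y = (A - B) / (A + B)"
        unfolding y_def A_def B_def message.simps combine_def ..
      ultimately have "y * (A + B) = A - B" by simp
      then have AB: "A * (1 - y) - B * (1 + y) = 0" by (simp add: algebra_simps)
      have fv: "flip v \<sigma> v = - \<sigma> v" by (simp add: flip_def)
      have P1: "P ?C \<sigma> = S0 * (\<Prod>w\<in>?C. 1 + ?\<theta> * (\<sigma> v * ?X w \<sigma>))"
        unfolding P_def S0_def by (simp add: prod.distrib)
      have P2: "P ?C (flip v \<sigma>) = S0 * (\<Prod>w\<in>?C. 1 + ?\<theta> * (- \<sigma> v * ?X w \<sigma>))"
        unfolding P_def S0_def prod.distrib[symmetric]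
      proof (rule prod.cong)
        fix w assume w: "w \<in> ?C"
        show "exp (b * ?S w (flip v \<sigma>)) *
            (1 + ?\<theta> * (flip v \<sigma> v * (if w \<in> ?C then ?X w (flip v \<sigma>) else flip v \<sigma> w)))
          = exp (b * ?S w \<sigma>) * (1 + ?\<theta> * (- \<sigma> v * ?X w \<sigma>))"
          unfolding fv message_flip_outside[OF vnb[OF w]] branch_energy_flip_outside[OF vnb[OF w]]
          using w by simp
      qed simp
      have F: "?F \<sigma> + ?F (flip v \<sigma>)
          = P ?C \<sigma> * (\<sigma> v - y) * H \<sigma> + P ?C (flip v \<sigma>) * (- \<sigma> v - y) * H \<sigma>"
        unfolding message_flip_inner[OF Suc.prems(2) vi] Suc.prems(3)[OF vi \<sigma>] fv y_def ..
      consider "\<sigma> v = 1" | "\<sigma> v = -1" using \<sigma> Suc.prems(1) by (auto simp: cube_def)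
      then have "?F \<sigma> + ?F (flip v \<sigma>) = S0 * H \<sigma> * (A * (1 - y) - B * (1 + y))"
      proof cases
        case 1
        have "P ?C \<sigma> = S0 * A" "P ?C (flip v \<sigma>) = S0 * B"
          unfolding P1 P2 1 A_def B_def by simp_all
        then show ?thesis unfolding F unfolding 1 by (simp add: algebra_simps)
      next
        case 2
        have "P ?C \<sigma> = S0 * B" "P ?C (flip v \<sigma>) = S0 * A"
          unfolding P1 P2 2 A_def B_def by simp_all
        then show ?thesis unfolding F unfolding 2 by (simp add: algebra_simps)
      qed
      then show ?thesis unfolding AB by simp
    qed
    then have "(\<Sum>\<sigma>\<in>cube V. ?F \<sigma>) + (\<Sum>\<sigma>\<in>cube V. ?F (flip v \<sigma>)) = 0"
      unfolding sum.distrib[symmetric] by (rule sum.neutral[rule_format])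
    then show ?thesis using sum_cube_flip[OF Suc.prems(1), of ?F] by linarith
  qed
  then have "(\<Sum>\<sigma>\<in>cube V. P {} \<sigma> * (\<sigma> v - ?Y \<sigma>) * H \<sigma>) = 0"
    using replace[of ?C] by simp
  moreover have "(\<Sum>\<sigma>\<in>cube V. exp (b * branch_energy E (Suc r) p v \<sigma>) * (\<sigma> v - ?Y \<sigma>) * H \<sigma>)
      = cosh b ^ card ?C * (\<Sum>\<sigma>\<in>cube V. P {} \<sigma> * (\<sigma> v - ?Y \<sigma>) * H \<sigma>)"
    unfolding sum_distrib_left by (rule sum.cong) (simp_all only: start mult.assoc)
  ultimately show ?case by (simp only: mult_zero_right)
qed

lemma pair_energy_flip:
  "pair_energy E (flip u \<sigma>) - pair_energy E \<sigma> = - 2 * \<sigma> u * (\<Sum>y\<in>E `` {u}. \<sigma> y)"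
proof -
  let ?g = "\<lambda>y. - 2 * \<sigma> u * \<sigma> y"
  have "(\<Sum>(x, y)\<in>E. flip u \<sigma> x * flip u \<sigma> y) - (\<Sum>(x, y)\<in>E. \<sigma> x * \<sigma> y)
      = (\<Sum>(x, y)\<in>E. (if x = u then ?g y else 0) + (if y = u then ?g x else 0))"
    unfolding sum_subtractf[symmetric]
    by (rule sum.cong) (use edges_irrefl in \<open>auto simp: flip_def irrefl_def\<close>)
  also have "\<dots> = (\<Sum>(x, y)\<in>E. if x = u then ?g y else 0) + (\<Sum>(x, y)\<in>E. if y = u then ?g x else 0)"
    by (simp add: split_def sum.distrib)
  also have "(\<Sum>(x, y)\<in>E. if y = u then ?g x else 0) = (\<Sum>(x, y)\<in>E. if x = u then ?g y else 0)"
    by (rule sum.reindex_bij_witness[of _ "\<lambda>(x, y). (y, x)" "\<lambda>(x, y). (y, x)"])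
      (use edges_sym in \<open>auto dest: symD\<close>)
  also have "(\<Sum>(x, y)\<in>E. if x = u then ?g y else 0) = (\<Sum>(x, y)\<in>{u} \<times> E `` {u}. ?g y)"
    by (rule sum.mono_neutral_cong_right) (use finite_edges in \<open>auto split: if_splits\<close>)
  also have "\<dots> = (\<Sum>y\<in>E `` {u}. ?g y)"
    by (simp add: sum.cartesian_product[symmetric])
  also have "(\<Sum>y\<in>E `` {u}. ?g y) = - 2 * \<sigma> u * (\<Sum>y\<in>E `` {u}. \<sigma> y)"
    by (simp add: sum_distrib_left)
  finally show ?thesis unfolding pair_energy_def diff_divide_distrib[symmetric] by simp
qed

text \<open>The edges at an inner vertex all belong to the branch or are the edge from \<open>p\<close> to \<open>v\<close>.  By
  comparison with \<open>pair_energy_flip\<close>, the rest of the energy is independent of the inner spins.\<close>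

lemma branch_energy_flip_inner:
  assumes "treelike E r p v" "(p, v) \<in> E" "u \<in> branch_inner E r p v"
  shows "flip u \<sigma> p * flip u \<sigma> v + branch_energy E r p v (flip u \<sigma>)
    - (\<sigma> p * \<sigma> v + branch_energy E r p v \<sigma>) = - 2 * \<sigma> u * (\<Sum>y\<in>E `` {u}. \<sigma> y)"
  using assms
proof (induction r arbitrary: p v)
  case (Suc r)
  let ?C = "E `` {v} - {p}"
  have C: "finite ?C" using finite_nbrs by simp
  have tl: "treelike E r v w" if "w \<in> ?C" for w using Suc.prems(1) that by simp
  have vnb: "v \<notin> branch E r v w" if "w \<in> ?C" for w using treelike_parent[OF tl[OF that]] .
  have pE: "p \<in> E `` {v}" using Suc.prems(2) edges_sym by (auto dest: symD)
  have "u \<in> branch E (Suc r) p v"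
    using Suc.prems(3) branch_inner_subset[of E "Suc r" p v] by blast
  then have "u \<noteq> p" using treelike_parent[OF Suc.prems(1)] by auto
  then have fp: "flip u \<sigma> p = \<sigma> p" by (auto simp: flip_def)
  show ?case
  proof (cases "u = v")
    case True
    have "flip u \<sigma> w = \<sigma> w" if "w \<in> ?C" for w
      using True vnb[OF that] root_in_branch[of w E r v] by (auto simp: flip_def)
    moreover have "branch_energy E r v w (flip u \<sigma>) = branch_energy E r v w \<sigma>" if "w \<in> ?C" for w
      using True vnb[OF that] by (simp add: branch_energy_flip_outside)
    moreover have "flip u \<sigma> v = - \<sigma> v" using True by (simp add: flip_def)
    ultimately have "(\<Sum>w\<in>?C. flip u \<sigma> v * flip u \<sigma> w + branch_energy E r v w (flip u \<sigma>))
        = (\<Sum>w\<in>?C. - \<sigma> v * \<sigma> w + branch_energy E r v w \<sigma>)"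
      by (intro sum.cong) simp_all
    also have "\<dots> = (\<Sum>w\<in>?C. \<sigma> v * \<sigma> w + branch_energy E r v w \<sigma>) - 2 * \<sigma> v * (\<Sum>w\<in>?C. \<sigma> w)"
      unfolding sum_distrib_left sum_subtractf[symmetric] by (rule sum.cong) auto
    finally have "branch_energy E (Suc r) p v (flip u \<sigma>)
        = branch_energy E (Suc r) p v \<sigma> - 2 * \<sigma> v * (\<Sum>w\<in>?C. \<sigma> w)"
      unfolding branch_energy.simps .
    moreover have "(\<Sum>y\<in>E `` {u}. \<sigma> y) = \<sigma> p + (\<Sum>w\<in>?C. \<sigma> w)"
      using True pE finite_nbrs by (simp add: sum.remove)
    moreover have "flip u \<sigma> v = - \<sigma> v" using True by (simp add: flip_def)
    ultimately show ?thesis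
      using True fp by (simp add: algebra_simps del: branch_energy.simps)
  next
    case False
    then obtain w where w: "w \<in> ?C" "u \<in> branch_inner E r v w" using Suc.prems(3) by auto
    have fv: "flip u \<sigma> v = \<sigma> v" using False by (simp add: flip_def)
    have ub: "u \<in> branch E r v w" using w(2) branch_inner_subset[of E r v w] by blast
    have other: "flip u \<sigma> v * flip u \<sigma> w' + branch_energy E r v w' (flip u \<sigma>)
        = \<sigma> v * \<sigma> w' + branch_energy E r v w' \<sigma>" if w': "w' \<in> ?C - {w}" for w'
    proof -
      have "branch E r v w \<inter> branch E r v w' = {}"
        using w' by (intro treelike_disjoint[OF Suc.prems(1) w(1)]) auto
      then have n: "u \<notin> branch E r v w'" using ub by blast
      then have "flip u \<sigma> w' = \<sigma> w'" using root_in_branch[of w' E r v] by (auto simp: flip_def)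
      then show ?thesis by (simp add: fv branch_energy_flip_outside[OF n])
    qed
    have rest: "(\<Sum>w'\<in>?C - {w}. flip u \<sigma> v * flip u \<sigma> w' + branch_energy E r v w' (flip u \<sigma>))
        = (\<Sum>w'\<in>?C - {w}. \<sigma> v * \<sigma> w' + branch_energy E r v w' \<sigma>)"
      by (rule sum.cong[OF refl]) (rule other)
    have "branch_energy E (Suc r) p v (flip u \<sigma>) - branch_energy E (Suc r) p v \<sigma>
        = (flip u \<sigma> v * flip u \<sigma> w + branch_energy E r v w (flip u \<sigma>))
          - (\<sigma> v * \<sigma> w + branch_energy E r v w \<sigma>)"
      unfolding branch_energy.simps sum.remove[OF C w(1)] rest by (rule add_diff_cancel_right)
    also have "\<dots> = - 2 * \<sigma> u * (\<Sum>y\<in>E `` {u}. \<sigma> y)"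
      using Suc.IH[OF tl[OF w(1)] _ w(2)] w(1) by auto
    finally show ?thesis using fp fv by (simp del: branch_energy.simps)
  qed
qed simp

text \<open>With \<open>\<theta> = tanh b\<close> the edge weight multiplies the branch weight by \<open>1 + \<theta> \<sigma>\<^sub>i \<sigma>\<^sub>j\<close>, and a
  spin of mean \<open>X\<close> tilted in this way has mean \<open>(X + \<theta> \<sigma>\<^sub>i) / (1 + \<theta> \<sigma>\<^sub>i X)\<close>.  The function
  \<open>R\<close> stands for any further weight that does not see the inner spins.\<close>

lemma edge_conditional_mean:
  assumes b: "0 \<le> b" and e: "(i, j) \<in> E" and tl: "treelike E r i j"
    and R: "\<And>u \<sigma>. u \<in> branch_inner E r i j \<Longrightarrow> \<sigma> \<in> cube V \<Longrightarrow> R (flip u \<sigma>) = R \<sigma>"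
  shows "(\<Sum>\<sigma>\<in>cube V. exp (b * pair_energy E \<sigma>) * R \<sigma> * (\<sigma> i * \<sigma> j -
    (tanh b + \<sigma> i * message E (tanh b) r i j \<sigma>) / (1 + tanh b * (\<sigma> i * message E (tanh b) r i j \<sigma>)))) = 0"
proof -
  let ?\<theta> = "tanh b" and ?X = "message E (tanh b) r i j"
  have \<theta>: "0 \<le> ?\<theta>" "?\<theta> < 1" using b by (auto simp: tanh_real_lt_1)
  have ij: "i \<in> V" "j \<in> V" using e edges_subset by auto
  define H1 where "H1 \<sigma> = exp (b * (pair_energy E \<sigma> - (\<sigma> i * \<sigma> j + branch_energy E r i j \<sigma>)))" for \<sigma>
  define H where "H \<sigma> = cosh b * H1 \<sigma> * R \<sigma> * (1 - ?\<theta>\<^sup>2) / (1 + ?\<theta> * (\<sigma> i * ?X \<sigma>)) * \<sigma> i" for \<sigma>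
  have "exp (b * pair_energy E \<sigma>) * R \<sigma> * (\<sigma> i * \<sigma> j -
      (?\<theta> + \<sigma> i * ?X \<sigma>) / (1 + ?\<theta> * (\<sigma> i * ?X \<sigma>)))
      = exp (b * branch_energy E r i j \<sigma>) * (\<sigma> j - ?X \<sigma>) * H \<sigma>" if \<sigma>: "\<sigma> \<in> cube V" for \<sigma>
  proof -
    have "exp (b * pair_energy E \<sigma>)
        = exp (b * branch_energy E r i j \<sigma> + b * (\<sigma> i * \<sigma> j)
          + b * (pair_energy E \<sigma> - (\<sigma> i * \<sigma> j + branch_energy E r i j \<sigma>)))"
      by (simp add: algebra_simps)
    also have "\<dots> = exp (b * branch_energy E r i j \<sigma>) * exp (b * (\<sigma> i * \<sigma> j)) * H1 \<sigma>"
      unfolding H1_def by (simp only: exp_add)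
    also have "exp (b * (\<sigma> i * \<sigma> j)) = cosh b * (1 + ?\<theta> * (\<sigma> i * \<sigma> j))"
      by (rule exp_spin_product) (use cube_sq[OF \<sigma>] ij in auto)
    finally have 1: "exp (b * pair_energy E \<sigma>)
        = exp (b * branch_energy E r i j \<sigma>) * (cosh b * (1 + ?\<theta> * (\<sigma> i * \<sigma> j))) * H1 \<sigma>" .
    define y where "y = \<sigma> i * ?X \<sigma>"
    define z where "z = \<sigma> i * \<sigma> j"
    have "\<bar>y\<bar> \<le> 1"
      unfolding y_def using cube_abs[OF \<sigma> ij(1)] message_bound[OF \<theta> \<sigma> ij(2)] by (simp add: abs_mult)
    then have "\<bar>?\<theta> * y\<bar> < 1"
      using \<theta> mult_left_mono[of "\<bar>y\<bar>" 1 ?\<theta>] by (simp add: abs_mult)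
    then have y0: "1 + ?\<theta> * y \<noteq> 0" by auto
    have "z * z = (\<sigma> i * \<sigma> i) * (\<sigma> j * \<sigma> j)" unfolding z_def by (simp only: ac_simps)
    then have zz: "z * z = 1" using cube_sq[OF \<sigma> ij(1)] cube_sq[OF \<sigma> ij(2)] by simp
    have ii: "\<sigma> i * (\<sigma> j - ?X \<sigma>) = z - y" by (simp add: z_def y_def algebra_simps)
    have "(1 + ?\<theta> * z) * (z - (?\<theta> + y) / (1 + ?\<theta> * y)) = (1 - ?\<theta>\<^sup>2) / (1 + ?\<theta> * y) * (z - y)"
    proof -
      have "(1 + ?\<theta> * z) * (z * (1 + ?\<theta> * y) - (?\<theta> + y)) = (1 - ?\<theta>\<^sup>2) * (z - y)"
      proof -
        have "(1 + ?\<theta> * z) * (z * (1 + ?\<theta> * y) - (?\<theta> + y))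
            = z + ?\<theta> * (z * z) - ?\<theta> - y - ?\<theta> * ?\<theta> * z + ?\<theta> * ?\<theta> * y * (z * z)"
          by (simp add: algebra_simps)
        then show ?thesis unfolding zz by (simp add: algebra_simps power2_eq_square)
      qed
      then show ?thesis using y0 by (simp add: field_simps)
    qed
    then have key: "(1 + ?\<theta> * z) * (z - (?\<theta> + y) / (1 + ?\<theta> * y))
        = (1 - ?\<theta>\<^sup>2) / (1 + ?\<theta> * y) * (\<sigma> i * (\<sigma> j - ?X \<sigma>))"
      unfolding ii .
    have "exp (b * pair_energy E \<sigma>) * R \<sigma> * (z - (?\<theta> + y) / (1 + ?\<theta> * y))
        = exp (b * branch_energy E r i j \<sigma>) * cosh b * H1 \<sigma> * R \<sigma> *
          ((1 + ?\<theta> * z) * (z - (?\<theta> + y) / (1 + ?\<theta> * y)))"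
      unfolding 1 z_def[symmetric] by (simp only: ac_simps)
    then show ?thesis
      unfolding key H_def y_def[symmetric] z_def[symmetric] by simp
  qed
  then have "(\<Sum>\<sigma>\<in>cube V. exp (b * pair_energy E \<sigma>) * R \<sigma> * (\<sigma> i * \<sigma> j -
      (?\<theta> + \<sigma> i * ?X \<sigma>) / (1 + ?\<theta> * (\<sigma> i * ?X \<sigma>))))
      = (\<Sum>\<sigma>\<in>cube V. exp (b * branch_energy E r i j \<sigma>) * (\<sigma> j - ?X \<sigma>) * H \<sigma>)"
    by (rule sum.cong[OF refl])
  also have "\<dots> = 0"
  proof (rule branch_conditional_mean[OF b ij(2) tl])
    fix u \<sigma> assume u: "u \<in> branch_inner E r i j" and \<sigma>: "\<sigma> \<in> cube V"
    have "u \<noteq> i" using u treelike_parent[OF tl] branch_inner_subset[of E r i j] by blast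
    then have fi: "flip u \<sigma> i = \<sigma> i" by (simp add: flip_def)
    have "H1 (flip u \<sigma>) = H1 \<sigma>"
      unfolding H1_def using branch_energy_flip_inner[OF tl e u, of \<sigma>] pair_energy_flip[of u \<sigma>]
      by (intro arg_cong[of _ _ "\<lambda>t. exp (b * t)"]) linarith
    then show "H (flip u \<sigma>) = H \<sigma>"
      unfolding H_def by (simp only: fi R[OF u \<sigma>] message_flip_inner[OF tl u])
  qed
  finally show ?thesis .
qed

end

section \<open>Branches inside a ball of the regular tree\<close>

lemma graph_ball_mono: "d \<le> d' \<Longrightarrow> graph_ball E v d \<subseteq> graph_ball E v d'"
proof
  fix w assume d: "d \<le> d'" and "w \<in> graph_ball E v d"
  then obtain n where "n \<le> d" "(v, w) \<in> E ^^ n" unfolding graph_ball_def by blast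
  with d have "n \<le> d'" "(v, w) \<in> E ^^ n" by auto
  then show "w \<in> graph_ball E v d'" unfolding graph_ball_def by blast
qed

text \<open>Under the isomorphism the parent of a word is its tail, so children prepend a letter and the branch
  below \<open>v\<close> consists of words with suffix \<open>f v\<close>.  Different children give different letters at
  the same position from the end, so their branches are disjoint.\<close>

lemma treelike_in_tree_ball:
  assumes inj: "inj_on f (graph_ball E i R)"
    and edges: "\<And>x y. x \<in> graph_ball E i R \<Longrightarrow> y \<in> graph_ball E i R \<Longrightarrow> (x, y) \<in> E \<Longrightarrow>
      (f x, f y) \<in> tree_edges k"
  shows "v \<in> graph_ball E i d \<Longrightarrow> d + m \<le> R \<Longrightarrow> p \<in> graph_ball E i R \<Longrightarrow> f v = a # f p \<Longrightarrow>
    treelike E m p v \<and> (\<forall>u\<in>branch E m p v. \<exists>ys. f u = ys @ f v)"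
proof (induction m arbitrary: p v d a)
  case 0
  then show ?case by auto
next
  case (Suc m)
  have v: "v \<in> graph_ball E i R" using Suc.prems(1,2) graph_ball_mono[of d R E i] by auto
  have nbr: "w \<in> graph_ball E i (Suc d)" "w \<in> graph_ball E i R" if w: "w \<in> E `` {v}" for w
  proof -
    obtain n where n: "n \<le> d" "(i, v) \<in> E ^^ n" using Suc.prems(1) by (auto simp: graph_ball_def)
    then have "(i, w) \<in> E ^^ Suc n" using w by auto
    then show "w \<in> graph_ball E i (Suc d)" using n(1) unfolding graph_ball_def by blast
    then show "w \<in> graph_ball E i R" using graph_ball_mono[of "Suc d" R E i] Suc.prems(2) by auto
  qed
  have child: "\<exists>b. f w = b # f v \<and> treelike E m v w \<and> (\<forall>u\<in>branch E m v w. \<exists>ys. f u = ys @ f w)"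
    if w: "w \<in> E `` {v} - {p}" for w
  proof -
    have wE: "w \<in> E `` {v}" using w by simp
    have "f w \<noteq> f p"
      using inj_onD[OF inj _ nbr(2)[OF wE] Suc.prems(3)] w by blast
    moreover have "(f v, f w) \<in> tree_edges k" using edges[OF v nbr(2)[OF wE]] w by simp
    ultimately obtain b where b: "f w = b # f v"
      using Suc.prems(4) by (auto simp: tree_edges_def)
    have "Suc d + m \<le> R" using Suc.prems(2) by simp
    from Suc.IH[OF nbr(1)[OF wE] this v b] b show ?thesis by blast
  qed
  have below: "\<exists>ys. f u = ys @ f v" if u: "u \<in> branch E (Suc m) p v" for u
  proof (cases "u = v")
    case False
    then obtain w where "w \<in> E `` {v} - {p}" "u \<in> branch E m v w" using u by auto
    then obtain b ys where "f w = b # f v" "f u = ys @ f w" using child by blast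
    then have "f u = (ys @ [b]) @ f v" by simp
    then show ?thesis by blast
  qed (auto intro: exI[of _ "[]"])
  have "p \<notin> branch E (Suc m) p v"
  proof
    assume "p \<in> branch E (Suc m) p v"
    then obtain ys where "f p = ys @ f v" using below by blast
    then have "length (f p) = length ys + Suc (length (f p))" using Suc.prems(4) by simp
    then show False by simp
  qed
  moreover have "branch E m v w \<inter> branch E m v w' = {}"
    if w: "w \<in> E `` {v} - {p}" "w' \<in> E `` {v} - {p}" "w \<noteq> w'" for w w'
  proof (rule ccontr)
    assume "branch E m v w \<inter> branch E m v w' \<noteq> {}"
    then obtain u where u: "u \<in> branch E m v w" "u \<in> branch E m v w'" by blast
    obtain b ys where b: "f w = b # f v" "f u = ys @ f w" using child[OF w(1)] u(1) by blast
    obtain b' ys' where b': "f w' = b' # f v" "f u = ys' @ f w'" using child[OF w(2)] u(2) by blast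
    have "f w = f w'" using b b' by auto
    have "w = w'"
      using inj_onD[OF inj \<open>f w = f w'\<close> nbr(2) nbr(2)] w(1,2) by simp
    then show False using w(3) by simp
  qed
  ultimately have "treelike E (Suc m) p v"
    unfolding treelike.simps(2) using child by blast
  then show ?case using below by blast
qed

lemma balls_isomorphic_treelike:
  assumes "balls_isomorphic (Suc r) E i (tree_edges k) []" and e: "(i, j) \<in> E"
  shows "treelike E r i j"
proof -
  obtain f where f: "bij_betw f (graph_ball E i (Suc r)) (graph_ball (tree_edges k) [] (Suc r))"
    "f i = []" and edges: "\<And>x y. x \<in> graph_ball E i (Suc r) \<Longrightarrow> y \<in> graph_ball E i (Suc r) \<Longrightarrow>
      (x, y) \<in> E \<longleftrightarrow> (f x, f y) \<in> tree_edges k"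
    using assms(1) unfolding balls_isomorphic_def by blast
  have i: "i \<in> graph_ball E i (Suc r)" unfolding graph_ball_def by (auto intro!: exI[of _ 0])
  have "(i, j) \<in> E ^^ 1" using e by simp
  then have j: "j \<in> graph_ball E i 1" unfolding graph_ball_def by blast
  then have "j \<in> graph_ball E i (Suc r)"
    using graph_ball_mono[of 1 "Suc r" E i] by auto
  then have "([], f j) \<in> tree_edges k" using edges[OF i] e f(2) by simp
  then obtain a where a: "f j = a # f i" using f(2) by (auto simp: tree_edges_def)
  have "treelike E r i j \<and> (\<forall>u\<in>branch E r i j. \<exists>ys. f u = ys @ f j)"
    by (rule treelike_in_tree_ball[OF _ _ j _ i a])
      (use f(1) edges in \<open>auto simp: bij_betw_def\<close>)
  then show ?thesis ..
qed

section \<open>The spectral hypothesis as a bound on quadratic forms\<close>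

text \<open>The Rayleigh principle: the form attains its maximum \<open>c\<close> on the compact unit sphere, and at a
  maximiser \<open>x\<close> the vector \<open>g = a x - c x\<close> vanishes, since otherwise \<open>x + s g\<close> would violate the
  bound for small positive \<open>s\<close>.\<close>

lemma symmetric_form_top_eigenvector:
  fixes a :: "nat \<Rightarrow> nat \<Rightarrow> real"
  assumes N: "0 < N" and sym: "\<And>i l. i < N \<Longrightarrow> l < N \<Longrightarrow> a i l = a l i"
  shows "\<exists>c x. (\<Sum>i<N. (x i)\<^sup>2) = 1 \<and> (\<forall>i<N. (\<Sum>l<N. a i l * x l) = c * x i) \<and>
    (\<forall>y. (\<Sum>i<N. \<Sum>l<N. a i l * y i * y l) \<le> c * (\<Sum>i<N. (y i)\<^sup>2))"
proof -
  let ?q = "\<lambda>y. \<Sum>i<N. \<Sum>l<N. a i l * y i * y l"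
  let ?n = "\<lambda>y :: nat \<Rightarrow> real. \<Sum>i<N. (y i)\<^sup>2"
  let ?B = "\<Pi>\<^sub>E i\<in>UNIV. if i < N then {-1..1} else {0 :: real}"
  let ?S = "?B \<inter> ?n -` {1}"
  have "compactin (product_topology (\<lambda>i. euclidean) UNIV) ?B"
    unfolding compactin_PiE by auto
  then have B: "compact ?B"
    by (simp add: euclidean_product_topology)
  have cn: "continuous_on UNIV ?n" 
    by (intro continuous_intros continuous_on_product_coordinates)
  have cq: "continuous_on UNIV ?q" 
    by (intro continuous_intros continuous_on_product_coordinates)
  have "closed (?n -` {1})"
    using closed_singleton cn by (rule closed_vimage)
  with B have S: "compact ?S" by (rule compact_Int_closed)
  have "(\<lambda>i. if i = 0 then 1 else 0) \<in> ?S"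
    using N by (auto simp: if_distrib[of "\<lambda>t. t\<^sup>2"] cong: if_cong)
  then have "?S \<noteq> {}" by blast
  from continuous_attains_sup[OF S this continuous_on_subset[OF cq]]
  obtain x where x: "x \<in> ?S" "\<And>y. y \<in> ?S \<Longrightarrow> ?q y \<le> ?q x" by auto
  define c where "c = ?q x"
  have nx: "?n x = 1" using x(1) by simp
  have bound: "?q y \<le> c * ?n y" for y
  proof (cases "?n y = 0")
    case True
    then have "y i = 0" if "i < N" for i
      using that by (simp add: sum_nonneg_eq_0_iff)
    then show ?thesis using True by simp
  next
    case False
    have n0: "0 < ?n y" using False by (simp add: order_le_neq_trans sum_nonneg)
    define s where "s = sqrt (?n y)"
    have s: "0 < s" "s\<^sup>2 = ?n y" using n0 by (auto simp: s_def)
    define z where "z i = (if i < N then y i / s else 0)" for i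
    have "?n z = ?n y / s\<^sup>2"
      unfolding sum_divide_distrib by (rule sum.cong) (auto simp: z_def power_divide)
    then have nz: "?n z = 1" using n0 s by simp
    have "\<bar>z i\<bar> \<le> 1" if "i < N" for i
    proof -
      have "(z i)\<^sup>2 \<le> ?n z" using that by (intro member_le_sum[of i _ "\<lambda>i. (z i)\<^sup>2"]) auto
      then show ?thesis using nz by (simp add: abs_square_le_1)
    qed
    then have "- 1 \<le> z i \<and> z i \<le> 1" if "i < N" for i using that by (simp add: abs_le_iff minus_le_iff)
    moreover have "z i = 0" if "\<not> i < N" for i using that by (simp add: z_def)
    ultimately have "z \<in> ?S" using nz by (auto simp: PiE_def Pi_def)
    then have "?q z \<le> c" unfolding c_def by (rule x(2))
    moreover have "?q z = ?q y / s\<^sup>2"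
      unfolding sum_divide_distrib by (intro sum.cong) (auto simp: z_def power2_eq_square)
    ultimately show ?thesis using n0 s by (simp add: divide_le_eq)
  qed
  define g where "g i = (\<Sum>l<N. a i l * x l) - c * x i" for i
  have "?n g = 0"
  proof (rule ccontr)
    assume "?n g \<noteq> 0"
    then have D: "0 < ?n g" by (simp add: order_le_neq_trans sum_nonneg)
    define m where "m = c * ?n g - ?q g"
    have *: "2 * s * ?n g \<le> s\<^sup>2 * m" for s
    proof -
      have cross: "(\<Sum>i<N. \<Sum>l<N. a i l * g i * x l) = (\<Sum>i<N. g i * (\<Sum>l<N. a i l * x l))"
        by (simp add: sum_distrib_left ac_simps)
      have cross': "(\<Sum>i<N. \<Sum>l<N. a i l * x i * g l) = (\<Sum>i<N. \<Sum>l<N. a i l * g i * x l)"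
        by (subst sum.swap) (intro sum.cong, auto simp: sym)
      have "?q (\<lambda>i. x i + s * g i) = ?q x + s * (\<Sum>i<N. \<Sum>l<N. a i l * x i * g l)
          + s * (\<Sum>i<N. \<Sum>l<N. a i l * g i * x l) + s\<^sup>2 * ?q g"
        by (simp add: algebra_simps sum.distrib sum_distrib_left power2_eq_square)
      also have "\<dots> = c + 2 * s * (\<Sum>i<N. g i * (\<Sum>l<N. a i l * x l)) + s\<^sup>2 * ?q g"
        unfolding cross' cross c_def by simp
      finally have 1: "?q (\<lambda>i. x i + s * g i) = \<dots>" .
      have "?n (\<lambda>i. x i + s * g i) = ?n x + 2 * s * (\<Sum>i<N. g i * x i) + s\<^sup>2 * ?n g"
        by (simp add: algebra_simps sum.distrib sum_distrib_left power2_eq_square)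
      then have 2: "?n (\<lambda>i. x i + s * g i) = 1 + 2 * s * (\<Sum>i<N. g i * x i) + s\<^sup>2 * ?n g"
        by (simp only: nx)
      have 3: "(\<Sum>i<N. g i * (\<Sum>l<N. a i l * x l)) = ?n g + c * (\<Sum>i<N. g i * x i)"
      proof -
        have "(\<Sum>l<N. a i l * x l) = g i + c * x i" for i by (simp add: g_def)
        then show ?thesis
          by (simp add: distrib_left sum.distrib sum_distrib_left power2_eq_square ac_simps)
      qed
      show ?thesis using bound[of "\<lambda>i. x i + s * g i"] unfolding 1 2 3 m_def
        by (simp add: algebra_simps)
    qed
    define s where "s = ?n g / (\<bar>m\<bar> + 1)"
    have s: "0 < s" using D by (simp add: s_def)
    have "2 * ?n g \<le> s * m" using *[of s] s by (simp add: power2_eq_square)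
    also have "\<dots> \<le> s * (\<bar>m\<bar> + 1)" using s by (intro mult_left_mono) auto
    also have "\<dots> = ?n g" by (simp add: s_def)
    finally show False using D by simp
  qed
  then have "g i = 0" if "i < N" for i
    using that by (simp add: sum_nonneg_eq_0_iff)
  then have "\<forall>i<N. (\<Sum>l<N. a i l * x l) = c * x i" by (simp add: g_def)
  with nx bound show ?thesis by (intro exI[of _ c] exI[of _ x]) simp
qed

lemma form_between_extreme_eigenvalues:
  fixes B :: "real mat"
  assumes B: "B \<in> carrier_mat N N" and N: "0 < N"
    and sym: "\<And>i l. i < N \<Longrightarrow> l < N \<Longrightarrow> B $$ (i, l) = B $$ (l, i)"
  shows "(\<Sum>i<N. \<Sum>l<N. B $$ (i, l) * y i * y l) \<le> lambda_max B * (\<Sum>i<N. (y i)\<^sup>2)"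
    and "lambda_min B * (\<Sum>i<N. (y i)\<^sup>2) \<le> (\<Sum>i<N. \<Sum>l<N. B $$ (i, l) * y i * y l)"
proof -
  have fin: "finite (spectrum B)" using card_finite_spectrum[OF B] by simp
  have eig: "c \<in> spectrum B"
    if "(\<Sum>i<N. (x i)\<^sup>2) = 1" "\<And>i. i < N \<Longrightarrow> (\<Sum>l<N. B $$ (i, l) * x l) = c * x i" for c x
  proof -
    have "vec N x \<noteq> 0\<^sub>v N"
    proof
      assume "vec N x = 0\<^sub>v N"
      then have "x i = 0" if "i < N" for i using that by (metis index_vec index_zero_vec(1))
      then show False using \<open>(\<Sum>i<N. (x i)\<^sup>2) = 1\<close> by simp
    qed
    moreover have "B *\<^sub>v vec N x = c \<cdot>\<^sub>v vec N x"
      using B that(2) by (intro eq_vecI) (auto simp: scalar_prod_def atLeast0LessThan)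
    ultimately have "eigenvector B (vec N x) c" using B by (simp add: eigenvector_def)
    then show ?thesis by (auto simp: spectrum_def eigenvalue_def)
  qed
  have n0: "0 \<le> (\<Sum>i<N. (y i)\<^sup>2)" by (simp add: sum_nonneg)
  have top: "\<exists>c x. (\<Sum>i<N. (x i)\<^sup>2) = 1 \<and> (\<forall>i<N. (\<Sum>l<N. B $$ (i, l) * x l) = c * x i) \<and>
      (\<forall>y. (\<Sum>i<N. \<Sum>l<N. B $$ (i, l) * y i * y l) \<le> c * (\<Sum>i<N. (y i)\<^sup>2))"
    by (rule symmetric_form_top_eigenvector[OF N]) (rule sym)
  have top': "\<exists>c x. (\<Sum>i<N. (x i)\<^sup>2) = 1 \<and> (\<forall>i<N. (\<Sum>l<N. - B $$ (i, l) * x l) = c * x i) \<and>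
      (\<forall>y. (\<Sum>i<N. \<Sum>l<N. - B $$ (i, l) * y i * y l) \<le> c * (\<Sum>i<N. (y i)\<^sup>2))"
    by (rule symmetric_form_top_eigenvector[OF N]) (simp add: sym)
  obtain c x where x: "(\<Sum>i<N. (x i)\<^sup>2) = 1 \<and> (\<forall>i<N. (\<Sum>l<N. B $$ (i, l) * x l) = c * x i) \<and>
    (\<forall>y. (\<Sum>i<N. \<Sum>l<N. B $$ (i, l) * y i * y l) \<le> c * (\<Sum>i<N. (y i)\<^sup>2))"
    using top by (elim exE) (rule that)
  have "c \<le> lambda_max B" unfolding lambda_max_def using fin eig[of x c] x by simp
  then show "(\<Sum>i<N. \<Sum>l<N. B $$ (i, l) * y i * y l) \<le> lambda_max B * (\<Sum>i<N. (y i)\<^sup>2)"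
    using x mult_right_mono[OF _ n0] by (meson order_trans)
  obtain c x where x: "(\<Sum>i<N. (x i)\<^sup>2) = 1 \<and> (\<forall>i<N. (\<Sum>l<N. - B $$ (i, l) * x l) = c * x i) \<and>
    (\<forall>y. (\<Sum>i<N. \<Sum>l<N. - B $$ (i, l) * y i * y l) \<le> c * (\<Sum>i<N. (y i)\<^sup>2))"
    using top' by (elim exE) (rule that)
  then have x1: "(\<Sum>i<N. (x i)\<^sup>2) = 1"
    and x3: "(\<Sum>i<N. \<Sum>l<N. - B $$ (i, l) * y i * y l) \<le> c * (\<Sum>i<N. (y i)\<^sup>2)" by blast+
  have "(\<Sum>l<N. B $$ (i, l) * x l) = - c * x i" if "i < N" for i
  proof -
    have "- (\<Sum>l<N. B $$ (i, l) * x l) = c * x i" using x that by (simp add: sum_negf)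
    then show ?thesis by linarith
  qed
  then have "lambda_min B \<le> - c" unfolding lambda_min_def using fin eig[OF x1] by simp
  then have "lambda_min B * (\<Sum>i<N. (y i)\<^sup>2) \<le> - c * (\<Sum>i<N. (y i)\<^sup>2)"
    using n0 by (rule mult_right_mono)
  then show "lambda_min B * (\<Sum>i<N. (y i)\<^sup>2) \<le> (\<Sum>i<N. \<Sum>l<N. B $$ (i, l) * y i * y l)"
    using x3 by (simp add: sum_negf)
qed

lemma proj_perp_carrier: "proj_perp N \<in> carrier_mat N N"
  unfolding proj_perp_def by (auto simp: ones_def)

lemma proj_perp_index:
  assumes "i < N" "l < N"
  shows "proj_perp N $$ (i, l) = (if i = l then 1 else 0) - 1 / real N"
  using assms by (simp add: proj_perp_def ones_def scalar_prod_def mat_of_cols_def mat_of_rows_def)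

lemma mult_mat_index_sum:
  assumes "X \<in> carrier_mat N N" "Y \<in> carrier_mat N N" "i < N" "l < N"
  shows "(X * Y) $$ (i, l) = (\<Sum>m<N. X $$ (i, m) * Y $$ (m, l))"
  using assms by (simp add: scalar_prod_def atLeast0LessThan)

text \<open>Regularity makes \<open>ones\<close> an eigenvector of the interaction matrix, so the compression subtracts the
  same constant from every entry.\<close>

lemma compress_perp_index:
  assumes reg: "regular_graph k {..<N} E" and i: "i < N" and l: "l < N"
  shows "compress_perp (interaction_mat \<beta> N E) $$ (i, l)
    = (if (i, l) \<in> E then \<beta> else 0) - \<beta> * real k / real N"
proof -
  let ?A = "interaction_mat \<beta> N E" and ?P = "proj_perp N"
  have A: "?A \<in> carrier_mat N N" by (simp add: interaction_mat_def)
  have nb: "E `` {v} \<subseteq> {..<N}" "card (E `` {v}) = k" if "v < N" for v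
    using reg that by (auto simp: regular_graph_def simple_graph_def)
  have row: "(\<Sum>m<N. if (v, m) \<in> E then \<beta> else 0) = \<beta> * real k" if "v < N" for v
  proof -
    have "(\<Sum>m<N. if (v, m) \<in> E then \<beta> else 0) = (\<Sum>m\<in>E `` {v}. \<beta>)"
      using nb(1)[OF that] by (intro sum.mono_neutral_cong_right) auto
    then show ?thesis using nb(2)[OF that] by (simp add: mult.commute)
  qed
  have "sym E" using reg by (simp add: regular_graph_def simple_graph_def)
  then have sym: "(m, v) \<in> E \<longleftrightarrow> (v, m) \<in> E" for m v by (blast dest: symD)
  have col: "(\<Sum>m<N. if (m, v) \<in> E then \<beta> else 0) = \<beta> * real k" if "v < N" for v
    unfolding sym[of _ v] by (rule row[OF that])
  have PA: "(?P * ?A) $$ (u, v) = (if (u, v) \<in> E then \<beta> else 0) - \<beta> * real k / real N"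
    if "u < N" "v < N" for u v
  proof -
    have "(?P * ?A) $$ (u, v) = (\<Sum>m<N. ((if u = m then 1 else 0) - 1 / real N) * (if (m, v) \<in> E then \<beta> else 0))"
      using that A proj_perp_carrier[of N]
      by (simp add: scalar_prod_def atLeast0LessThan proj_perp_index interaction_mat_def)
    also have "\<dots> = (\<Sum>m<N. if u = m then (if (m, v) \<in> E then \<beta> else 0) else 0)
        - (1 / real N) * (\<Sum>m<N. if (m, v) \<in> E then \<beta> else 0)"
      unfolding sum_distrib_left sum_subtractf[symmetric] by (rule sum.cong) (auto simp: algebra_simps)
    finally show ?thesis using that by (simp add: col)
  qed
  have "compress_perp ?A $$ (i, l) = (\<Sum>m<N. (?P * ?A) $$ (i, m) * ?P $$ (m, l))"
  proof -
    have "compress_perp ?A = (?P * ?A) * ?P" using A by (simp add: compress_perp_def)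
    moreover have "?P * ?A \<in> carrier_mat N N" using A proj_perp_carrier by (rule mult_carrier_mat[rotated])
    ultimately show ?thesis using mult_mat_index_sum[OF _ proj_perp_carrier i l] by metis
  qed
  also have "\<dots> = (\<Sum>m<N. ((if (i, m) \<in> E then \<beta> else 0) - \<beta> * real k / real N)
      * ((if m = l then 1 else 0) - 1 / real N))"
    using i l by (intro sum.cong) (auto simp: PA proj_perp_index)
  also have "\<dots> = (\<Sum>m<N. if m = l then (if (i, m) \<in> E then \<beta> else 0) - \<beta> * real k / real N else 0)
      - (1 / real N) * ((\<Sum>m<N. if (i, m) \<in> E then \<beta> else 0) - (\<Sum>m<N. \<beta> * real k / real N))"
    unfolding sum_distrib_left sum_subtractf[symmetric] by (rule sum.cong) (auto simp: algebra_simps)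
  also have "\<dots> = (if (i, l) \<in> E then \<beta> else 0) - \<beta> * real k / real N"
    using i l by (simp add: row)
  finally show ?thesis .
qed

lemma compress_perp_form:
  assumes reg: "regular_graph k {..<N} E"
  shows "(\<Sum>i<N. \<Sum>l<N. compress_perp (interaction_mat \<beta> N E) $$ (i, l) * x i * x l)
    = \<beta> * (\<Sum>(i, l)\<in>E. x i * x l) - \<beta> * real k / real N * (\<Sum>i<N. x i)\<^sup>2"
proof -
  have sub: "E \<subseteq> {..<N} \<times> {..<N}" using reg by (simp add: regular_graph_def simple_graph_def)
  have "(\<Sum>i<N. \<Sum>l<N. compress_perp (interaction_mat \<beta> N E) $$ (i, l) * x i * x l)
      = (\<Sum>i<N. \<Sum>l<N. \<beta> * (if (i, l) \<in> E then x i * x l else 0) - \<beta> * real k / real N * (x i * x l))"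
    by (intro sum.cong) (auto simp: compress_perp_index[OF reg] algebra_simps)
  also have "\<dots> = \<beta> * (\<Sum>i<N. \<Sum>l<N. if (i, l) \<in> E then x i * x l else 0)
      - \<beta> * real k / real N * (\<Sum>i<N. \<Sum>l<N. x i * x l)"
    by (simp only: sum_subtractf sum_distrib_left)
  also have "(\<Sum>i<N. \<Sum>l<N. if (i, l) \<in> E then x i * x l else 0) = (\<Sum>(i, l)\<in>E. x i * x l)"
    unfolding sum.cartesian_product using sub
    by (intro sum.mono_neutral_cong_right) auto
  also have "(\<Sum>i<N. \<Sum>l<N. x i * x l) = (\<Sum>i<N. x i)\<^sup>2"
    by (simp add: power2_eq_square sum_product)
  finally show ?thesis .
qed

text \<open>The quadratic form of the compressed matrix.\<close>

definition perp_form :: "real \<Rightarrow> nat \<Rightarrow> nat \<Rightarrow> nat rel \<Rightarrow> (nat \<Rightarrow> real) \<Rightarrow> real" where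
  "perp_form \<beta> k N E x =
    \<beta> * (\<Sum>(i, l)\<in>E. x i * x l) - \<beta> * real k / real N * (\<Sum>i<N. x i)\<^sup>2"

lemma spectral_window:
  fixes I :: "real set"
  assumes reg: "regular_graph k {..<N} E" and N: "0 < N" and I: "bounded I"
    and eig: "lambda_max (compress_perp (interaction_mat \<beta> N E)) \<in> I"
      "lambda_min (compress_perp (interaction_mat \<beta> N E)) \<in> I"
  shows "\<exists>p. \<forall>x. 0 \<le> perp_form \<beta> k N E x + p * (\<Sum>i<N. (x i)\<^sup>2) \<and>
    perp_form \<beta> k N E x + p * (\<Sum>i<N. (x i)\<^sup>2) \<le> diameter I * (\<Sum>i<N. (x i)\<^sup>2)"
proof -
  let ?B = "compress_perp (interaction_mat \<beta> N E)"
  have B: "?B \<in> carrier_mat N N"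
    using proj_perp_carrier[of N] unfolding compress_perp_def interaction_mat_def
    by (auto intro!: mult_carrier_mat)
  have "sym E" using reg by (simp add: regular_graph_def simple_graph_def)
  then have "(i, l) \<in> E \<longleftrightarrow> (l, i) \<in> E" for i l by (blast dest: symD)
  then have sym: "?B $$ (i, l) = ?B $$ (l, i)" if "i < N" "l < N" for i l
    using that by (simp add: compress_perp_index[OF reg])
  have bd: "lambda_min ?B * (\<Sum>i<N. (x i)\<^sup>2) \<le> perp_form \<beta> k N E x" "perp_form \<beta> k N E x \<le> lambda_max ?B * (\<Sum>i<N. (x i)\<^sup>2)" for x
    using form_between_extreme_eigenvalues[OF B N sym, of x] unfolding compress_perp_form[OF reg] perp_form_def by simp_all
  have "dist (lambda_max ?B) (lambda_min ?B) \<le> diameter I"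
    using I eig by (rule diameter_bounded_bound)
  then have d: "lambda_max ?B - lambda_min ?B \<le> diameter I" by (simp add: dist_real_def)
  have "0 \<le> perp_form \<beta> k N E x + - lambda_min ?B * (\<Sum>i<N. (x i)\<^sup>2) \<and>
      perp_form \<beta> k N E x + - lambda_min ?B * (\<Sum>i<N. (x i)\<^sup>2) \<le> diameter I * (\<Sum>i<N. (x i)\<^sup>2)" for x
  proof -
    have "(lambda_max ?B - lambda_min ?B) * (\<Sum>i<N. (x i)\<^sup>2) \<le> diameter I * (\<Sum>i<N. (x i)\<^sup>2)"
      using d by (intro mult_right_mono sum_nonneg) auto
    then show ?thesis using bd[of x] by (simp add: left_diff_distrib)
  qed
  then show ?thesis by blast
qed

lemma poincare_scale:
  assumes "c \<noteq> 0" "poincare V (\<lambda>\<sigma>. c * w \<sigma>) K"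
  shows "poincare V w K"
  using assms(2) unfolding poincare_def var_def by (simp add: avg_scale[OF assms(1)])

lemma poincare_cong:
  assumes "\<And>\<sigma>. \<sigma> \<in> cube V \<Longrightarrow> w \<sigma> = w' \<sigma>"
  shows "poincare V w K \<longleftrightarrow> poincare V w' K"
proof -
  have "avg (cube V) w f = avg (cube V) w' f" for f
    unfolding avg_def using assms by (metis (mono_tags, lifting) sum.cong)
  then show ?thesis unfolding poincare_def var_def by simp
qed

lemma ising_poincare:
  assumes reg: "regular_graph k {..<N} E"
    and window: "\<And>x. 0 \<le> perp_form \<beta> k N E x + p * (\<Sum>i<N. (x i)\<^sup>2)"
      "\<And>x. perp_form \<beta> k N E x + p * (\<Sum>i<N. (x i)\<^sup>2) \<le> j * (\<Sum>i<N. (x i)\<^sup>2)"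
    and j: "0 \<le> j" "j < 1" and t: "0 \<le> t" "t \<le> 1"
  shows "poincare {..<N} (\<lambda>\<sigma>. exp (t * (perp_form \<beta> k N E \<sigma> / 2))) (2 / (1 - j))"
proof -
  let ?B = "compress_perp (interaction_mat \<beta> N E)"
  define J where "J i l = t * (?B $$ (i, l) + (if i = l then p else 0))" for i l
  have "sym E" using reg by (simp add: regular_graph_def simple_graph_def)
  then have "(i, l) \<in> E \<longleftrightarrow> (l, i) \<in> E" for i l by (blast dest: symD)
  then have sym: "J i l = J l i" if "i < N" "l < N" for i l
    using that by (simp add: J_def compress_perp_index[OF reg])
  have form: "(\<Sum>i<N. \<Sum>l<N. J i l * x i * x l) = t * (perp_form \<beta> k N E x + p * (\<Sum>i<N. (x i)\<^sup>2))" for x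
  proof -
    have "(\<Sum>i<N. \<Sum>l<N. J i l * x i * x l)
        = t * ((\<Sum>i<N. \<Sum>l<N. ?B $$ (i, l) * x i * x l)
          + (\<Sum>i<N. \<Sum>l<N. if i = l then p * (x i)\<^sup>2 else 0))"
      unfolding sum_distrib_left sum.distrib[symmetric]
      by (intro sum.cong) (auto simp: J_def algebra_simps power2_eq_square)
    also have "(\<Sum>i<N. \<Sum>l<N. if i = l then p * (x i)\<^sup>2 else 0) = p * (\<Sum>i<N. (x i)\<^sup>2)"
      by (simp add: sum_distrib_left)
    finally show ?thesis unfolding compress_perp_form[OF reg] perp_form_def .
  qed
  have "poincare {..<N} (\<lambda>\<sigma>. exp ((\<Sum>i<N. \<Sum>l<N. J i l * \<sigma> i * \<sigma> l) / 2)) (2 / (1 - j))"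
  proof (rule poincare_quadratic)
    fix x
    let ?y = "perp_form \<beta> k N E x + p * (\<Sum>i<N. (x i)\<^sup>2)"
    show "0 \<le> (\<Sum>i<N. \<Sum>l<N. J i l * x i * x l)"
      unfolding form using t window(1) by simp
    have "t * ?y \<le> 1 * ?y" using t window(1) by (intro mult_right_mono)
    then show "(\<Sum>i<N. \<Sum>l<N. J i l * x i * x l) \<le> j * (\<Sum>i<N. (x i)\<^sup>2)"
      unfolding form using window(2)[of x] by simp
  qed (use sym j in auto)
  moreover have "exp ((\<Sum>i<N. \<Sum>l<N. J i l * \<sigma> i * \<sigma> l) / 2) = exp (t * p * real N / 2) * exp (t * (perp_form \<beta> k N E \<sigma> / 2))"
    if "\<sigma> \<in> cube {..<N}" for \<sigma>
  proof -
    have "(\<Sum>i<N. (\<sigma> i)\<^sup>2) = (\<Sum>i<N. 1)"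
      using cube_sq[OF that] by (intro sum.cong) (auto simp: power2_eq_square)
    then show ?thesis unfolding form exp_add[symmetric] by (simp add: algebra_simps add_divide_distrib)
  qed
  ultimately have "poincare {..<N} (\<lambda>\<sigma>. exp (t * p * real N / 2) * exp (t * (perp_form \<beta> k N E \<sigma> / 2))) (2 / (1 - j))"
    using poincare_cong by (metis (no_types, lifting))
  then show ?thesis by (rule poincare_scale[rotated]) simp
qed

text \<open>The forms at \<open>a + u\<close> and \<open>a - u\<close> differ by at most \<open>j\<close> times the common squared norm.  With \<open>u\<close> the
  indicator of the neighbourhood of a vertex and \<open>a\<close> the multiple \<open>sqrt k\<close> of the indicator of
  that vertex, edges inside the neighbourhood cancel and the edges at the vertex remain.\<close>

lemma degree_bound:
  assumes reg: "regular_graph k {..<N} E" and N: "0 < N" and k: "0 < k"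
    and window: "\<And>x. 0 \<le> perp_form \<beta> k N E x + p * (\<Sum>i<N. (x i)\<^sup>2)"
      "\<And>x. perp_form \<beta> k N E x + p * (\<Sum>i<N. (x i)\<^sup>2) \<le> j * (\<Sum>i<N. (x i)\<^sup>2)"
  shows "2 * \<beta> * sqrt (real k) * (1 - real k / real N) \<le> j"
proof -
  define s where "s = sqrt (real k)"
  have s: "0 < s" "s\<^sup>2 = real k" using k by (auto simp: s_def)
  define nb where "nb = E `` {0}"
  have sub: "E \<subseteq> {..<N} \<times> {..<N}" and symE: "sym E" and irr: "irrefl E"
    and deg: "finite nb" "card nb = k"
    using reg N by (auto simp: regular_graph_def simple_graph_def nb_def)
  have finE: "finite E" using sub by (meson finite_SigmaI finite_lessThan finite_subset)
  have nbN: "nb \<subseteq> {..<N}" "0 \<notin> nb" using sub irr by (auto simp: nb_def irrefl_def)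
  define a where "a i = (if i = 0 then s else 0)" for i :: nat
  define u where "u i = (if i \<in> nb then 1 else 0 :: real)" for i
  let ?n = "\<lambda>x :: nat \<Rightarrow> real. \<Sum>i<N. (x i)\<^sup>2"
  have sum_a: "(\<Sum>i<N. a i) = s" using N by (simp add: a_def)
  have sum_u: "(\<Sum>i<N. u i) = real k"
  proof -
    have "(\<Sum>i<N. u i) = (\<Sum>i\<in>nb. 1)"
      unfolding u_def using nbN by (intro sum.mono_neutral_cong_right) auto
    then show ?thesis using deg by simp
  qed
  have norm: "?n (\<lambda>i. a i + e * u i) = s\<^sup>2 + real k" if "e * e = 1" for e
  proof -
    have "?n (\<lambda>i. a i + e * u i) = (\<Sum>i<N. (if i = 0 then s\<^sup>2 else 0) + u i)"
      using nbN that by (intro sum.cong) (auto simp: a_def u_def power2_eq_square)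
    also have "\<dots> = s\<^sup>2 + real k" using N sum_u by (simp add: sum.distrib)
    finally show ?thesis .
  qed
  have cross: "(\<Sum>(i, l)\<in>E. a i * u l) = s * real k"
  proof -
    have "(\<Sum>(i, l)\<in>E. a i * u l) = (\<Sum>(i, l)\<in>{0 :: nat} \<times> nb. s)"
      by (rule sum.mono_neutral_cong_right) (use finE in \<open>auto simp: a_def u_def nb_def split: if_splits\<close>)
    then show ?thesis using deg by simp
  qed
  have cross': "(\<Sum>(i, l)\<in>E. u i * a l) = (\<Sum>(i, l)\<in>E. a i * u l)"
    by (rule sum.reindex_bij_witness[of _ "\<lambda>(x, y). (y, x)" "\<lambda>(x, y). (y, x)"])
      (use symE in \<open>auto dest: symD\<close>)
  have "(\<Sum>(i, l)\<in>E. (a i + u i) * (a l + u l)) - (\<Sum>(i, l)\<in>E. (a i + (-1) * u i) * (a l + (-1) * u l))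
      = 2 * (\<Sum>(i, l)\<in>E. a i * u l) + 2 * (\<Sum>(i, l)\<in>E. u i * a l)"
    unfolding sum_distrib_left sum_subtractf[symmetric] sum.distrib[symmetric]
    by (rule sum.cong) (auto simp: algebra_simps)
  then have edge: "(\<Sum>(i, l)\<in>E. (a i + u i) * (a l + u l))
      - (\<Sum>(i, l)\<in>E. (a i + (-1) * u i) * (a l + (-1) * u l)) = 4 * (s * real k)"
    unfolding cross' cross by simp
  have mag: "(\<Sum>i<N. a i + e * u i) = s + e * real k" for e
    unfolding sum.distrib sum_a sum_distrib_left[symmetric] sum_u ..
  have "perp_form \<beta> k N E (\<lambda>i. a i + 1 * u i) - perp_form \<beta> k N E (\<lambda>i. a i + (-1) * u i) \<le> j * (s\<^sup>2 + real k)"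
    using window(2)[of "\<lambda>i. a i + 1 * u i"] window(1)[of "\<lambda>i. a i + (-1) * u i"]
      norm[of 1] norm[of "-1"] by simp
  moreover have "perp_form \<beta> k N E (\<lambda>i. a i + 1 * u i) - perp_form \<beta> k N E (\<lambda>i. a i + (-1) * u i)
      = \<beta> * (4 * (s * real k)) - \<beta> * real k / real N * (4 * (s * real k))"
    unfolding perp_form_def mag using edge by (simp add: algebra_simps power2_eq_square)
  ultimately have "(2 * real k) * (2 * \<beta> * s * (1 - real k / real N)) \<le> (2 * real k) * j"
    using s by (simp add: algebra_simps)
  then show ?thesis using k unfolding s_def by simp
qed

section \<open>Edge correlations\<close>

lemma exp_minus_one_bound:
  fixes x :: real
  shows "\<bar>exp x - 1\<bar> \<le> \<bar>x\<bar> * exp \<bar>x\<bar>"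
proof (cases "0 \<le> x")
  case True
  have "1 - x \<le> exp (- x)" using exp_ge_add_one_self[of "- x"] by simp
  then have "(1 - x) * exp x \<le> exp (- x) * exp x" by (intro mult_right_mono) auto
  then show ?thesis using True by (simp add: algebra_simps exp_minus)
next
  case False
  then have "\<bar>exp x - 1\<bar> = 1 - exp x" "\<bar>x\<bar> = - x" by simp_all
  then have "\<bar>exp x - 1\<bar> \<le> \<bar>x\<bar> * 1" using exp_ge_add_one_self[of x] by linarith
  also have "\<dots> \<le> \<bar>x\<bar> * exp \<bar>x\<bar>" by (intro mult_left_mono) auto
  finally show ?thesis .
qed

lemma avg_odd:
  assumes "\<And>\<sigma>. w (- \<sigma>) = w \<sigma>" "\<And>\<sigma>. f (- \<sigma>) = - f \<sigma>"
  shows "avg (cube V) w f = 0"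
proof -
  have "(\<Sum>\<sigma>\<in>cube V. w \<sigma> * f \<sigma>) = (\<Sum>\<sigma>\<in>cube V. w (- \<sigma>) * f (- \<sigma>))"
    by (rule sum_cube_uminus[symmetric])
  then have "(\<Sum>\<sigma>\<in>cube V. w \<sigma> * f \<sigma>) = 0" unfolding assms by (simp add: sum_negf)
  then show ?thesis by (simp add: avg_def)
qed

lemma avg_abs_le_sqrt:
  assumes "pos_weight S w" "avg S w (\<lambda>s. (f s)\<^sup>2) \<le> c"
  shows "avg S w (\<lambda>s. \<bar>f s\<bar>) \<le> sqrt c"
proof -
  have "(avg S w (\<lambda>s. \<bar>f s\<bar>))\<^sup>2 \<le> c"
    using avg_Cauchy_Schwarz[OF assms(1), of "\<lambda>_. 1" "\<lambda>s. \<bar>f s\<bar>"] assms(2)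
    by (simp add: avg_const[OF assms(1)])
  then show ?thesis by (rule real_le_rsqrt)
qed

lemma magnetization_second_moment:
  assumes V: "finite V" and w: "pos_weight (cube V) w" and P: "poincare V w K"
    and sym: "\<And>\<sigma>. w (- \<sigma>) = w \<sigma>"
  shows "avg (cube V) w (\<lambda>\<sigma>. (\<Sum>i\<in>V. \<sigma> i)\<^sup>2) \<le> K * real (card V)"
proof -
  let ?M = "lin V (\<lambda>_. 1)"
  have "avg (cube V) w ?M = 0" by (rule avg_odd) (simp_all add: sym lin_def sum_negf)
  then have "avg (cube V) w (\<lambda>\<sigma>. (?M \<sigma>)\<^sup>2) = var (cube V) w ?M" by (simp add: var_def)
  also have "\<dots> \<le> K * avg (cube V) w (dirichlet V ?M)" by (rule poincareD[OF P])
  also have "avg (cube V) w (dirichlet V ?M) = avg (cube V) w (\<lambda>_. real (card V))"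
    by (rule avg_cong) (simp add: dirichlet_lin[OF V])
  finally show ?thesis by (simp add: lin_def avg_const[OF w])
qed

text \<open>Replacing the square of the magnetization by the square of its part outside the inner vertices
  changes the weight by a factor \<open>exp \<kappa>\<close> and makes \<open>edge_conditional_mean\<close> applicable.  The first
  term of the bound is the mean size of the message, the second one the effect of \<open>\<kappa>\<close>, which is
  of order \<open>1 / sqrt N\<close> when \<open>a\<close> is of order \<open>1 / N\<close>: on average \<open>\<kappa>\<close> is bounded by \<open>a\<close> times
  the size of the magnetization, up to factors depending on \<open>r\<close>.\<close>

lemma edge_correlation:
  fixes E :: "'a rel"
  assumes V: "finite V" and reg: "regular_graph k V E" and b: "0 \<le> b" and a: "0 \<le> a"
    and P: "poincare V (\<lambda>\<sigma>. exp (b * pair_energy E \<sigma> - a * (\<Sum>i\<in>V. \<sigma> i)\<^sup>2)) K" and K: "0 \<le> K"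
    and e: "(i, j) \<in> E" and tl: "treelike E r i j"
    and q: "real (k - 1) * (tanh b / (1 - (tanh b)\<^sup>2))\<^sup>2 \<le> 1 / 2"
  defines "u \<equiv> real ((k + 1) ^ r)" and "N \<equiv> real (card V)"
  shows "\<bar>avg (cube V) (\<lambda>\<sigma>. exp (b * pair_energy E \<sigma> - a * (\<Sum>i\<in>V. \<sigma> i)\<^sup>2)) (\<lambda>\<sigma>. \<sigma> i * \<sigma> j) - tanh b\<bar>
    \<le> 2 * sqrt (K * (1 / 2) ^ r) + 2 * (exp (3 * a * u * N) * (a * u * (2 * sqrt (K * N) + u)))"
proof -
  let ?M = "\<lambda>\<sigma>. \<Sum>i\<in>V. \<sigma> i :: real"
  define w where "w \<sigma> = exp (b * pair_energy E \<sigma> - a * (?M \<sigma>)\<^sup>2)" for \<sigma>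
  let ?A = "avg (cube V) w"
  let ?X = "message E (tanh b) r i j"
  define \<theta> where "\<theta> = tanh b"
  have \<theta>: "0 \<le> \<theta>" "\<theta> < 1" using b by (auto simp: tanh_real_lt_1 \<theta>_def)
  have sub: "E \<subseteq> V \<times> V" using edges_subset[OF V reg] .
  have ij: "i \<in> V" "j \<in> V" using e sub by auto
  have pw: "pos_weight (cube V) w" by (rule pos_weight_cube[OF V]) (simp add: w_def)
  have P': "poincare V w K" using P unfolding w_def .
  have pe_sym: "pair_energy E (- \<sigma>) = pair_energy E \<sigma>" for \<sigma>
    by (simp add: pair_energy_def)
  have w_sym: "w (- \<sigma>) = w \<sigma>" for \<sigma>
    unfolding w_def pe_sym by (simp add: sum_negf)
  have N0: "0 \<le> N" and u0: "0 \<le> u" by (auto simp: N_def u_def)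
  have M2: "?A (\<lambda>\<sigma>. (?M \<sigma>)\<^sup>2) \<le> K * N"
    unfolding N_def by (rule magnetization_second_moment[OF V pw P' w_sym])
  define U where "U = branch_inner E r i j"
  have UV: "U \<subseteq> V" unfolding U_def
    using branch_inner_subset[of E r i j] branch_subset[OF sub ij(2)] by blast
  have cU: "real (card U) \<le> u" "real (card U) \<le> N"
  proof -
    have "card U \<le> (k + 1) ^ r"
      unfolding U_def using card_branch_inner[OF sub degree[OF V reg] ij(2)] by blast
    then show "real (card U) \<le> u" unfolding u_def by (rule of_nat_mono)
    show "real (card U) \<le> N" unfolding N_def using card_mono[OF V UV] by simp
  qed
  define \<kappa> where "\<kappa> \<sigma> = a * ((?M \<sigma>)\<^sup>2 - (\<Sum>i\<in>V - U. \<sigma> i)\<^sup>2)" for \<sigma> :: "'a \<Rightarrow> real"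
  have kappa: "\<bar>\<kappa> \<sigma>\<bar> \<le> a * u * (2 * \<bar>?M \<sigma>\<bar> + u)" "\<bar>\<kappa> \<sigma>\<bar> \<le> 3 * a * u * N"
    if \<sigma>: "\<sigma> \<in> cube V" for \<sigma>
  proof -
    let ?m = "\<Sum>i\<in>U. \<sigma> i"
    have bd: "\<bar>\<Sum>i\<in>W. \<sigma> i\<bar> \<le> real (card W)" if "W \<subseteq> V" for W
    proof -
      have "\<bar>\<Sum>i\<in>W. \<sigma> i\<bar> \<le> (\<Sum>i\<in>W. \<bar>\<sigma> i\<bar>)" by (rule sum_abs)
      also have "\<dots> = (\<Sum>i\<in>W. 1)" using that cube_abs[OF \<sigma>] by (intro sum.cong) auto
      finally show ?thesis by simp
    qed
    have m: "\<bar>?m\<bar> \<le> u" "\<bar>?m\<bar> \<le> N" using bd[OF UV] cU by linarith+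
    have M: "\<bar>?M \<sigma>\<bar> \<le> N" using bd[of V] by (simp add: N_def)
    have outer: "(\<Sum>i\<in>V - U. \<sigma> i) = ?M \<sigma> - ?m" by (rule sum_diff[OF V UV])
    have "\<kappa> \<sigma> = a * (?m * (2 * ?M \<sigma> - ?m))"
      unfolding \<kappa>_def outer by (simp add: power2_eq_square algebra_simps)
    then have eq: "\<bar>\<kappa> \<sigma>\<bar> = a * (\<bar>?m\<bar> * \<bar>2 * ?M \<sigma> - ?m\<bar>)" using a by (simp add: abs_mult)
    have "\<bar>?m\<bar> * \<bar>2 * ?M \<sigma> - ?m\<bar> \<le> u * (2 * \<bar>?M \<sigma>\<bar> + u)"
      using m u0 by (intro mult_mono) linarith+
    from mult_left_mono[OF this a] show "\<bar>\<kappa> \<sigma>\<bar> \<le> a * u * (2 * \<bar>?M \<sigma>\<bar> + u)"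
      unfolding eq by (simp add: mult.assoc)
    have "\<bar>?m\<bar> * \<bar>2 * ?M \<sigma> - ?m\<bar> \<le> u * (3 * N)"
      using m M u0 by (intro mult_mono) linarith+
    from mult_left_mono[OF this a] show "\<bar>\<kappa> \<sigma>\<bar> \<le> 3 * a * u * N"
      unfolding eq by (simp add: ac_simps)
  qed
  define y where "y \<sigma> = \<sigma> i * ?X \<sigma>" for \<sigma>
  define G where "G \<sigma> = (\<theta> + y \<sigma>) / (1 + \<theta> * y \<sigma>)" for \<sigma>
  have X1: "\<bar>?X \<sigma>\<bar> \<le> 1" if "\<sigma> \<in> cube V" for \<sigma>
    using message_bound[OF V reg \<theta>[unfolded \<theta>_def] that ij(2)] .
  have yX: "\<bar>y \<sigma>\<bar> = \<bar>?X \<sigma>\<bar>" if "\<sigma> \<in> cube V" for \<sigma>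
    unfolding y_def using cube_abs[OF that ij(1)] by (simp add: abs_mult)
  have den: "1 - \<theta> \<le> 1 + \<theta> * y \<sigma>" if \<sigma>: "\<sigma> \<in> cube V" for \<sigma>
  proof -
    have "\<theta> * \<bar>y \<sigma>\<bar> \<le> \<theta> * 1" using X1[OF \<sigma>] yX[OF \<sigma>] \<theta> by (intro mult_left_mono) auto
    then have "\<bar>\<theta> * y \<sigma>\<bar> \<le> \<theta>" using \<theta> by (simp add: abs_mult)
    then show ?thesis by linarith
  qed
  have G1: "\<bar>G \<sigma>\<bar> \<le> 1" if \<sigma>: "\<sigma> \<in> cube V" for \<sigma>
  proof -
    have d: "0 < 1 + \<theta> * y \<sigma>" using den[OF \<sigma>] \<theta> by linarith
    have "0 \<le> (1 - \<theta>) * (1 - y \<sigma>)" "0 \<le> (1 + \<theta>) * (1 + y \<sigma>)"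
      using X1[OF \<sigma>] yX[OF \<sigma>] \<theta> by (auto intro!: mult_nonneg_nonneg)
    then have "\<theta> + y \<sigma> \<le> 1 + \<theta> * y \<sigma>" "- (1 + \<theta> * y \<sigma>) \<le> \<theta> + y \<sigma>" by (auto simp: algebra_simps)
    then show ?thesis unfolding G_def using d by (simp add: abs_le_iff divide_simps)
  qed
  have Gth: "\<bar>G \<sigma> - \<theta>\<bar> \<le> 2 * \<bar>?X \<sigma>\<bar>" if \<sigma>: "\<sigma> \<in> cube V" for \<sigma>
  proof -
    have d: "0 < 1 + \<theta> * y \<sigma>" using den[OF \<sigma>] \<theta> by linarith
    have "G \<sigma> - \<theta> = y \<sigma> * ((1 - \<theta>) * (1 + \<theta>)) / (1 + \<theta> * y \<sigma>)"
      unfolding G_def using d by (simp add: field_simps)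
    then have "\<bar>G \<sigma> - \<theta>\<bar> = \<bar>?X \<sigma>\<bar> * (1 + \<theta>) * ((1 - \<theta>) / (1 + \<theta> * y \<sigma>))"
      using d \<theta> yX[OF \<sigma>] by (simp add: abs_mult)
    also have "\<dots> \<le> \<bar>?X \<sigma>\<bar> * (1 + \<theta>) * 1"
      using d \<theta> den[OF \<sigma>] by (intro mult_left_mono) auto
    also have "\<dots> \<le> \<bar>?X \<sigma>\<bar> * 2" using \<theta> by (simp add: mult_left_mono)
    finally show ?thesis by simp
  qed
  have zero: "?A (\<lambda>\<sigma>. exp (\<kappa> \<sigma>) * (\<sigma> i * \<sigma> j - G \<sigma>)) = 0"
  proof -
    define R where "R \<sigma> = exp (- a * (\<Sum>i\<in>V - U. \<sigma> i)\<^sup>2)" for \<sigma> :: "'a \<Rightarrow> real"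
    have "R (flip x \<sigma>) = R \<sigma>" if "x \<in> branch_inner E r i j" for x \<sigma>
    proof -
      have "(\<Sum>i\<in>V - U. flip x \<sigma> i) = (\<Sum>i\<in>V - U. \<sigma> i)"
        using that by (intro sum.cong) (auto simp: flip_def U_def)
      then show ?thesis by (simp add: R_def)
    qed
    then have "(\<Sum>\<sigma>\<in>cube V. exp (b * pair_energy E \<sigma>) * R \<sigma> * (\<sigma> i * \<sigma> j - G \<sigma>)) = 0"
      unfolding G_def y_def \<theta>_def by (intro edge_conditional_mean[OF V reg b e tl]) auto
    moreover have "w \<sigma> * (exp (\<kappa> \<sigma>) * (\<sigma> i * \<sigma> j - G \<sigma>))
        = exp (b * pair_energy E \<sigma>) * R \<sigma> * (\<sigma> i * \<sigma> j - G \<sigma>)" for \<sigma>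
    proof -
      have "w \<sigma> * exp (\<kappa> \<sigma>) = exp (b * pair_energy E \<sigma>) * R \<sigma>"
        unfolding w_def \<kappa>_def R_def exp_add[symmetric] by (simp add: algebra_simps)
      then show ?thesis by (simp only: mult.assoc[symmetric])
    qed
    ultimately have "(\<Sum>\<sigma>\<in>cube V. w \<sigma> * (exp (\<kappa> \<sigma>) * (\<sigma> i * \<sigma> j - G \<sigma>))) = 0"
      by (simp only:)
    then show ?thesis unfolding avg_def by simp
  qed
  have "\<bar>?A (\<lambda>\<sigma>. \<sigma> i * \<sigma> j - G \<sigma>)\<bar> = \<bar>?A (\<lambda>\<sigma>. (\<sigma> i * \<sigma> j - G \<sigma>) - exp (\<kappa> \<sigma>) * (\<sigma> i * \<sigma> j - G \<sigma>))\<bar>"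
    unfolding avg_diff[of _ _ _ "\<lambda>\<sigma>. exp (\<kappa> \<sigma>) * (\<sigma> i * \<sigma> j - G \<sigma>)"] zero by simp
  also have "\<dots> \<le> ?A (\<lambda>\<sigma>. \<bar>(\<sigma> i * \<sigma> j - G \<sigma>) - exp (\<kappa> \<sigma>) * (\<sigma> i * \<sigma> j - G \<sigma>)\<bar>)"
    by (rule avg_abs[OF pw])
  also have "\<dots> \<le> ?A (\<lambda>\<sigma>. (2 * (exp (3 * a * u * N) * (a * u))) * (2 * \<bar>?M \<sigma>\<bar> + u))"
  proof (rule avg_mono[OF pw])
    fix \<sigma> assume \<sigma>: "\<sigma> \<in> cube V"
    have "\<bar>\<sigma> i * \<sigma> j\<bar> \<le> 1" using cube_abs[OF \<sigma> ij(1)] cube_abs[OF \<sigma> ij(2)] by (simp add: abs_mult)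
    then have 1: "\<bar>\<sigma> i * \<sigma> j - G \<sigma>\<bar> \<le> 2" using G1[OF \<sigma>] by linarith
    have "\<bar>exp (\<kappa> \<sigma>) - 1\<bar> \<le> \<bar>\<kappa> \<sigma>\<bar> * exp \<bar>\<kappa> \<sigma>\<bar>" by (rule exp_minus_one_bound)
    also have "\<dots> \<le> (a * u * (2 * \<bar>?M \<sigma>\<bar> + u)) * exp (3 * a * u * N)"
      using kappa[OF \<sigma>] by (intro mult_mono) auto
    finally have 2: "\<bar>exp (\<kappa> \<sigma>) - 1\<bar> \<le> \<dots>" .
    have "(\<sigma> i * \<sigma> j - G \<sigma>) - exp (\<kappa> \<sigma>) * (\<sigma> i * \<sigma> j - G \<sigma>) = (\<sigma> i * \<sigma> j - G \<sigma>) * (1 - exp (\<kappa> \<sigma>))"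
      by (simp add: algebra_simps)
    then have "\<bar>(\<sigma> i * \<sigma> j - G \<sigma>) - exp (\<kappa> \<sigma>) * (\<sigma> i * \<sigma> j - G \<sigma>)\<bar>
        = \<bar>\<sigma> i * \<sigma> j - G \<sigma>\<bar> * \<bar>exp (\<kappa> \<sigma>) - 1\<bar>"
      by (simp add: abs_mult abs_minus_commute)
    also have "\<dots> \<le> 2 * ((a * u * (2 * \<bar>?M \<sigma>\<bar> + u)) * exp (3 * a * u * N))"
      using 1 2 by (intro mult_mono) auto
    finally show "\<bar>(\<sigma> i * \<sigma> j - G \<sigma>) - exp (\<kappa> \<sigma>) * (\<sigma> i * \<sigma> j - G \<sigma>)\<bar>
        \<le> (2 * (exp (3 * a * u * N) * (a * u))) * (2 * \<bar>?M \<sigma>\<bar> + u)"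
      by (simp only: ac_simps)
  qed
  also have "\<dots> = (2 * (exp (3 * a * u * N) * (a * u))) * (2 * ?A (\<lambda>\<sigma>. \<bar>?M \<sigma>\<bar>) + u)"
    by (simp only: avg_cmult avg_add avg_const[OF pw])
  also have "\<dots> \<le> (2 * (exp (3 * a * u * N) * (a * u))) * (2 * sqrt (K * N) + u)"
    using avg_abs_le_sqrt[OF pw M2] a u0 by (intro mult_left_mono) auto
  finally have first: "\<bar>?A (\<lambda>\<sigma>. \<sigma> i * \<sigma> j - G \<sigma>)\<bar>
      \<le> 2 * (exp (3 * a * u * N) * (a * u * (2 * sqrt (K * N) + u)))" by (simp only: mult.assoc)
  have X2: "?A (\<lambda>\<sigma>. (?X \<sigma>)\<^sup>2) \<le> K * (1 / 2) ^ r"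
  proof -
    have "?A ?X = 0" by (rule avg_odd) (rule w_sym, rule message_uminus[OF V reg])
    then have "?A (\<lambda>\<sigma>. (?X \<sigma>)\<^sup>2) = var (cube V) w ?X" by (simp add: var_def)
    also have "\<dots> \<le> K * ?A (dirichlet V ?X)" by (rule poincareD[OF P'])
    also have "?A (dirichlet V ?X) \<le> ?A (\<lambda>_. (1 / 2) ^ r)"
    proof (rule avg_mono[OF pw])
      fix \<sigma> assume \<sigma>: "\<sigma> \<in> cube V"
      have "dirichlet V ?X \<sigma> = (\<Sum>x\<in>V. (?X \<sigma> - ?X (flip x \<sigma>))\<^sup>2) / 4"
        by (simp add: dirichlet_def sum_divide_distrib)
      also have "\<dots> \<le> (4 * (real (k - 1) * (tanh b / (1 - (tanh b)\<^sup>2))\<^sup>2) ^ r) / 4"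
        using message_gradient[OF V reg \<theta>[unfolded \<theta>_def] \<sigma> e tl] by (rule divide_right_mono) simp
      also have "\<dots> \<le> (1 / 2) ^ r" using power_mono[OF q, of r] by simp
      finally show "dirichlet V ?X \<sigma> \<le> (1 / 2) ^ r" .
    qed
    finally show ?thesis using K by (simp add: avg_const[OF pw] mult_left_mono)
  qed
  have "\<bar>?A (\<lambda>\<sigma>. G \<sigma> - \<theta>)\<bar> \<le> ?A (\<lambda>\<sigma>. \<bar>G \<sigma> - \<theta>\<bar>)" by (rule avg_abs[OF pw])
  also have "\<dots> \<le> ?A (\<lambda>\<sigma>. 2 * \<bar>?X \<sigma>\<bar>)" by (rule avg_mono[OF pw]) (rule Gth)
  also have "\<dots> \<le> 2 * sqrt (K * (1 / 2) ^ r)"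
    unfolding avg_cmult using avg_abs_le_sqrt[OF pw X2] by simp
  finally have second: "\<bar>?A (\<lambda>\<sigma>. G \<sigma> - \<theta>)\<bar> \<le> 2 * sqrt (K * (1 / 2) ^ r)" .
  have "?A (\<lambda>\<sigma>. \<sigma> i * \<sigma> j) - \<theta> = ?A (\<lambda>\<sigma>. \<sigma> i * \<sigma> j - G \<sigma>) + ?A (\<lambda>\<sigma>. G \<sigma> - \<theta>)"
    by (simp add: avg_diff avg_const[OF pw])
  then show ?thesis using first second unfolding w_def[symmetric] \<theta>_def by linarith
qed

section \<open>The free energy\<close>

lemma tanh_le_self:
  fixes x :: real
  assumes "0 \<le> x"
  shows "tanh x \<le> x"
proof -
  have "0 - tanh 0 \<le> x - tanh x"
  proof (rule DERIV_nonneg_imp_nondecreasing[OF assms])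
    fix y :: real
    have "((\<lambda>x. x - tanh x) has_real_derivative 1 - (1 - (tanh y)\<^sup>2) * 1) (at y)"
      by (intro derivative_intros) (auto intro: cosh_real_pos less_imp_neq[symmetric])
    then show "\<exists>d. ((\<lambda>x. x - tanh x) has_real_derivative d) (at y) \<and> 0 \<le> d" by fastforce
  qed
  then show ?thesis by simp
qed

text \<open>From \<open>tanh b \<le> \<beta>\<close> and \<open>k \<ge> 3\<close> the square of \<open>tanh b\<close> is at most \<open>1/12\<close>, which leaves a
  factor of at most \<open>(1/4) (12/11)\<^sup>2\<close>.\<close>

lemma message_contraction:
  assumes k: "3 \<le> k" and b: "0 \<le> b" "b \<le> \<beta>" and \<beta>: "4 * real k * \<beta>\<^sup>2 \<le> 1"
  shows "real (k - 1) * (tanh b / (1 - (tanh b)\<^sup>2))\<^sup>2 \<le> 1 / 2"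
proof -
  define x where "x = (tanh b)\<^sup>2"
  have "tanh b \<le> \<beta>" using tanh_le_self[OF b(1)] b(2) by linarith
  then have "x \<le> \<beta>\<^sup>2" unfolding x_def using b(1) by (intro power_mono) auto
  then have kx: "4 * real k * x \<le> 1"
    using \<beta> mult_left_mono[of x "\<beta>\<^sup>2" "4 * real k"] by simp
  have x0: "0 \<le> x" by (simp add: x_def)
  have "12 * x \<le> 4 * real k * x" using k x0 by (intro mult_right_mono) auto
  then have "12 * x \<le> 1" using kx by (rule order_trans)
  then have x12: "x \<le> 1 / 12" by simp
  have "(11 / 12)\<^sup>2 \<le> (1 - x)\<^sup>2" using x12 by (intro power_mono) auto
  then have d: "121 / 144 \<le> (1 - x)\<^sup>2" by (simp add: power2_eq_square)
  have "real (k - 1) * (tanh b / (1 - (tanh b)\<^sup>2))\<^sup>2 = real (k - 1) * x / (1 - x)\<^sup>2"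
    by (simp add: x_def power_divide)
  also have "\<dots> \<le> (1 / 4) / (121 / 144)"
  proof (rule frac_le)
    have "real (k - 1) * x \<le> real k * x" using x0 by (intro mult_right_mono) auto
    then show "real (k - 1) * x \<le> 1 / 4" using kx by simp
  qed (use d in auto)
  also have "\<dots> \<le> 1 / 2" by simp
  finally show ?thesis .
qed

lemma perp_form_energy:
  assumes "regular_graph k {..<N} E"
  shows "perp_form \<beta> k N E \<sigma> / 2
    = \<beta> * pair_energy E \<sigma> - \<beta> * real k / (2 * real N) * (\<Sum>i<N. \<sigma> i)\<^sup>2"
  by (simp add: perp_form_def pair_energy_def diff_divide_distrib)

lemma sum_over_edges:
  fixes f :: "nat \<Rightarrow> real"
  assumes reg: "regular_graph k {..<N} E"
  shows "(\<Sum>(x, y)\<in>E. f x) = real k * (\<Sum>x<N. f x)"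
proof -
  note ctx = finite_lessThan reg
  have "E = Sigma {..<N} (\<lambda>x. E `` {x})" using edges_subset[OF ctx] by auto
  then have "(\<Sum>(x, y)\<in>E. f x) = (\<Sum>(x, y)\<in>Sigma {..<N} (\<lambda>x. E `` {x}). f x)" by simp
  also have "\<dots> = (\<Sum>x<N. \<Sum>y\<in>E `` {x}. f x)"
    using finite_nbrs[OF ctx] by (subst sum.Sigma) auto
  also have "\<dots> = (\<Sum>x<N. real k * f x)"
    using degree[OF ctx] by (intro sum.cong) auto
  finally show ?thesis by (simp add: sum_distrib_left)
qed

lemma card_cube: "finite V \<Longrightarrow> card (cube V) = 2 ^ card V"
proof (induction V rule: finite_induct)
  case (insert a V)
  have "card (cube (insert a V)) = (\<Sum>\<sigma>\<in>cube (insert a V). 1)" by simp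
  also have "\<dots> = card (cube V) + card (cube V)"
    using insert by (subst sum_cube_insert) auto
  finally show ?case using insert by simp
qed (simp add: cube_empty)

definition perp_partition :: "real \<Rightarrow> nat \<Rightarrow> nat \<Rightarrow> nat rel \<Rightarrow> real" where
  "perp_partition \<beta> k N E = (\<Sum>\<sigma>\<in>cube {..<N}. exp (perp_form \<beta> k N E \<sigma> / 2))"

definition correlation_error :: "real \<Rightarrow> real \<Rightarrow> nat \<Rightarrow> nat \<Rightarrow> nat \<Rightarrow> real" where
  "correlation_error \<beta> K k r N = 2 * sqrt (K * (1 / 2) ^ r) +
    2 * (exp (3 / 2 * \<beta> * real k * real ((k + 1) ^ r)) *
      (\<beta> * real k / (2 * real N) * real ((k + 1) ^ r) * (2 * sqrt (K * real N) + real ((k + 1) ^ r))))"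

text \<open>At every \<open>t\<close> the derivative of the free energy is compared with that of the claimed limit, edge by
  edge.  Edges starting at a vertex without tree neighbourhood contribute at most 2 each.\<close>

lemma perp_free_energy:
  fixes r :: nat
  assumes reg: "regular_graph k {..<N} E" and N: "0 < N" and k: "3 \<le> k" and \<beta>: "0 \<le> \<beta>"
    and \<beta>k: "4 * real k * \<beta>\<^sup>2 \<le> 1" and j: "0 \<le> j" "j < 1"
    and window: "\<And>x. 0 \<le> perp_form \<beta> k N E x + p * (\<Sum>i<N. (x i)\<^sup>2)"
      "\<And>x. perp_form \<beta> k N E x + p * (\<Sum>i<N. (x i)\<^sup>2) \<le> j * (\<Sum>i<N. (x i)\<^sup>2)"
  defines "K \<equiv> 2 / (1 - j)"
    and "good \<equiv> {v \<in> {..<N}. balls_isomorphic (Suc r) E v (tree_edges k) []}"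
  shows "\<bar>ln (perp_partition \<beta> k N E) / real N - (ln 2 + real k / 2 * ln (cosh \<beta>))\<bar>
    \<le> \<beta> * real k / 2 * correlation_error \<beta> K k r N + \<beta> * real k * (1 - real (card good) / real N)
      + \<beta> * real k * K / (2 * real N)"
proof -
  note ctx = finite_lessThan reg
  let ?C = "cube {..<N}" and ?Q = "\<lambda>\<sigma>. perp_form \<beta> k N E \<sigma> / 2"
  let ?M = "\<lambda>\<sigma>. \<Sum>i<N. \<sigma> i :: real"
  define w where "w t \<sigma> = exp (t * ?Q \<sigma>)" for t \<sigma>
  define Z where "Z t = (\<Sum>\<sigma>\<in>?C. w t \<sigma>)" for t
  define g where "g t = ln (Z t) / real N - ln 2 - real k / 2 * ln (cosh (t * \<beta>))" for t
  define g' where "g' t = avg ?C (w t) ?Q / real N - real k / 2 * (\<beta> * tanh (t * \<beta>))" for t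
  let ?err = "correlation_error \<beta> K k r N"
  let ?bound = "\<beta> * real k / 2 * ?err + \<beta> * real k * (1 - real (card good) / real N)
      + \<beta> * real k * K / (2 * real N)"
  have K0: "0 < K" using j by (simp add: K_def)
  have pw: "pos_weight ?C (w t)" for t by (rule pos_weight_cube) (auto simp: w_def)
  have Z0: "0 < Z t" for t unfolding Z_def by (rule pos_weight_sum[OF pw])
  have deriv: "(g has_real_derivative g' t) (at t)" for t
  proof -
    have "(Z has_real_derivative (\<Sum>\<sigma>\<in>?C. w t \<sigma> * ?Q \<sigma>)) (at t)"
      unfolding Z_def w_def by (auto intro!: derivative_eq_intros sum.cong)
    moreover have "((\<lambda>t. cosh (t * \<beta>)) has_real_derivative sinh (t * \<beta>) * \<beta>) (at t)"
      by (auto intro!: derivative_eq_intros)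
    moreover have "avg ?C (w t) ?Q = (\<Sum>\<sigma>\<in>?C. w t \<sigma> * ?Q \<sigma>) / Z t"
      by (simp add: avg_def Z_def)
    ultimately show ?thesis
      unfolding g_def g'_def using Z0[of t] N cosh_real_pos[of "t * \<beta>"]
      by (auto intro!: derivative_eq_intros simp: tanh_def field_simps)
  qed
  have slope: "\<bar>g' t\<bar> \<le> ?bound" if t: "0 \<le> t" "t \<le> 1" for t
  proof -
    define b where "b = t * \<beta>"
    define a where "a = t * (\<beta> * real k / (2 * real N))"
    let ?A = "avg ?C (w t)" and ?\<theta> = "tanh b"
    have b: "0 \<le> b" "b \<le> \<beta>" using t \<beta> mult_right_mono[of t 1 \<beta>] by (auto simp: b_def)
    have a: "0 \<le> a" "a \<le> \<beta> * real k / (2 * real N)"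
      using t \<beta> mult_right_mono[of t 1 "\<beta> * real k / (2 * real N)"] by (auto simp: a_def)
    have w_eq: "w t = (\<lambda>\<sigma>. exp (b * pair_energy E \<sigma> - a * (?M \<sigma>)\<^sup>2))"
      unfolding w_def perp_form_energy[OF reg] a_def b_def by (simp add: algebra_simps)
    have P: "poincare {..<N} (w t) K"
      unfolding w_def K_def using ising_poincare[OF reg window j t] .
    have w_sym: "w t (- \<sigma>) = w t \<sigma>" for \<sigma>
      unfolding w_eq by (simp add: pair_energy_def sum_negf)
    have M2: "?A (\<lambda>\<sigma>. (?M \<sigma>)\<^sup>2) \<le> K * real N" "0 \<le> ?A (\<lambda>\<sigma>. (?M \<sigma>)\<^sup>2)"
      using magnetization_second_moment[OF finite_lessThan pw P w_sym] by (auto intro: avg_nonneg[OF pw])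
    have corr: "\<bar>?A (\<lambda>\<sigma>. \<sigma> x * \<sigma> y) - ?\<theta>\<bar> \<le> ?err + (if x \<in> good then 0 else 2)"
      if e: "(x, y) \<in> E" for x y
    proof (cases "x \<in> good")
      case True
      then have "balls_isomorphic (Suc r) E x (tree_edges k) []" by (simp add: good_def)
      then have "treelike E r x y" using e by (rule balls_isomorphic_treelike)
      from edge_correlation[OF ctx b(1) a(1) P[unfolded w_eq] _ e this message_contraction[OF k b \<beta>k]]
      have "\<bar>?A (\<lambda>\<sigma>. \<sigma> x * \<sigma> y) - ?\<theta>\<bar> \<le> 2 * sqrt (K * (1 / 2) ^ r) +
        2 * (exp (3 * a * real ((k + 1) ^ r) * real N) *
          (a * real ((k + 1) ^ r) * (2 * sqrt (K * real N) + real ((k + 1) ^ r))))"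
        unfolding w_eq using K0 by simp
      also have "\<dots> \<le> ?err"
        unfolding correlation_error_def
      proof (intro add_left_mono mult_left_mono mult_mono mult_right_mono)
        have "3 * a * real ((k + 1) ^ r) * real N
            = 3 * (a * (2 * real N)) * real ((k + 1) ^ r) / 2" by simp
        also have "\<dots> \<le> 3 * (\<beta> * real k / (2 * real N) * (2 * real N)) * real ((k + 1) ^ r) / 2"
          using a by (intro divide_right_mono mult_right_mono mult_left_mono) auto
        also have "\<dots> = 3 / 2 * \<beta> * real k * real ((k + 1) ^ r)" using N by simp
        finally show "exp (3 * a * real ((k + 1) ^ r) * real N) \<le> exp (3 / 2 * \<beta> * real k * real ((k + 1) ^ r))"
          by simp
      qed (use a K0 \<beta> in \<open>auto intro!: mult_nonneg_nonneg add_nonneg_nonneg\<close>)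
      finally show ?thesis using True by simp
    next
      case False
      have xy: "x < N" "y < N" using e edges_subset[OF ctx] by auto
      have "\<bar>?A (\<lambda>\<sigma>. \<sigma> x * \<sigma> y)\<bar> \<le> ?A (\<lambda>\<sigma>. \<bar>\<sigma> x * \<sigma> y\<bar>)" by (rule avg_abs[OF pw])
      also have "\<dots> = ?A (\<lambda>_. 1)"
        by (rule avg_cong) (use xy in \<open>simp add: abs_mult cube_abs\<close>)
      finally have "\<bar>?A (\<lambda>\<sigma>. \<sigma> x * \<sigma> y)\<bar> \<le> 1" by (simp add: avg_const[OF pw])
      moreover have "0 \<le> ?\<theta>" "?\<theta> < 1" using b by (auto simp: tanh_real_lt_1)
      moreover have "0 \<le> ?err" unfolding correlation_error_def using \<beta> K0
        by (auto intro!: add_nonneg_nonneg mult_nonneg_nonneg)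
      ultimately have "\<bar>?A (\<lambda>\<sigma>. \<sigma> x * \<sigma> y) - ?\<theta>\<bar> \<le> ?err + 2" by linarith
      then show ?thesis using False by simp
    qed
    have Q_avg: "?A ?Q = \<beta> / 2 * (\<Sum>(x, y)\<in>E. ?A (\<lambda>\<sigma>. \<sigma> x * \<sigma> y))
        - \<beta> * real k / (2 * real N) * ?A (\<lambda>\<sigma>. (?M \<sigma>)\<^sup>2)"
    proof -
      have "?A ?Q = ?A (\<lambda>\<sigma>. \<beta> / 2 * (\<Sum>e\<in>E. \<sigma> (fst e) * \<sigma> (snd e))
          - \<beta> * real k / (2 * real N) * (?M \<sigma>)\<^sup>2)"
        by (rule avg_cong)
          (simp add: perp_form_energy[OF reg] pair_energy_def split_def)
      then show ?thesis unfolding avg_diff avg_cmult avg_sum split_def .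
    qed
    have \<theta>_sum: "real k * real N * ?\<theta> = (\<Sum>(x, y)\<in>E. ?\<theta>)"
      unfolding sum_over_edges[OF reg, of "\<lambda>_. ?\<theta>"] by simp
    have "real N * g' t = ?A ?Q - \<beta> / 2 * (real k * real N * ?\<theta>)"
      unfolding g'_def b_def using N by (simp add: right_diff_distrib)
    also have "\<dots> = \<beta> / 2 * (\<Sum>(x, y)\<in>E. ?A (\<lambda>\<sigma>. \<sigma> x * \<sigma> y))
        - \<beta> * real k / (2 * real N) * ?A (\<lambda>\<sigma>. (?M \<sigma>)\<^sup>2) - \<beta> / 2 * (\<Sum>(x, y)\<in>E. ?\<theta>)"
      unfolding Q_avg \<theta>_sum ..
    also have "\<dots> = \<beta> / 2 * (\<Sum>(x, y)\<in>E. ?A (\<lambda>\<sigma>. \<sigma> x * \<sigma> y) - ?\<theta>)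
        - \<beta> * real k / (2 * real N) * ?A (\<lambda>\<sigma>. (?M \<sigma>)\<^sup>2)"
      by (simp add: split_def sum_subtractf algebra_simps)
    finally have g'_eq: "real N * g' t = \<dots>" .
    have "\<bar>\<Sum>(x, y)\<in>E. ?A (\<lambda>\<sigma>. \<sigma> x * \<sigma> y) - ?\<theta>\<bar> \<le> (\<Sum>(x, y)\<in>E. \<bar>?A (\<lambda>\<sigma>. \<sigma> x * \<sigma> y) - ?\<theta>\<bar>)"
      unfolding split_def by (rule sum_abs)
    also have "\<dots> \<le> (\<Sum>(x, y)\<in>E. ?err + (if x \<in> good then 0 else 2))"
      by (rule sum_mono) (use corr in auto)
    also have "\<dots> = real k * (\<Sum>x<N. ?err + (if x \<in> good then 0 else 2))"
      by (rule sum_over_edges[OF reg])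
    also have "(\<Sum>x<N. ?err + (if x \<in> good then 0 else 2)) = real N * ?err + 2 * (real N - real (card good))"
    proof -
      have gs: "good \<subseteq> {..<N}" by (auto simp: good_def)
      have "(\<Sum>x<N. if x \<in> good then 0 else 2 :: real) = (\<Sum>x\<in>{..<N} - good. 2)"
        by (rule sum.mono_neutral_cong_right) auto
      also have "\<dots> = 2 * real (card ({..<N} - good))" by simp
      also have "card ({..<N} - good) = N - card good" using gs by (simp add: card_Diff_subset finite_subset)
      also have "real (N - card good) = real N - real (card good)"
        using card_mono[OF _ gs] by (simp add: of_nat_diff)
      finally show ?thesis by (simp add: sum.distrib)
    qed
    finally have edges: "\<bar>\<Sum>(x, y)\<in>E. ?A (\<lambda>\<sigma>. \<sigma> x * \<sigma> y) - ?\<theta>\<bar>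
        \<le> real k * (real N * ?err + 2 * (real N - real (card good)))" .
    have "\<bar>real N * g' t\<bar> \<le> \<beta> / 2 * \<bar>\<Sum>(x, y)\<in>E. ?A (\<lambda>\<sigma>. \<sigma> x * \<sigma> y) - ?\<theta>\<bar>
        + \<beta> * real k / (2 * real N) * ?A (\<lambda>\<sigma>. (?M \<sigma>)\<^sup>2)"
      unfolding g'_eq using \<beta> M2(2)
      by (intro order_trans[OF abs_triangle_ineq4]) (auto simp: abs_mult)
    also have "\<dots> \<le> \<beta> / 2 * (real k * (real N * ?err + 2 * (real N - real (card good))))
        + \<beta> * real k / (2 * real N) * (K * real N)"
      using edges M2(1) \<beta> by (intro add_mono mult_left_mono) auto
    also have "\<dots> = real N * ?bound" using N by (simp add: field_simps)
    finally have "real N * \<bar>g' t\<bar> \<le> real N * ?bound" by (simp add: abs_mult)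
    then show ?thesis using N by simp
  qed
  have "\<exists>z>0. z < 1 \<and> g 1 - g 0 = (1 - 0) * g' z"
    by (rule MVT2) (use deriv in auto)
  then obtain z where z: "0 < z" "z < 1" "g 1 - g 0 = g' z" by auto
  have "Z 0 = 2 ^ N" by (simp add: Z_def w_def card_cube)
  then have "g 0 = 0" using N by (simp add: g_def ln_realpow)
  then have "\<bar>g 1\<bar> \<le> ?bound" using z slope[of z] by simp
  moreover have "g 1 = ln (perp_partition \<beta> k N E) / real N - (ln 2 + real k / 2 * ln (cosh \<beta>))"
    by (simp add: g_def Z_def w_def perp_partition_def)
  ultimately show ?thesis by simp
qed

lemma Z_b_eq:
  assumes reg: "regular_graph k {..<N} E"
  shows "Z_b (interaction_mat \<beta> N E) \<epsilon>
    = (\<Sum>\<sigma> | \<sigma> \<in> cube {..<N} \<and> \<bar>\<Sum>i<N. \<sigma> i\<bar> \<le> real N * \<epsilon>. exp (\<beta> * pair_energy E \<sigma>))"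
proof -
  note ctx = finite_lessThan reg
  let ?A = "interaction_mat \<beta> N E"
  have d: "dim_row ?A = N" by (simp add: interaction_mat_def)
  have sp: "scalar_prod (vec N \<sigma>) (ones N) = (\<Sum>i<N. \<sigma> i)" for \<sigma>
    by (simp add: scalar_prod_def ones_def atLeast0LessThan)
  have en: "scalar_prod (vec N \<sigma>) (?A *\<^sub>v vec N \<sigma>) / 2 = \<beta> * pair_energy E \<sigma>" for \<sigma>
  proof -
    have "scalar_prod (vec N \<sigma>) (?A *\<^sub>v vec N \<sigma>)
        = (\<Sum>i<N. \<Sum>l<N. if (i, l) \<in> E then \<beta> * (\<sigma> i * \<sigma> l) else 0)"
      by (simp add: scalar_prod_def interaction_mat_def atLeast0LessThan sum_distrib_left)
        (intro sum.cong, auto)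
    also have "\<dots> = (\<Sum>(i, l)\<in>E. \<beta> * (\<sigma> i * \<sigma> l))"
      unfolding sum.cartesian_product using edges_subset[OF ctx]
      by (intro sum.mono_neutral_cong_right) auto
    finally show ?thesis
      by (simp add: pair_energy_def sum_distrib_left split_def)
  qed
  show ?thesis
    unfolding Z_b_def d Let_def
  proof (rule sum.reindex_bij_witness[of _ "\<lambda>\<sigma>. vec N \<sigma>" "\<lambda>s i. if i < N then s $ i else 0"])
    fix s assume "s \<in> {\<sigma> \<in> spin_configs N. \<bar>scalar_prod \<sigma> (ones N)\<bar> \<le> real N * \<epsilon>}"
    then have s: "s \<in> carrier_vec N" "\<And>i. i < N \<Longrightarrow> s $ i \<in> {-1, 1}"
      "\<bar>scalar_prod s (ones N)\<bar> \<le> real N * \<epsilon>"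
      by (auto simp: spin_configs_def)
    let ?\<sigma> = "\<lambda>i. if i < N then s $ i else 0"
    show v: "vec N ?\<sigma> = s" using s(1) by (intro eq_vecI) auto
    show "?\<sigma> \<in> {\<sigma> \<in> cube {..<N}. \<bar>\<Sum>i<N. \<sigma> i\<bar> \<le> real N * \<epsilon>}"
      using s(2,3) sp[of ?\<sigma>] unfolding v by (auto simp: cube_def)
    show "exp (\<beta> * pair_energy E ?\<sigma>) = exp (scalar_prod s (?A *\<^sub>v s) / 2)"
      using en[of ?\<sigma>] unfolding v by simp
  next
    fix \<sigma> assume "\<sigma> \<in> {\<sigma> \<in> cube {..<N}. \<bar>\<Sum>i<N. \<sigma> i\<bar> \<le> real N * \<epsilon>}"
    then have \<sigma>: "\<sigma> \<in> cube {..<N}" "\<bar>\<Sum>i<N. \<sigma> i\<bar> \<le> real N * \<epsilon>" by auto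
    show "(\<lambda>i. if i < N then vec N \<sigma> $ i else 0) = \<sigma>"
      using \<sigma>(1) by (auto simp: cube_def)
    show "vec N \<sigma> \<in> {\<sigma> \<in> spin_configs N. \<bar>scalar_prod \<sigma> (ones N)\<bar> \<le> real N * \<epsilon>}"
      using \<sigma> sp[of \<sigma>] by (auto simp: spin_configs_def cube_def)
  qed
qed

text \<open>The upper bound holds because the balanced energy exceeds the form of the compressed matrix by a
  multiple of the squared magnetization, the lower bound because by Chebyshev's inequality the
  configurations outside the window have relative weight at most \<open>K / (N \<epsilon>\<^sup>2)\<close>.\<close>

lemma balanced_free_energy:
  assumes reg: "regular_graph k {..<N} E" and N: "0 < N" and \<beta>: "0 \<le> \<beta>" and j: "0 \<le> j" "j < 1"
    and window: "\<And>x. 0 \<le> perp_form \<beta> k N E x + p * (\<Sum>i<N. (x i)\<^sup>2)"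
      "\<And>x. perp_form \<beta> k N E x + p * (\<Sum>i<N. (x i)\<^sup>2) \<le> j * (\<Sum>i<N. (x i)\<^sup>2)"
    and \<epsilon>: "0 < \<epsilon>"
  defines "K \<equiv> 2 / (1 - j)"
  assumes small: "K < real N * \<epsilon>\<^sup>2"
  shows "\<bar>F_b (interaction_mat \<beta> N E) \<epsilon> - ln (perp_partition \<beta> k N E) / real N\<bar>
    \<le> \<beta> * real k * \<epsilon>\<^sup>2 / 2 - ln (1 - K / (real N * \<epsilon>\<^sup>2)) / real N"
proof -
  note ctx = finite_lessThan reg
  let ?C = "cube {..<N}" and ?M = "\<lambda>\<sigma>. \<Sum>i<N. \<sigma> i :: real"
  define w where "w \<sigma> = exp (perp_form \<beta> k N E \<sigma> / 2)" for \<sigma>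
  define Z where "Z = perp_partition \<beta> k N E"
  define B where "B = {\<sigma> \<in> ?C. \<bar>?M \<sigma>\<bar> \<le> real N * \<epsilon>}"
  let ?Zb = "Z_b (interaction_mat \<beta> N E) \<epsilon>"
  let ?c = "\<beta> * real k / (2 * real N)"
  have fC: "finite ?C" by (simp add: finite_cube)
  have B: "B \<subseteq> ?C" "finite B" using fC by (auto simp: B_def)
  have pw: "pos_weight ?C w" by (rule pos_weight_cube) (auto simp: w_def)
  have Z: "Z = (\<Sum>\<sigma>\<in>?C. w \<sigma>)" by (simp add: Z_def perp_partition_def w_def)
  have Z0: "0 < Z" unfolding Z by (rule pos_weight_sum[OF pw])
  have P: "poincare {..<N} w K"
    using ising_poincare[OF reg window j, of 1] by (simp add: w_def[abs_def] K_def)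
  have en: "exp (\<beta> * pair_energy E \<sigma>) = w \<sigma> * exp (?c * (?M \<sigma>)\<^sup>2)" for \<sigma>
    unfolding w_def perp_form_energy[OF reg] exp_add[symmetric] by simp
  have c0: "0 \<le> ?c" using \<beta> by simp
  have Zb: "?Zb = (\<Sum>\<sigma>\<in>B. w \<sigma> * exp (?c * (?M \<sigma>)\<^sup>2))"
    unfolding Z_b_eq[OF reg] B_def en ..
  have upper: "?Zb \<le> Z * exp (\<beta> * real k * real N * \<epsilon>\<^sup>2 / 2)"
  proof -
    have "w \<sigma> * exp (?c * (?M \<sigma>)\<^sup>2) \<le> w \<sigma> * exp (\<beta> * real k * real N * \<epsilon>\<^sup>2 / 2)"
      if "\<sigma> \<in> B" for \<sigma>
    proof -
      have "\<bar>?M \<sigma>\<bar>\<^sup>2 \<le> (real N * \<epsilon>)\<^sup>2" using that unfolding B_def by (intro power_mono) auto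
      then have "?c * (?M \<sigma>)\<^sup>2 \<le> ?c * (real N * \<epsilon>)\<^sup>2" using c0 by (intro mult_left_mono) auto
      also have "\<dots> = \<beta> * real k * real N * \<epsilon>\<^sup>2 / 2" using N by (simp add: power2_eq_square)
      finally show ?thesis by (simp add: w_def)
    qed
    then have "?Zb \<le> (\<Sum>\<sigma>\<in>B. w \<sigma> * exp (\<beta> * real k * real N * \<epsilon>\<^sup>2 / 2))"
      unfolding Zb by (rule sum_mono)
    also have "\<dots> \<le> (\<Sum>\<sigma>\<in>?C. w \<sigma> * exp (\<beta> * real k * real N * \<epsilon>\<^sup>2 / 2))"
      using fC B by (intro sum_mono2) (auto simp: w_def)
    finally show ?thesis by (simp add: Z sum_distrib_right)
  qed
  define \<delta> where "\<delta> = K / (real N * \<epsilon>\<^sup>2)"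
  have N\<epsilon>: "0 < real N * \<epsilon>\<^sup>2" using N \<epsilon> by simp
  have \<delta>: "\<delta> < 1" unfolding \<delta>_def using small N\<epsilon> by simp
  have lower: "Z * (1 - \<delta>) \<le> ?Zb"
  proof -
    have w_sym: "w (- \<sigma>) = w \<sigma>" for \<sigma>
      by (simp add: w_def perp_form_def sum_negf)
    have "(\<Sum>\<sigma>\<in>?C - B. w \<sigma>) * (real N * \<epsilon>)\<^sup>2 \<le> (\<Sum>\<sigma>\<in>?C - B. w \<sigma> * (?M \<sigma>)\<^sup>2)"
      unfolding sum_distrib_right
    proof (intro sum_mono mult_left_mono)
      fix \<sigma> assume "\<sigma> \<in> ?C - B"
      then have "(real N * \<epsilon>)\<^sup>2 \<le> \<bar>?M \<sigma>\<bar>\<^sup>2" using \<epsilon> by (intro power_mono) (auto simp: B_def)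
      then show "(real N * \<epsilon>)\<^sup>2 \<le> (?M \<sigma>)\<^sup>2" by simp
    qed (simp add: w_def)
    also have "\<dots> \<le> (\<Sum>\<sigma>\<in>?C. w \<sigma> * (?M \<sigma>)\<^sup>2)"
      using fC by (intro sum_mono2) (auto simp: w_def)
    also have "\<dots> = Z * avg ?C w (\<lambda>\<sigma>. (?M \<sigma>)\<^sup>2)" using Z0 by (simp add: avg_def Z)
    also have "\<dots> \<le> Z * (K * real N)"
      using magnetization_second_moment[OF finite_lessThan pw P w_sym] Z0 by (intro mult_left_mono) auto
    also have "\<dots> = Z * \<delta> * (real N * \<epsilon>)\<^sup>2"
      unfolding \<delta>_def using N \<epsilon> by (simp add: field_simps power2_eq_square)
    finally have "(\<Sum>\<sigma>\<in>?C - B. w \<sigma>) \<le> Z * \<delta>" using N \<epsilon> by simp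
    moreover have "Z = (\<Sum>\<sigma>\<in>?C - B. w \<sigma>) + (\<Sum>\<sigma>\<in>B. w \<sigma>)"
      unfolding Z by (rule sum.subset_diff[OF B(1) fC])
    moreover have "(\<Sum>\<sigma>\<in>B. w \<sigma>) \<le> ?Zb"
      unfolding Zb using \<beta> by (intro sum_mono) (simp add: w_def)
    ultimately show ?thesis by (simp add: algebra_simps)
  qed
  have Zb0: "0 < ?Zb" using lower Z0 \<delta> by (meson diff_gt_0_iff_gt less_le_trans mult_pos_pos)
  have F: "F_b (interaction_mat \<beta> N E) \<epsilon> = ln ?Zb / real N"
    by (simp add: F_b_def interaction_mat_def)
  have "ln ?Zb \<le> ln (Z * exp (\<beta> * real k * real N * \<epsilon>\<^sup>2 / 2))"
    using upper Zb0 Z0 by (subst ln_le_cancel_iff) auto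
  then have u: "ln ?Zb - ln Z \<le> real N * (\<beta> * real k * \<epsilon>\<^sup>2 / 2)"
    using Z0 by (simp add: ln_mult algebra_simps)
  have "ln (Z * (1 - \<delta>)) \<le> ln ?Zb"
    using lower Zb0 Z0 \<delta> by (subst ln_le_cancel_iff) auto
  then have l: "ln (1 - \<delta>) \<le> ln ?Zb - ln Z"
    using Z0 \<delta> by (simp add: ln_mult)
  have "0 \<le> \<delta>" unfolding \<delta>_def K_def using j N\<epsilon> by simp
  then have "ln (1 - \<delta>) \<le> 0" using \<delta> by simp
  moreover have "0 \<le> real N * (\<beta> * real k * \<epsilon>\<^sup>2 / 2)" using \<beta> by simp
  ultimately have "\<bar>ln ?Zb - ln Z\<bar> \<le> real N * (\<beta> * real k * \<epsilon>\<^sup>2 / 2) - ln (1 - \<delta>)"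
    using u l by linarith
  then have "\<bar>ln ?Zb - ln Z\<bar> / real N \<le> (real N * (\<beta> * real k * \<epsilon>\<^sup>2 / 2) - ln (1 - \<delta>)) / real N"
    by (rule divide_right_mono) simp
  moreover have "\<bar>ln ?Zb - ln Z\<bar> / real N = \<bar>ln ?Zb / real N - ln Z / real N\<bar>"
    by (simp add: diff_divide_distrib[symmetric])
  ultimately show ?thesis
    unfolding F Z_def[symmetric] \<delta>_def[symmetric] using N by (simp add: diff_divide_distrib)
qed

lemma along_infinite: "infinite S \<Longrightarrow> along S \<noteq> bot"
proof
  assume S: "infinite S" and "along S = bot"
  then have "eventually (\<lambda>_. False) (along S)" by simp
  then have "eventually (\<lambda>n. n \<notin> S) sequentially" by (simp add: eventually_inf_principal)
  then obtain n where "\<And>m. n \<le> m \<Longrightarrow> m \<notin> S" by (auto simp: eventually_sequentially)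
  then have "S \<subseteq> {..n}" by (meson atMost_iff nat_le_linear subsetI)
  then show False using S finite_subset by blast
qed

lemma tendsto_along: "f \<longlonglongrightarrow> l \<Longrightarrow> (f \<longlongrightarrow> l) (along S)"
  by (rule tendsto_mono[OF inf_le1])

theorem mainTheorem3:
  fixes k :: nat and \<beta> :: real
    and S :: "nat set" and E :: "nat \<Rightarrow> nat rel" and I :: "real set"
  assumes "k \<ge> 3" and "\<beta> \<ge> 0"
    and "infinite S" and "0 \<notin> S"
    and "\<And>N. N \<in> S \<Longrightarrow> regular_graph k {..<N} (E N)"
    and "converges_locally_to_tree k S E"
    and "is_interval I" and "bounded I" and "diameter I < 1"
    and "\<And>N. N \<in> S \<Longrightarrow>
      lambda_max (compress_perp (interaction_mat \<beta> N (E N))) \<in> I \<and>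
      lambda_min (compress_perp (interaction_mat \<beta> N (E N))) \<in> I"
  shows "\<exists>\<epsilon> :: nat \<Rightarrow> real. (\<forall>N\<in>S. 0 < \<epsilon> N \<and> \<epsilon> N < 1) \<and> (\<epsilon> \<longlongrightarrow> 0) (along S) \<and>
    ((\<lambda>N. F_b (interaction_mat \<beta> N (E N)) (\<epsilon> N)) \<longlongrightarrow> ln 2 + real k / 2 * ln (cosh \<beta>)) (along S)"
proof -
  define j where "j = diameter I"
  have j: "0 \<le> j" "j < 1" using assms(8,9) by (auto simp: j_def diameter_ge_0)
  define K where "K = 2 / (1 - j)"
  have K0: "0 < K" using j by (simp add: K_def)
  have reg: "regular_graph k {..<N} (E N)" if "N \<in> S" for N by (rule assms(5)[OF that])
  have pos: "0 < N" if "N \<in> S" for N using that assms(4) by (cases N) auto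
  have "\<forall>N\<in>S. \<exists>p. \<forall>x. 0 \<le> perp_form \<beta> k N (E N) x + p * (\<Sum>i<N. (x i)\<^sup>2) \<and>
      perp_form \<beta> k N (E N) x + p * (\<Sum>i<N. (x i)\<^sup>2) \<le> j * (\<Sum>i<N. (x i)\<^sup>2)"
    unfolding j_def using spectral_window[OF reg pos assms(8)] assms(10) by blast
  then obtain p where "\<forall>N\<in>S. \<forall>x. 0 \<le> perp_form \<beta> k N (E N) x + p N * (\<Sum>i<N. (x i)\<^sup>2) \<and>
      perp_form \<beta> k N (E N) x + p N * (\<Sum>i<N. (x i)\<^sup>2) \<le> j * (\<Sum>i<N. (x i)\<^sup>2)"
    by metis
  then have window: "\<And>x. 0 \<le> perp_form \<beta> k N (E N) x + p N * (\<Sum>i<N. (x i)\<^sup>2)"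
    "\<And>x. perp_form \<beta> k N (E N) x + p N * (\<Sum>i<N. (x i)\<^sup>2) \<le> j * (\<Sum>i<N. (x i)\<^sup>2)"
    if "N \<in> S" for N
    using that by blast+
  have in_S: "eventually (\<lambda>N. N \<in> S) (along S)" by (simp add: eventually_inf_principal)
  have "2 * \<beta> * sqrt (real k) * (1 - 0) \<le> j"
  proof (rule tendsto_le[OF along_infinite[OF assms(3)]])
    have "(\<lambda>N. real k / real N) \<longlonglongrightarrow> 0" by real_asymp
    from tendsto_along[OF this]
    show "((\<lambda>N. 2 * \<beta> * sqrt (real k) * (1 - real k / real N)) \<longlongrightarrow> 2 * \<beta> * sqrt (real k) * (1 - 0)) (along S)"
      by (intro tendsto_intros)
    show "((\<lambda>N. j) \<longlongrightarrow> j) (along S)" by (rule tendsto_const)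
    show "eventually (\<lambda>N. 2 * \<beta> * sqrt (real k) * (1 - real k / real N) \<le> j) (along S)"
      using in_S
    proof eventually_elim
      case (elim N)
      show ?case by (rule degree_bound[OF reg[OF elim] pos[OF elim] _ window[OF elim]]) (use assms(1) in simp)
    qed
  qed
  then have "2 * \<beta> * sqrt (real k) \<le> 1" using j by simp
  then have "(2 * \<beta> * sqrt (real k))\<^sup>2 \<le> 1\<^sup>2" using assms(2) by (intro power_mono) auto
  then have \<beta>k: "4 * real k * \<beta>\<^sup>2 \<le> 1" by (simp add: power_mult_distrib mult.commute mult.left_commute)
  \<comment> \<open>Any rate with \<open>\<epsilon> \<rightarrow> 0\<close> and \<open>N \<epsilon>\<^sup>2 \<rightarrow> \<infinity>\<close> would do.\<close>
  define \<epsilon> where "\<epsilon> N = 1 / sqrt (sqrt (real N))" for N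
  have \<epsilon>2: "real N * (\<epsilon> N)\<^sup>2 = sqrt (real N)" "(\<epsilon> N)\<^sup>2 = 1 / sqrt (real N)" if "0 < N" for N
  proof -
    show "(\<epsilon> N)\<^sup>2 = 1 / sqrt (real N)" by (simp add: \<epsilon>_def power_divide)
    then show "real N * (\<epsilon> N)\<^sup>2 = sqrt (real N)" using that by (simp add: real_div_sqrt)
  qed
  have \<epsilon>_range: "0 < \<epsilon> N \<and> \<epsilon> N < 1" if "N \<in> S" for N
  proof -
    have "k = card (E N `` {0})" and "E N `` {0} \<subseteq> {..<N}"
      using reg[OF that] pos[OF that] by (auto simp: regular_graph_def simple_graph_def)
    then have "k \<le> N" using card_mono[of "{..<N}" "E N `` {0}"] by simp
    then have "1 < N" using assms(1) by simp
    then show ?thesis by (simp add: \<epsilon>_def)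
  qed
  have \<epsilon>_lim: "(\<epsilon> \<longlongrightarrow> 0) (along S)"
    by (rule tendsto_along) (unfold \<epsilon>_def, real_asymp)
  let ?L = "ln 2 + real k / 2 * ln (cosh \<beta>)"
  let ?F = "\<lambda>N. F_b (interaction_mat \<beta> N (E N)) (\<epsilon> N)"
  let ?good = "\<lambda>r N. {v \<in> {..<N}. balls_isomorphic (Suc r) (E N) v (tree_edges k) []}"
  define rest where "rest r N = \<beta> * real k / 2 * (correlation_error \<beta> K k r N - 2 * sqrt (K * (1 / 2) ^ r))
      + \<beta> * real k * (1 - real (card (?good r N)) / real N) + \<beta> * real k * K / (2 * real N)
      + (\<beta> * real k * (1 / sqrt (real N)) / 2 - ln (1 - K / sqrt (real N)) / real N)" for r N
  have bound: "eventually (\<lambda>N. \<bar>?F N - ?L\<bar> \<le> \<beta> * real k * sqrt (K * (1 / 2) ^ r) + rest r N) (along S)" for r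
  proof -
    have "filterlim (\<lambda>N. sqrt (real N)) at_top sequentially" by real_asymp
    then have "eventually (\<lambda>N. K < sqrt (real N)) sequentially" by (simp add: filterlim_at_top_dense)
    then have "eventually (\<lambda>N. K < sqrt (real N)) (along S)" by (rule filter_leD[OF inf_le1])
    with in_S show ?thesis
    proof eventually_elim
      case (elim N)
      note N = pos[OF elim(1)]
      have "\<bar>?F N - ln (perp_partition \<beta> k N (E N)) / real N\<bar>
          \<le> \<beta> * real k * (1 / sqrt (real N)) / 2 - ln (1 - K / sqrt (real N)) / real N"
        using balanced_free_energy[OF reg[OF elim(1)] N assms(2) j window[OF elim(1)], of "\<epsilon> N", folded K_def]
          \<epsilon>_range[OF elim(1)] elim(2) unfolding \<epsilon>2(1)[OF N] unfolding \<epsilon>2(2)[OF N] by blast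
      moreover note perp_free_energy[OF reg[OF elim(1)] N assms(1,2) \<beta>k j window[OF elim(1)], of r, folded K_def]
      ultimately show ?case unfolding rest_def right_diff_distrib by simp
    qed
  qed
  have rest_lim: "(rest r \<longlongrightarrow> 0) (along S)" for r
  proof -
    define u where "u = real ((k + 1) ^ r)"
    define c where "c = 2 * exp (3 / 2 * \<beta> * real k * u)"
    have "(\<lambda>N. c * (\<beta> * real k / (2 * real N) * u * (2 * sqrt (K * real N) + u))) \<longlonglongrightarrow> 0"
      using K0 by real_asymp
    then have 1: "(\<lambda>N. correlation_error \<beta> K k r N - 2 * sqrt (K * (1 / 2) ^ r)) \<longlonglongrightarrow> 0"
      by (simp add: correlation_error_def c_def u_def mult.assoc)
    have 2: "(\<lambda>N. \<beta> * real k * K / (2 * real N)) \<longlonglongrightarrow> 0"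
      "(\<lambda>N. \<beta> * real k * (1 / sqrt (real N)) / 2 - ln (1 - K / sqrt (real N)) / real N) \<longlonglongrightarrow> 0"
      by real_asymp+
    have 3: "((\<lambda>N. real (card (?good r N)) / real N) \<longlongrightarrow> 1) (along S)"
      using assms(6) unfolding converges_locally_to_tree_def by blast
    have "(rest r \<longlongrightarrow> \<beta> * real k / 2 * 0 + \<beta> * real k * (1 - 1) + 0 + 0) (along S)"
      unfolding rest_def by (intro tendsto_intros tendsto_along[OF 1] tendsto_along[OF 2(1)] tendsto_along[OF 2(2)] 3)
    then show ?thesis by simp
  qed
  have "(?F \<longlongrightarrow> ?L) (along S)"
  proof (rule tendstoI)
    fix e :: real assume e: "0 < e"
    have "(\<lambda>r. \<beta> * real k * sqrt (K * (1 / 2) ^ r)) \<longlonglongrightarrow> \<beta> * real k * sqrt (K * 0)"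
      by (intro tendsto_intros LIMSEQ_power_zero) auto
    then have "eventually (\<lambda>r. \<beta> * real k * sqrt (K * (1 / 2) ^ r) < e / 2) sequentially"
      using e by (intro order_tendstoD) auto
    then obtain r where r: "\<beta> * real k * sqrt (K * (1 / 2) ^ r) < e / 2"
      by (auto simp: eventually_sequentially)
    have "eventually (\<lambda>N. rest r N < e / 2) (along S)"
      using e by (intro order_tendstoD(2)[OF rest_lim]) simp
    with bound[of r] show "eventually (\<lambda>N. dist (?F N) ?L < e) (along S)"
    proof eventually_elim
      case (elim N)
      then show ?case using r by (simp add: dist_real_def)
    qed
  qed
  with \<epsilon>_range \<epsilon>_lim show ?thesis by (intro exI[of _ \<epsilon>]) auto
qed

end
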